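(* Let $(\mu_k)$ be a sequence of non-negative Radon measures on $\mathbf{R}^d\setminus\{0\}$ such that $\lim_{k\to\infty}\mu_k(H_{\omega,p})=a(\omega,p)$ for almost all halfspaces $H_{\omega,p}$ with $\overline{H_{\omega,p}}\subset\mathbf{R}^d\setminus\{0\}$, where $a$ is rapidly decaying in the sense that $a(\omega,p)=O(|p|^{-m})$ as $p\to-\infty$ for all $m$. Then there exists a unique $\mu\in M_{\mathrm{loc}}(\mathbf{R}^d\setminus\{0\})$ such that $\lim_{k\to\infty}\int\varphi\,d\mu_k=\int\varphi\,d\mu$ for all bounded continuous $\varphi$ on $\mathbf{R}^d$ whose support is bounded away from the origin. The measure $\mu$ satisfies $R\mu=\partial_pa$ in $S^{d-1}\times\{p\in\mathbf{R}:p<0\}$.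
   Context: $H_{\omega,p}=\{x\in\mathbf{R}^d:x\cdot\omega<p\}$ (closure avoids $0$ iff $p<0$); "almost all" is with respect to surface measure on $S^{d-1}$ times Lebesgue measure. $M_{\mathrm{loc}}(\Omega)$ denotes signed Radon measures on $\Omega$. $R\mu$ on $S^{d-1}\times(-\infty,0)$: $\langle R\mu,\psi\rangle=\int R^*\psi\,d\mu$ for $\psi$ continuous with compact support in $S^{d-1}\times(-\infty,0)$, where $R^*\psi(x)=\int_{S^{d-1}}\psi(\omega,x\cdot\omega)\,d\omega$ (normalized surface measure). $\partial_pa$ is the distributional derivative in $p$. *)

theory Defs
  imports "HOL-Analysis.Analysis"
begin

definition halfspace :: "'a::euclidean_space \<Rightarrow> real \<Rightarrow> 'a set" where
  "halfspace \<omega> p = {x. x \<bullet> \<omega> < p}"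

text \<open>Non-negative Radon measure on R^d minus the origin, represented as a Borel
  measure on R^d giving no mass to the origin and finite mass to every compact set
  avoiding the origin.\<close>
definition radon0 :: "'a::euclidean_space measure \<Rightarrow> bool" where
  "radon0 M \<longleftrightarrow> sets M = sets borel \<and> emeasure M {0} = 0 \<and>
     (\<forall>K. compact K \<and> 0 \<notin> K \<longrightarrow> emeasure M K < \<infinity>)"

text \<open>Normalized surface measure on the unit sphere, defined as the cone measure:
  sigma(A) = Lebesgue measure of {t x : x in A, 0 < t <= 1} divided by the volume of the
  unit ball (image of the normalized Lebesgue measure on the ball under x / |x|).\<close>
definition sphere_measure :: "'a::euclidean_space measure" where
  "sphere_measure = distr (uniform_measure lborel (ball 0 1)) borel (\<lambda>x. x /\<^sub>R norm x)"

definition param_measure :: "('a::euclidean_space \<times> real) measure" where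
  "param_measure = completion (sphere_measure \<Otimes>\<^sub>M lborel)"

definition pdiff :: "'b::real_normed_vector \<Rightarrow> ('b \<Rightarrow> real) \<Rightarrow> 'b \<Rightarrow> real" where
  "pdiff v f x = (THE D. ((\<lambda>t. f (x + t *\<^sub>R v)) has_real_derivative D) (at 0))"

definition smooth_fun :: "('b::euclidean_space \<Rightarrow> real) \<Rightarrow> bool" where
  "smooth_fun f \<longleftrightarrow> (\<forall>vs. set vs \<subseteq> Basis \<longrightarrow>
      continuous_on UNIV (foldr pdiff vs f) \<and>
      (\<forall>v\<in>Basis. \<forall>x. (\<lambda>t. foldr pdiff vs f (x + t *\<^sub>R v)) differentiable (at 0)))"

text \<open>Test functions on S^{d-1} x (-inf,0): restrictions of smooth functions on R^d x R
  whose restriction to S^{d-1} x R has compact support contained in S^{d-1} x (-inf,0).\<close>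
definition test_fun :: "('a::euclidean_space \<times> real \<Rightarrow> real) \<Rightarrow> bool" where
  "test_fun \<psi> \<longleftrightarrow> smooth_fun \<psi> \<and>
     (\<exists>K. compact K \<and> K \<subseteq> sphere 0 1 \<times> {..<0} \<and>
          (\<forall>\<omega>\<in>sphere 0 1. \<forall>p. (\<omega>, p) \<notin> K \<longrightarrow> \<psi> (\<omega>, p) = 0))"

definition dp :: "('a::euclidean_space \<times> real \<Rightarrow> real) \<Rightarrow> 'a \<times> real \<Rightarrow> real" where
  "dp \<psi> = pdiff (0, 1) \<psi>"

definition Rstar :: "('a::euclidean_space \<times> real \<Rightarrow> real) \<Rightarrow> 'a \<Rightarrow> real" where
  "Rstar \<psi> x = (\<integral>\<omega>. \<psi> (\<omega>, x \<bullet> \<omega>) \<partial>sphere_measure)"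

definition admissible :: "('a::euclidean_space \<Rightarrow> real) \<Rightarrow> bool" where
  "admissible \<phi> \<longleftrightarrow> continuous_on UNIV \<phi> \<and> bounded (range \<phi>) \<and>
     (\<exists>r>0. \<forall>x. norm x < r \<longrightarrow> \<phi> x = 0)"

end

theory Submission
  imports Defs "HOL-Probability.Probability"
begin

text \<open>Finitely many halfspaces of convergence cover |x| >= r, so the measures are eventually bounded there, and
  the decay of a gives tightness and finite moments of the weak subsequential limits. The heart of the matter is
  that two such limits agree on |x| > r, i.e. a support theorem for the Radon transform. If two measures agree on
  the halfspaces x . w < p with p < -r, they agree on the ridge functions max 0 (x . w - g)^k for g > r |w|.
  Differentiating in w multiplies these by arbitrary polynomials P(x). Averaging over w against the projection of
  the uniform measure on a ball of odd dimension 2 d + 1 yields P(x) F(g, |x|), where F is polynomial in g for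
  g <= |x| and 0 for g >= |x|, so an iterated difference in g has compact support in x and is nonzero just
  outside |x| = r. By Stone-Weierstrass such products determine a measure on |x| > r. Hence the whole sequence
  converges on |x| > r, and the limits for different r can be glued.\<close>

section \<open>Ridge functions averaged over a ball\<close>

text \<open>Nothing is known about the masses near the origin, so every function that is tested has
  to vanish on a ball. This is the meaning of g > r |w|: such a ridge function only sees halfspaces
  that miss |x| \<le> r. The condition is open in (w, g), so derivatives in w of every order stay
  admissible. Decay of every order is essential: in the plane, the real part of z^(-k) with k \<ge>
  2 has vanishing integrals over all lines that miss the origin. Here it makes the integrals against
  arbitrary polynomials finite. The averaged profile is radial but grows at infinity, where
  polynomial approximation is impossible. Because it is a polynomial in g of a degree independent of
  x, one finite difference cuts it off for all large |x| at once; in even dimension the marginal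
  density of the ball would contain a square root. Convergence at almost all halfspaces suffices
  because ridge integrals, unlike halfspace masses, depend continuously on the direction: the good
  directions need only be dense, and offsets are compared through continuous cutoffs.\<close>

lemma orthogonal_transformation_exists_unit:
  fixes e e' :: "'b::euclidean_space"
  assumes "norm e = 1" "norm e' = 1"
  obtains T where "orthogonal_transformation T" "T e = e'"
proof -
  \<comment> \<open>\<open>T\<close> is the Householder reflection that exchanges the two unit
    vectors. For \<open>e = e'\<close> the quotient is a division by zero with value 0, so
    \<open>T\<close> is the identity.\<close>
  define n where "n = e - e'"
  define T where "T z = z - (2 * (z \<bullet> n) / (n \<bullet> n)) *\<^sub>R n" for z
  have lin: "linear T"
    by (rule linearI) (simp_all add: T_def inner_add_left inner_diff_left algebra_simps add_divide_distrib)
  have "T v \<bullet> T w = v \<bullet> w" for v w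
  proof (cases "n = 0")
    case False
    then have "n \<bullet> n \<noteq> 0" by simp
    then show ?thesis
      unfolding T_def by (simp add: inner_diff_left inner_diff_right inner_commute divide_simps algebra_simps)
  qed (simp add: T_def)
  then have orth: "orthogonal_transformation T"
    using lin by (simp add: orthogonal_transformation_def)
  have ee: "e \<bullet> e = 1" "e' \<bullet> e' = 1"
    using assms by (simp_all add: norm_eq_1)
  have nn: "n \<bullet> n = 2 * (e \<bullet> n)"
    unfolding n_def by (simp add: inner_diff_left inner_diff_right inner_commute ee)
  have "T e = e'"
  proof (cases "n = 0")
    case False
    then have "n \<bullet> n \<noteq> 0" by simp
    then have "T e = e - n" unfolding T_def using nn by simp
    then show ?thesis by (simp add: n_def)
  qed (simp add: T_def n_def)
  with orth show ?thesis by (rule that)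
qed

lemma nn_integral_lborel_translate:
  fixes g :: "'b::euclidean_space \<Rightarrow> ennreal"
  assumes [measurable]: "g \<in> borel_measurable borel"
  shows "(\<integral>\<^sup>+x. g (c + x) \<partial>lborel) = (\<integral>\<^sup>+x. g x \<partial>lborel)"
proof -
  have "(\<integral>\<^sup>+x. g x \<partial>lborel) = (\<integral>\<^sup>+x. g x \<partial>distr lborel borel ((+) c))"
    by (simp add: lborel_distr_plus)
  also have "\<dots> = (\<integral>\<^sup>+x. g (c + x) \<partial>lborel)"
    by (subst nn_integral_distr) auto
  finally show ?thesis by simp
qed

text \<open>The uniqueness proof of Haar measure by Fubini, with the unit ball, which the isometry
  preserves, as reference set.\<close>

lemma lborel_distr_orthogonal:
  fixes T :: "'b::euclidean_space \<Rightarrow> 'b"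
  assumes T: "orthogonal_transformation T"
  shows "distr lborel borel T = lborel"
proof (rule measure_eqI)
  show "sets (distr lborel borel T) = sets (lborel :: 'b measure)" by simp
next
  fix A assume "A \<in> sets (distr lborel borel T)"
  then have A[measurable]: "A \<in> sets borel" by simp
  have lin: "linear T" using T by (simp add: orthogonal_transformation_def)
  then have [measurable]: "T \<in> borel_measurable borel"
    by (simp add: borel_measurable_continuous_onI linear_continuous_on linear_conv_bounded_linear)
  define S where "S = inv T"
  have TS: "T (S y) = y" for y
    unfolding S_def using orthogonal_transformation_surj[OF T] by (simp add: surj_f_inv_f)
  define B :: "'b set" where "B = ball 0 1"
  have [measurable]: "B \<in> sets borel" unfolding B_def by simp
  have Bfin: "emeasure lborel B \<noteq> \<infinity>" "emeasure lborel B \<noteq> 0"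
    unfolding B_def using emeasure_lborel_ball_finite[of "0::'b" 1]
    by (auto simp: emeasure_ball ennreal_eq_0_iff not_le unit_ball_vol_pos)
  have 1: "(\<integral>\<^sup>+x. indicator A (T x) \<partial>lborel) = (\<integral>\<^sup>+x. indicator A (T x + y) \<partial>lborel)" for y
    using nn_integral_lborel_translate[of "\<lambda>x. indicator A (T x)" "S y"]
    by (simp add: linear_add[OF lin] TS add.commute)
  have 2: "(\<integral>\<^sup>+x. indicator B (y - T x) \<partial>lborel) = emeasure lborel B" for y
  proof -
    have "indicator B (y - T x) = (indicator (ball (S y) 1) x :: ennreal)" for x
    proof -
      have "norm (y - T x) = norm (T (S y - x))" by (simp add: linear_diff[OF lin] TS)
      also have "\<dots> = norm (S y - x)" by (rule orthogonal_transformation_norm[OF T])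
      finally show ?thesis by (simp add: B_def indicator_def dist_norm norm_minus_commute[of "T x"])
    qed
    then show ?thesis by (simp add: emeasure_ball B_def)
  qed
  \<comment> \<open>The double integral of \<open>indicator B y * indicator A (T x + y)\<close> is
    evaluated twice: shifting x by \<open>S y\<close> removes y from the second factor, shifting y
    by \<open>- T x\<close> removes x from it. In the second case the x-integral is the volume of a
    unit ball about \<open>S y\<close>.\<close>
  have "emeasure lborel B * emeasure (distr lborel borel T) A
      = (\<integral>\<^sup>+y. indicator B y * (\<integral>\<^sup>+x. indicator A (T x) \<partial>lborel) \<partial>lborel)"
  proof -
    have "emeasure (distr lborel borel T) A = (\<integral>\<^sup>+x. indicator A x \<partial>distr lborel borel T)" by simp
    also have "\<dots> = (\<integral>\<^sup>+x. indicator A (T x) \<partial>lborel)" by (rule nn_integral_distr) measurable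
    finally show ?thesis by (simp add: nn_integral_multc)
  qed
  also have "\<dots> = (\<integral>\<^sup>+y. \<integral>\<^sup>+x. indicator B y * indicator A (T x + y) \<partial>lborel \<partial>lborel)"
  proof (rule nn_integral_cong)
    fix y
    show "indicator B y * (\<integral>\<^sup>+x. indicator A (T x) \<partial>lborel)
        = (\<integral>\<^sup>+x. indicator B y * indicator A (T x + y) \<partial>lborel)"
      unfolding 1[of y] by (rule nn_integral_cmult[symmetric]) measurable
  qed
  also have "\<dots> = (\<integral>\<^sup>+x. \<integral>\<^sup>+y. indicator B y * indicator A (T x + y) \<partial>lborel \<partial>lborel)"
    by (rule lborel_pair.Fubini') measurable
  also have "\<dots> = (\<integral>\<^sup>+x. \<integral>\<^sup>+y. indicator B (y - T x) * indicator A y \<partial>lborel \<partial>lborel)"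
  proof (rule nn_integral_cong)
    fix x
    show "(\<integral>\<^sup>+y. indicator B y * indicator A (T x + y) \<partial>lborel)
        = (\<integral>\<^sup>+y. indicator B (y - T x) * indicator A y \<partial>lborel)"
      using nn_integral_lborel_translate[of "\<lambda>y. indicator B (y - T x) * indicator A y" "T x"]
      by simp
  qed
  also have "\<dots> = (\<integral>\<^sup>+y. \<integral>\<^sup>+x. indicator B (y - T x) * indicator A y \<partial>lborel \<partial>lborel)"
    by (rule lborel_pair.Fubini') measurable
  also have "\<dots> = (\<integral>\<^sup>+y. emeasure lborel B * indicator A y \<partial>lborel)"
    by (subst nn_integral_multc) (simp_all add: 2)
  also have "\<dots> = emeasure lborel B * emeasure lborel A"
    by (simp add: nn_integral_cmult_indicator)
  finally show "emeasure (distr lborel borel T) A = emeasure lborel A"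
    using Bfin by (simp add: ennreal_mult_cancel_left)
qed

section \<open>Marginals of the unit ball and the radial profile\<close>

lemma poly_antiderivative:
  fixes p :: "real poly"
  obtains q where "pderiv q = p"
proof -
  define q where "q = (\<Sum>i\<le>degree p. monom (coeff p i / real (Suc i)) (Suc i))"
  have "pderiv q = (\<Sum>i\<le>degree p. monom (coeff p i) i)"
    unfolding q_def higher_pderiv_sum[of 1, simplified] by (intro sum.cong) (auto simp: pderiv_monom simp del: of_nat_Suc)
  then have "pderiv q = p" by (simp add: poly_as_sum_of_monoms)
  then show ?thesis by (rule that)
qed


text \<open>Fubini: the slice of the ball at first coordinate u is a ball of radius
  \<open>sqrt (1 - u\<^sup>2)\<close>, and its volume is the weight. Continuity of \<open>h\<close>
  gives measurability and a bound on [-1, 1].\<close>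

lemma set_integral_ball_fst:
  fixes h :: "real \<Rightarrow> real"
  assumes h: "continuous_on UNIV h"
  shows "(LINT w:ball 0 1|(lborel :: (real \<times> 'c::euclidean_space) measure). h (fst w))
       = (LINT u:{-1..1}|lborel. h u * (unit_ball_vol (DIM('c)) * sqrt (1 - u\<^sup>2) ^ DIM('c)))"
proof -
  define B :: "(real \<times> 'c) set" where "B = ball 0 1"
  have [measurable]: "h \<in> borel_measurable borel"
    using h by (rule borel_measurable_continuous_onI)
  have [measurable]: "B \<in> sets borel" unfolding B_def by simp
  have B: "(u, v) \<in> B \<longleftrightarrow> u\<^sup>2 + (norm v)\<^sup>2 < 1" for u v
    by (simp add: B_def norm_Pair)
  have B1: "\<bar>u\<bar> \<le> 1" if "(u, v) \<in> B" for u v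
  proof -
    have "u\<^sup>2 \<le> 1" using that B[of u v] by (smt (verit) zero_le_power2)
    then show ?thesis by (simp add: abs_square_le_1)
  qed
  have "bounded (h ` {-1..1})"
    using h by (intro compact_imp_bounded compact_continuous_image) (auto intro: continuous_on_subset)
  then obtain C where C: "\<And>u. u \<in> {-1..1} \<Longrightarrow> \<bar>h u\<bar> \<le> C"
    unfolding bounded_iff real_norm_def by (metis imageI)
  have C0: "0 \<le> C" using C[of 0] by auto
  have fin: "emeasure lborel B < \<infinity>" unfolding B_def by (rule emeasure_lborel_ball_finite)
  have int: "integrable (lborel \<Otimes>\<^sub>M lborel) (\<lambda>w. indicator B w *\<^sub>R h (fst w))"
    unfolding lborel_prod
  proof (rule Bochner_Integration.integrable_bound)
    show "integrable lborel (\<lambda>w. indicator B w * C)" using fin by simp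
    show "AE w in lborel. norm (indicator B w *\<^sub>R h (fst w)) \<le> norm (indicator B w * C)"
    proof (intro AE_I2)
      fix w :: "real \<times> 'c"
      show "norm (indicator B w *\<^sub>R h (fst w)) \<le> norm (indicator B w * C)"
        using C[of "fst w"] B1[of "fst w" "snd w"] C0 by (auto split: split_indicator simp: abs_le_iff)
    qed
    have "(\<lambda>w :: real \<times> 'c. h (fst w)) \<in> borel_measurable borel"
      by (intro borel_measurable_continuous_onI continuous_on_compose2[OF h] continuous_intros) simp
    then show "(\<lambda>w. indicator B w *\<^sub>R h (fst w)) \<in> borel_measurable lborel" by simp
  qed
  have slice: "(\<integral>v. indicator B (u, v) *\<^sub>R h u \<partial>lborel)
     = indicator {-1..1} u *\<^sub>R (h u * (unit_ball_vol (DIM('c)) * sqrt (1 - u\<^sup>2) ^ DIM('c)))" for u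
  proof (cases "\<bar>u\<bar> \<le> 1")
    case True
    then have u: "u\<^sup>2 \<le> 1" by (simp add: abs_square_le_1)
    have "indicator B (u, v) = (indicator (ball 0 (sqrt (1 - u\<^sup>2))) v :: real)" for v :: 'c
    proof -
      have "norm v < sqrt (1 - u\<^sup>2) \<longleftrightarrow> (norm v)\<^sup>2 < 1 - u\<^sup>2"
        using u by (metis abs_norm_cancel real_sqrt_abs real_sqrt_less_iff)
      then show ?thesis using B[of u v] by (auto simp: indicator_def)
    qed
    then have "(\<integral>v. indicator B (u, v) *\<^sub>R h u \<partial>lborel)
       = measure lborel (ball (0::'c) (sqrt (1 - u\<^sup>2))) * h u" by simp
    also have "\<dots> = unit_ball_vol (DIM('c)) * sqrt (1 - u\<^sup>2) ^ DIM('c) * h u"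
      using content_ball[of "sqrt (1 - u\<^sup>2)" "0::'c"] u by (simp add: )
    finally show ?thesis using True by (simp add: abs_le_iff)
  next
    case False
    then have "(u, v) \<notin> B" for v using B1 by blast
    then show ?thesis using False by (auto simp: abs_le_iff)
  qed
  have "(LINT w:B|lborel. h (fst w)) = (\<integral>w. indicator B w *\<^sub>R h (fst w) \<partial>(lborel \<Otimes>\<^sub>M lborel))"
    unfolding set_lebesgue_integral_def lborel_prod ..
  also have "\<dots> = (\<integral>u. \<integral>v. indicator B (u, v) *\<^sub>R h u \<partial>lborel \<partial>lborel)"
    using lborel_pair.integral_fst'[OF int] by simp
  also have "\<dots> = (LINT u:{-1..1}|lborel. h u * (unit_ball_vol (DIM('c)) * sqrt (1 - u\<^sup>2) ^ DIM('c)))"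
    unfolding slice set_lebesgue_integral_def ..
  finally show ?thesis by (simp add: B_def)
qed

text \<open>For y in [0, 1] the truncation only moves the lower limit of integration to y, so the
  integrand is a polynomial there. The value f satisfies f'' = (1 - u^2)^n with f(1) = f'(1) = 0: it
  is the double antiderivative taken from 1. As f'' > 0 on [0, 1), f' is negative and f decreases to
  0, hence is positive.\<close>

lemma truncated_moment_poly:
  fixes n :: nat
  shows "\<exists>f :: real poly.
    (\<forall>y. 0 \<le> y \<and> y \<le> 1 \<longrightarrow>
      (LINT u:{-1..1}|lborel. max 0 (u - y) * (1 - u\<^sup>2) ^ n) = poly f y) \<and>
    (\<forall>y. 0 \<le> y \<and> y < 1 \<longrightarrow> poly f y > 0)"
proof -
  define p :: "real poly" where "p = [:1, 0, -1:] ^ n"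
  have p: "poly p u = (1 - u\<^sup>2) ^ n" for u
    by (simp add: p_def poly_power power2_eq_square algebra_simps)
  obtain q where q: "pderiv q = p" by (rule poly_antiderivative)
  obtain r where r: "pderiv r = q" by (rule poly_antiderivative)
  define f where "f = [:poly q 1 - poly r 1, - poly q 1:] + r"
  have f: "poly f y = (1 - y) * poly q 1 - poly r 1 + poly r y" for y
    by (simp add: f_def algebra_simps)
  have 1: "(LINT u:{-1..1}|lborel. max 0 (u - y) * (1 - u\<^sup>2) ^ n) = poly f y"
    if y: "0 \<le> y" "y \<le> 1" for y
  proof -
    have "(LINT u:{-1..1}|lborel. max 0 (u - y) * (1 - u\<^sup>2) ^ n)
        = (LINT u:{y..1}|lborel. (u - y) * poly p u)"
      unfolding set_lebesgue_integral_def using y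
      by (intro Bochner_Integration.integral_cong) (auto simp: p max_def split: split_indicator)
    also have "\<dots> = (\<integral>u. ((u - y) * poly p u) * indicator {y..1} u \<partial>lborel)"
      unfolding set_lebesgue_integral_def by (simp add: mult.commute)
    also have "\<dots> = ((1 - y) * poly q 1 - poly r 1) - ((y - y) * poly q y - poly r y)"
    proof (rule integral_FTC_Icc_real[where F = "\<lambda>u. (u - y) * poly q u - poly r u"])
      show "y \<le> 1" by fact
      show "((\<lambda>u. (u - y) * poly q u - poly r u) has_real_derivative (u - y) * poly p u) (at u)" for u
        by (rule derivative_eq_intros poly_DERIV refl | simp add: q r)+
      show "isCont (\<lambda>u. (u - y) * poly p u) u" for u by simp
    qed
    finally show ?thesis by (simp add: f)
  qed
  have p0: "0 < poly p u" if "0 \<le> u" "u < 1" for u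
    using that by (simp add: p zero_less_power abs_square_less_1)
  have q1: "poly q y < poly q 1" if "0 \<le> y" "y < 1" for y
  proof (rule DERIV_pos_imp_increasing_open[OF that(2)])
    show "\<exists>d. (poly q has_real_derivative d) (at x) \<and> 0 < d" if "y < x" "x < 1" for x
      using poly_DERIV[of q x] p0[of x] \<open>0 \<le> y\<close> that q by auto
  qed (auto intro!: continuous_intros)
  have f1: "poly f 1 = 0" by (simp add: f)
  have 2: "poly f y > 0" if "0 \<le> y" "y < 1" for y
  proof -
    have "poly f 1 < poly f y"
    proof (rule DERIV_neg_imp_decreasing_open[OF that(2)])
      have "poly (pderiv f) x = poly q x - poly q 1" for x
        by (simp add: f_def pderiv_add pderiv_pCons r)
      then show "\<exists>d. (poly f has_real_derivative d) (at x) \<and> d < 0" if "y < x" "x < 1" for x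
        using poly_DERIV[of f x] q1[of x] \<open>0 \<le> y\<close> that by (intro exI[of _ "poly (pderiv f) x"]) auto
    qed (auto intro!: continuous_intros)
    then show ?thesis by (simp add: f1)
  qed
  show ?thesis using 1 2 by blast
qed

text \<open>The coordinate t of z = (t, w, v) is only there to make the dimension of the ball odd, so that the
  marginal density of w in any direction, hence the profile as a function of g, is polynomial.\<close>

definition cap_profile :: "real \<Rightarrow> 'a::euclidean_space \<Rightarrow> real" where
  "cap_profile g x = (LINT z:ball 0 1|(lborel :: (real \<times> 'a \<times> 'a) measure).
     max 0 (x \<bullet> fst (snd z) - g))"

lemma ridge_ball_measurable:
  "(\<lambda>z :: real \<times> 'a \<times> 'a. indicat_real (ball 0 1) z *\<^sub>R max 0 ((x::'a::euclidean_space) \<bullet> fst (snd z) - g))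
     \<in> borel_measurable borel"
proof (rule borel_measurable_scaleR)
  show "indicat_real (ball (0 :: real \<times> 'a \<times> 'a) 1) \<in> borel_measurable borel"
    by (rule borel_measurable_indicator) simp
  show "(\<lambda>z :: real \<times> 'a \<times> 'a. max 0 (x \<bullet> fst (snd z) - g)) \<in> borel_measurable borel"
    by (rule borel_measurable_continuous_onI) (intro continuous_intros)
qed

text \<open>An isometry carries the direction of x to the first axis, the coordinate that the
  slicing formula splits off. It preserves both the ball and Lebesgue measure.\<close>

lemma cap_profile_rotate:
  fixes x :: "'a::euclidean_space"
  shows "cap_profile g x = (LINT z:ball 0 1|(lborel :: (real \<times> 'a \<times> 'a) measure).
     max 0 (norm x * fst z - g))"
proof (cases "x = 0")
  case False
  define e :: "real \<times> 'a \<times> 'a" where "e = (1, 0, 0)"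
  define e' :: "real \<times> 'a \<times> 'a" where "e' = (0, x /\<^sub>R norm x, 0)"
  obtain T where T: "orthogonal_transformation T" "T e = e'"
    by (rule orthogonal_transformation_exists_unit[of e e']) (auto simp: e_def e'_def norm_Pair False)
  have lin: "linear T" using T by (simp add: orthogonal_transformation_def)
  then have [measurable]: "T \<in> borel_measurable borel"
    by (simp add: borel_measurable_continuous_onI linear_continuous_on linear_conv_bounded_linear)
  have ip: "x \<bullet> fst (snd (T z)) = norm x * fst z" for z
  proof -
    have "x \<bullet> fst (snd (T z)) = norm x * (e' \<bullet> T z)"
      by (cases "T z") (simp add: e'_def False)
    also have "\<dots> = norm x * (e \<bullet> z)"
      using T(1) by (metis T(2) orthogonal_transformation_def)
    finally show ?thesis by (cases z) (simp add: e_def)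
  qed
  have ball: "T z \<in> ball 0 1 \<longleftrightarrow> z \<in> ball 0 1" for z
    using T(1) by (simp add: orthogonal_transformation_norm)
  have "cap_profile g x = (LINT z:ball 0 1|distr lborel borel T. max 0 (x \<bullet> fst (snd z) - g))"
    by (simp add: cap_profile_def lborel_distr_orthogonal[OF T(1)])
  also have "\<dots> = (\<integral>z. indicator (ball 0 1) (T z) *\<^sub>R max 0 (x \<bullet> fst (snd (T z)) - g) \<partial>lborel)"
    unfolding set_lebesgue_integral_def by (rule integral_distr) (simp_all only: ridge_ball_measurable measurable_lborel1, measurable)
  also have "\<dots> = (LINT z:ball 0 1|(lborel :: (real \<times> 'a \<times> 'a) measure). max 0 (norm x * fst z - g))"
    by (simp only: set_lebesgue_integral_def ip indicator_def ball)
  finally show ?thesis .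
qed (simp add: cap_profile_def)

text \<open>The slices have the even dimension \<open>2 * DIM('a)\<close>, so the square root in the
  density disappears; scaling by \<open>norm x\<close> reduces to the truncated moment at y =
  \<open>g / norm x\<close>. One \<open>f\<close> serves all g and x, which later allows a single
  order of differences for all x.\<close>

lemma cap_profile_eq_poly:
  "\<exists>f :: real poly.
    (\<forall>g x. 0 \<le> g \<and> g \<le> norm x \<and> x \<noteq> 0 \<longrightarrow>
       cap_profile g (x::'a::euclidean_space) = norm x * poly f (g / norm x)) \<and>
    (\<forall>y. 0 \<le> y \<and> y < 1 \<longrightarrow> poly f y > 0)"
proof -
  define c where "c = unit_ball_vol (real (DIM('a \<times> 'a)))"
  have c: "c > 0" unfolding c_def by (rule unit_ball_vol_pos) simp
  obtain f :: "real poly" where f: "\<And>y. 0 \<le> y \<Longrightarrow> y \<le> 1 \<Longrightarrow>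
      (LINT u:{-1..1}|lborel. max 0 (u - y) * (1 - u\<^sup>2) ^ DIM('a)) = poly f y"
    "\<And>y. 0 \<le> y \<Longrightarrow> y < 1 \<Longrightarrow> poly f y > 0"
    using truncated_moment_poly[of "DIM('a)"] by blast
  have 1: "cap_profile g x = norm x * poly (smult c f) (g / norm x)"
    if g: "0 \<le> g" "g \<le> norm x" "x \<noteq> 0" for g and x :: 'a
  proof -
    have "cap_profile g x = (LINT u:{-1..1}|lborel. max 0 (norm x * u - g) *
        (c * sqrt (1 - u\<^sup>2) ^ DIM('a \<times> 'a)))"
      unfolding cap_profile_rotate c_def
      by (rule set_integral_ball_fst) (auto intro!: continuous_intros)
    also have "\<dots> = (LINT u:{-1..1}|lborel. (norm x * c) * (max 0 (u - g / norm x) * (1 - u\<^sup>2) ^ DIM('a)))"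
    proof (rule set_lebesgue_integral_cong)
      show "\<forall>u. u \<in> {-1..1} \<longrightarrow> max 0 (norm x * u - g) * (c * sqrt (1 - u\<^sup>2) ^ DIM('a \<times> 'a)) =
         (norm x * c) * (max 0 (u - g / norm x) * (1 - u\<^sup>2) ^ DIM('a))"
      proof safe
        fix u :: real assume "u \<in> {-1..1}"
        then have u: "u\<^sup>2 \<le> 1" by (simp add: abs_square_le_1 abs_le_iff)
        have "sqrt (1 - u\<^sup>2) ^ DIM('a \<times> 'a) = (1 - u\<^sup>2) ^ DIM('a)"
        proof -
          have "DIM('a \<times> 'a) = 2 * DIM('a)" by simp
          then show ?thesis using u by (simp only: power_mult) simp
        qed
        moreover have "max 0 (norm x * u - g) = norm x * max 0 (u - g / norm x)"
          using g by (auto simp: max_def field_simps)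
        ultimately show "max 0 (norm x * u - g) * (c * sqrt (1 - u\<^sup>2) ^ DIM('a \<times> 'a)) =
         (norm x * c) * (max 0 (u - g / norm x) * (1 - u\<^sup>2) ^ DIM('a))" by (simp only: mult_ac)
      qed
    qed simp
    also have "\<dots> = (norm x * c) * (LINT u:{-1..1}|lborel. max 0 (u - g / norm x) * (1 - u\<^sup>2) ^ DIM('a))"
      by (rule set_integral_mult_right)
    also have "(LINT u:{-1..1}|lborel. max 0 (u - g / norm x) * (1 - u\<^sup>2) ^ DIM('a)) = poly f (g / norm x)"
      by (rule f(1)) (use g in auto)
    finally show ?thesis by (simp only: poly_smult mult.assoc)
  qed
  have 2: "poly (smult c f) y > 0" if "0 \<le> y" "y < 1" for y
    unfolding poly_smult using c f(2)[OF that] by (rule mult_pos_pos)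
  show ?thesis using 1 2 by blast
qed

lemma abs_inner_fst_snd_le:
  fixes x :: "'a::euclidean_space" and z :: "real \<times> 'a \<times> 'a"
  assumes "z \<in> ball 0 1"
  shows "\<bar>x \<bullet> fst (snd z)\<bar> \<le> norm x"
proof -
  have "norm (fst (snd z)) \<le> norm z"
    using dist_fst_le[of "snd z" 0] dist_snd_le[of z 0] by simp
  then have "norm (fst (snd z)) \<le> 1" using assms by simp
  then have "norm x * norm (fst (snd z)) \<le> norm x * 1"
    by (intro mult_left_mono) auto
  then show ?thesis using Cauchy_Schwarz_ineq2[of x "fst (snd z)"] by linarith
qed

lemma cap_profile_eq_0:
  fixes x :: "'a::euclidean_space"
  assumes "norm x \<le> g"
  shows "cap_profile g x = 0"
proof -
  have "max 0 (x \<bullet> fst (snd z) - g) = 0" if "z \<in> ball 0 1" for z :: "real \<times> 'a \<times> 'a"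
    using abs_inner_fst_snd_le[OF that, of x] assms by simp
  then have "cap_profile g x = (LINT z:ball 0 1|(lborel :: (real \<times> 'a \<times> 'a) measure). 0)"
    unfolding cap_profile_def by (intro set_lebesgue_integral_cong) auto
  then show ?thesis by simp
qed

lemma integrable_ridge_ball:
  "set_integrable lborel (ball 0 1) (\<lambda>z :: real \<times> 'a \<times> 'a. max 0 ((x::'a::euclidean_space) \<bullet> fst (snd z) - g))"
  unfolding set_integrable_def
proof (rule Bochner_Integration.integrable_bound)
  show "integrable lborel (\<lambda>z :: real \<times> 'a \<times> 'a. indicator (ball 0 1) z * (norm x + \<bar>g\<bar>))"
    using emeasure_lborel_ball_finite by (intro integrable_mult_left integrable_real_indicator) auto
  show "AE z in lborel. norm (indicator (ball 0 1) z *\<^sub>R max 0 (x \<bullet> fst (snd z) - g))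
      \<le> norm (indicator (ball 0 1) (z :: real \<times> 'a \<times> 'a) * (norm x + \<bar>g\<bar>))"
  proof (intro AE_I2)
    fix z :: "real \<times> 'a \<times> 'a"
    have "max 0 (x \<bullet> fst (snd z) - g) \<le> norm x + \<bar>g\<bar>" if "z \<in> ball 0 1"
      using abs_inner_fst_snd_le[OF that, of x] by linarith
    then show "norm (indicator (ball 0 1) z *\<^sub>R max 0 (x \<bullet> fst (snd z) - g))
      \<le> norm (indicator (ball 0 1) z * (norm x + \<bar>g\<bar>))"
      by (auto simp: indicator_def)
  qed
qed (use ridge_ball_measurable[of x g] in simp)

lemma continuous_on_cap_profile: "continuous_on UNIV (cap_profile g :: 'a::euclidean_space \<Rightarrow> real)"
proof -
  define V where "V = measure lborel (ball (0 :: real \<times> 'a \<times> 'a) 1)"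
  have *: "\<bar>cap_profile g x - cap_profile g y\<bar> \<le> V * norm (x - y)" for x y :: 'a
  proof -
    let ?d = "\<lambda>z :: real \<times> 'a \<times> 'a. max 0 (x \<bullet> fst (snd z) - g) - max 0 (y \<bullet> fst (snd z) - g)"
    have int: "set_integrable lborel (ball 0 1) ?d"
      by (intro set_integral_diff integrable_ridge_ball)
    have "cap_profile g x - cap_profile g y = (LINT z:ball 0 1|lborel. ?d z)"
      unfolding cap_profile_def by (rule set_integral_diff(2)[symmetric]) (rule integrable_ridge_ball)+
    then have "\<bar>cap_profile g x - cap_profile g y\<bar> \<le> (\<integral>z. norm (indicator (ball 0 1) z *\<^sub>R ?d z) \<partial>lborel)"
      using integral_norm_bound[of lborel "\<lambda>z. indicator (ball 0 1) z *\<^sub>R ?d z"]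
      by (simp add: set_lebesgue_integral_def)
    also have "\<dots> \<le> (\<integral>z. indicator (ball (0 :: real \<times> 'a \<times> 'a) 1) z *\<^sub>R norm (x - y) \<partial>lborel)"
    proof (rule integral_mono)
      show "integrable lborel (\<lambda>z. norm (indicator (ball 0 1) z *\<^sub>R ?d z))"
        using int unfolding set_integrable_def by (rule integrable_norm)
      show "integrable lborel (\<lambda>z :: real \<times> 'a \<times> 'a. indicator (ball 0 1) z *\<^sub>R norm (x - y))"
        using emeasure_lborel_ball_finite by (intro integrable_scaleR_left integrable_real_indicator) auto
      fix z :: "real \<times> 'a \<times> 'a"
      have "\<bar>?d z\<bar> \<le> norm (x - y)" if "z \<in> ball 0 1"
        using abs_inner_fst_snd_le[OF that, of "x - y"] unfolding inner_diff_left by linarith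
      then show "norm (indicator (ball 0 1) z *\<^sub>R ?d z) \<le> indicator (ball 0 1) z *\<^sub>R norm (x - y)"
        by (auto simp: indicator_def)
    qed
    also have "\<dots> = V * norm (x - y)"
      unfolding V_def by simp
    finally show ?thesis .
  qed
  have "V-lipschitz_on UNIV (cap_profile g :: 'a \<Rightarrow> real)"
  proof (rule lipschitz_onI)
    show "dist (cap_profile g x) (cap_profile g y) \<le> V * dist x y" for x y :: 'a
      using *[of x y] by (simp add: dist_norm)
  qed (simp add: V_def)
  then show ?thesis by (rule lipschitz_on_continuous_on)
qed

section \<open>Weak compactness of tight sequences\<close>

text \<open>The base 4 digits of \<open>s y\<close> record which sets of a countable basis contain
  y. Using only the digits 0 and 1 in base 4 leaves gaps, so an approximate value of
  \<open>s y\<close> already determines its leading digits, and these locate y: \<open>s\<close>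
  itself is merely Borel, but its inverse is uniformly continuous on the image. This asymmetry is
  what the transport of weak convergence from the line requires.\<close>

lemma ball_coding:
  "\<exists>(s :: 'a::euclidean_space \<Rightarrow> real) g. s \<in> borel_measurable borel \<and> (\<forall>y. 0 \<le> s y \<and> s y \<le> 2) \<and>
     continuous_on UNIV g \<and> (\<forall>y\<in>cball 0 1. g (s y) = y)"
proof -
  obtain \<B> :: "'a set set" where \<B>: "countable \<B>" "topological_basis \<B>"
    using ex_countable_basis by blast
  define U where "U = from_nat_into \<B>"
  have "\<B> \<noteq> {}"
    using topological_basisE[OF \<B>(2) open_UNIV UNIV_I, of "0::'a"] by blast
  then have rU: "range U = \<B>" unfolding U_def by (rule range_from_nat_into) (rule \<B>(1))
  have oU: "open (U n)" for n
    using rU \<B>(2) by (metis rangeI topological_basis_open)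
  have [measurable]: "U n \<in> sets borel" for n using oU by simp
  have U_ex: "\<exists>n. y \<in> U n \<and> U n \<subseteq> O'" if "open O'" "y \<in> O'" for y O'
    using topological_basisE[OF \<B>(2) that] rU by (metis imageE)
  define s where "s y = (\<Sum>n. indicator (U n) y * (1/4::real)^n)" for y
  have geo: "summable (\<lambda>n. (1/4::real)^n)" by (rule summable_geometric) simp
  have geo_sum: "(\<Sum>n. (1/4::real)^n) = 4/3" by (subst suminf_geometric) auto
  have summ: "summable (\<lambda>n. indicator (U n) y * (1/4::real)^n)" for y
    by (rule summable_comparison_test'[OF geo, of 0]) (auto split: split_indicator)
  have s_meas: "s \<in> borel_measurable borel" unfolding s_def[abs_def] by measurable
  have s0: "0 \<le> s y" for y unfolding s_def by (rule suminf_nonneg[OF summ]) simp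
  have "s y \<le> (\<Sum>n. (1/4::real)^n)" for y unfolding s_def
    by (rule suminf_le[OF _ summ geo]) (auto split: split_indicator)
  then have s2: "s y \<le> 2" for y unfolding geo_sum by (rule order_trans) simp
  \<comment> \<open>At the first differing digit j the sums differ by \<open>(1/4)^j\<close>, and
    all later digits together can compensate at most a third of that. The remaining two thirds
    exceed the tolerance \<open>(1/4)^N / 2\<close> as j \<le> N.\<close>
  have key: "y \<in> U i \<longleftrightarrow> z \<in> U i" if "\<bar>s y - s z\<bar> < (1/4)^N / 2" "i \<le> N" for y z i N
  proof (rule ccontr)
    assume neg: "\<not> (y \<in> U i \<longleftrightarrow> z \<in> U i)"
    define j where "j = (LEAST j. \<not> (y \<in> U j \<longleftrightarrow> z \<in> U j))"
    have j: "\<not> (y \<in> U j \<longleftrightarrow> z \<in> U j)" unfolding j_def by (rule LeastI[of _ i]) (rule neg)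
    have jl: "y \<in> U k \<longleftrightarrow> z \<in> U k" if "k < j" for k
      using not_less_Least[of k "\<lambda>j. \<not> (y \<in> U j \<longleftrightarrow> z \<in> U j)"] that unfolding j_def by blast
    have ji: "j \<le> i" unfolding j_def by (rule Least_le) (rule neg)
    define d where "d n = (indicator (U n) y - indicator (U n) z) * (1/4::real)^n" for n
    have sd: "summable d" unfolding d_def left_diff_distrib by (rule summable_diff[OF summ summ])
    have "s y - s z = suminf d"
      unfolding s_def d_def left_diff_distrib by (rule suminf_diff[OF summ summ])
    also have "\<dots> = (\<Sum>n. d (n + Suc j)) + sum d {..<Suc j}"
      by (rule suminf_split_initial_segment[OF sd])
    also have "sum d {..<Suc j} = d j"
      using jl by (auto simp: d_def indicator_def intro!: sum.neutral)
    finally have eq: "s y - s z = (\<Sum>n. d (n + Suc j)) + d j" .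
    have "\<bar>\<Sum>n. d (n + Suc j)\<bar> \<le> (\<Sum>n. (1/4)^Suc j * (1/4::real)^n)"
    proof -
      have "norm (\<Sum>n. d (n + Suc j)) \<le> (\<Sum>n. (1/4)^Suc j * (1/4::real)^n)"
      proof (rule norm_suminf_le)
        show "norm (d (n + Suc j)) \<le> (1/4)^Suc j * (1/4::real)^n" for n
          by (auto simp: d_def power_add split: split_indicator)
        show "summable (\<lambda>n. (1/4)^Suc j * (1/4::real)^n)" by (intro summable_mult geo)
      qed
      then show ?thesis by simp
    qed
    also have "\<dots> = (1/4)^j / 3"
      by (subst suminf_mult[OF geo]) (simp add: geo_sum)
    finally have tail: "\<bar>\<Sum>n. d (n + Suc j)\<bar> \<le> (1/4)^j / 3" .
    have "\<bar>d j\<bar> = (1/4)^j" using j by (auto simp: d_def indicator_def)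
    with eq tail have "\<bar>s y - s z\<bar> \<ge> (1/4)^j * (2/3)" by linarith
    moreover have "(1/4::real)^N \<le> (1/4)^j" using ji that(2) by (intro power_decreasing) auto
    moreover have "(0::real) < (1/4)^N" by simp
    ultimately show False using that(1) by linarith
  qed
  have inj: "inj_on s (cball 0 1)"
  proof (rule inj_onI, rule ccontr)
    fix y z assume eq: "s y = s z" "y \<noteq> z"
    then obtain n where "y \<in> U n" "U n \<subseteq> - {z}" using U_ex[of "- {z}" y] by (auto simp: open_Compl)
    moreover have "y \<in> U n \<longleftrightarrow> z \<in> U n" by (rule key[of y z n n]) (simp_all add: eq)
    ultimately show False by blast
  qed
  define C where "C = s ` cball 0 1"
  define h where "h = the_inv_into (cball 0 1) s"
  have hs: "h (s y) = y" if "y \<in> cball 0 1" for y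
    unfolding h_def by (rule the_inv_into_f_f[OF inj that])
  have uc: "uniformly_continuous_on C h"
    unfolding uniformly_continuous_on_def
  proof (intro allI impI)
    fix e :: real assume e: "e > 0"
    define I where "I = {n. \<exists>y. U n \<subseteq> ball y (e/2)}"
    have "cball 0 1 \<subseteq> (\<Union>n\<in>I. U n)"
    proof
      fix y :: 'a
      obtain n where "y \<in> U n" "U n \<subseteq> ball y (e/2)"
        using U_ex[of "ball y (e/2)" y] e by auto
      then show "y \<in> (\<Union>n\<in>I. U n)" unfolding I_def by blast
    qed
    then obtain I' where I': "I' \<subseteq> I" "finite I'" "cball 0 1 \<subseteq> (\<Union>n\<in>I'. U n)"
      using compactE_image[OF compact_cball, of I U 0 1] oU by metis
    \<comment> \<open>By compactness finitely many basic sets, each inside a ball of radius e/2,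
      cover \<open>cball 0 1\<close>. If the digits up to N agree, y and z lie in a common one of
      them.\<close>
    define N where "N = Max (insert 0 I')"
    have N: "n \<le> N" if "n \<in> I'" for n unfolding N_def using that I'(2) by simp
    show "\<exists>d>0. \<forall>x\<in>C. \<forall>x'\<in>C. dist x' x < d \<longrightarrow> dist (h x') (h x) < e"
    proof (intro exI[of _ "(1/4)^N / 2"] conjI ballI impI)
      fix x x' assume "x \<in> C" "x' \<in> C" and d: "dist x' x < (1/4)^N / 2"
      then obtain y z where y: "y \<in> cball 0 1" "x = s y" and z: "z \<in> cball 0 1" "x' = s z"
        unfolding C_def by blast
      obtain n where n: "n \<in> I'" "y \<in> U n" using I'(3) y by blast
      then have "z \<in> U n" using key[of z y N n] d N[OF n(1)] by (simp add: y z dist_real_def)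
      moreover obtain w where "U n \<subseteq> ball w (e/2)" using n(1) I'(1) unfolding I_def by blast
      ultimately have "dist w y < e/2" "dist w z < e/2" using n(2) by auto
      then have "dist z y < e" by (metis dist_commute dist_triangle_half_r)
      then show "dist (h x') (h x) < e" unfolding y z by (simp only: hs[OF y(1)] hs[OF z(1)])
    qed simp
  qed
  \<comment> \<open>The image \<open>C\<close> need not be closed, as \<open>s\<close> is not
    continuous. Uniform continuity extends the inverse to the closure, and only then does Tietze
    extend it to the whole line.\<close>
  obtain g' where g': "uniformly_continuous_on (closure C) g'" "\<And>x. x \<in> C \<Longrightarrow> h x = g' x"
    using uniformly_continuous_on_extension_on_closure[OF uc] by metis
  have "C \<subseteq> {0..2}" unfolding C_def using s0 s2 by auto
  then have "bounded C" by (rule bounded_subset[rotated]) simp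
  then have "compact (closure C)" by (simp add: compact_closure)
  moreover have g'c: "continuous_on (closure C) g'" by (rule uniformly_continuous_imp_continuous[OF g'(1)])
  ultimately have "bounded (g' ` closure C)" by (intro compact_imp_bounded compact_continuous_image)
  then obtain B where B: "0 \<le> B" "\<And>x. x \<in> closure C \<Longrightarrow> norm (g' x) \<le> B"
    unfolding bounded_pos by (metis imageI less_eq_real_def)
  obtain g where g: "continuous_on UNIV g" "\<And>x. x \<in> closure C \<Longrightarrow> g x = g' x"
  proof -
    have "closedin (top_of_set UNIV) (closure C)" by simp
    from Tietze[OF g'c this B] that show ?thesis by metis
  qed
  have "g (s y) = y" if "y \<in> cball 0 1" for y
  proof -
    have "s y \<in> C" using that unfolding C_def by simp
    then show ?thesis using g(2) g'(2) hs[OF that] closure_subset[of C] by force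
  qed
  then show ?thesis using s_meas s0 s2 g(1) by blast
qed

text \<open>Prokhorov's theorem on Euclidean space. After compressing the space to the unit ball, the coding
  moves the measures to the line, where Helly's selection theorem applies; the decoding map is
  continuous, so weak convergence is transported back.\<close>

lemma tight_imp_weakly_convergent_subseq:
  fixes P :: "nat \<Rightarrow> 'a::euclidean_space measure"
  assumes prob: "\<And>n. prob_space (P n)" and sets: "\<And>n. sets (P n) = sets borel"
    and tight: "\<And>e. e > 0 \<Longrightarrow> \<exists>R. \<forall>\<^sub>F n in sequentially. measure (P n) {x. norm x > R} \<le> e"
  shows "\<exists>r N. strict_mono (r :: nat \<Rightarrow> nat) \<and> finite_measure N \<and> sets N = sets borel \<and>
    (\<forall>(f :: 'a \<Rightarrow> real) B. continuous_on UNIV f \<longrightarrow> (\<forall>x. \<bar>f x\<bar> \<le> B) \<longrightarrow>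
       (\<lambda>n. \<integral>x. f x \<partial>P (r n)) \<longlonglongrightarrow> (\<integral>x. f x \<partial>N))"
proof -
  obtain s :: "'a \<Rightarrow> real" and g :: "real \<Rightarrow> 'a" where
    s: "s \<in> borel_measurable borel" "\<And>y. 0 \<le> s y" "\<And>y. s y \<le> 2" and g: "continuous_on UNIV g"
    and gs: "\<And>y. y \<in> cball 0 1 \<Longrightarrow> g (s y) = y"
    using ball_coding[where 'a='a] by blast
  note s(1)[measurable]
  have [measurable]: "g \<in> borel_measurable borel" using g by (rule borel_measurable_continuous_onI)
  define J :: "'a \<Rightarrow> 'a" where "J x = x /\<^sub>R (1 + norm x)" for x
  define K :: "'a \<Rightarrow> 'a" where "K y = y /\<^sub>R (1 - norm y)" for y
  have nJ: "norm (J x) = norm x / (1 + norm x)" for x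
    unfolding J_def by (simp add: divide_inverse_commute add_nonneg_nonneg)
  have J1: "norm (J x) < 1" for x unfolding nJ by (simp add: add_pos_nonneg)
  have KJ: "K (J x) = x" for x
  proof -
    have p: "1 + norm x > 0" by (simp add: add_pos_nonneg)
    have "1 - norm (J x) = inverse (1 + norm x)" unfolding nJ using p by (simp add: field_simps)
    then have "K (J x) = (1 + norm x) *\<^sub>R J x" unfolding K_def by simp
    also have "\<dots> = x" unfolding J_def using p by simp
    finally show ?thesis .
  qed
  have gsJ: "g (s (J x)) = J x" for x using J1[of x] by (intro gs) simp
  have [measurable]: "J \<in> borel_measurable borel" unfolding J_def[abs_def] by measurable
  have [measurable]: "K \<in> borel_measurable borel" unfolding K_def[abs_def] by measurable
  have [measurable_cong]: "sets (P n) = sets borel" for n by (rule sets)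
  define Q where "Q n = distr (P n) borel (\<lambda>x. s (J x))" for n
  have rdQ: "real_distribution (Q n)" for n
  proof -
    interpret prob_space "P n" by (rule prob)
    interpret Q: prob_space "Q n" unfolding Q_def by (rule prob_space_distr) measurable
    show ?thesis by unfold_locales (simp add: Q_def)
  qed
  \<comment> \<open>The codes lie in a fixed bounded interval, so selection on the line is
    unconditional. The tightness of \<open>P\<close> enters only in the next estimate.\<close>
  have "tight Q"
    unfolding tight_def
  proof (intro conjI allI impI rdQ)
    fix e :: real assume e: "0 < e"
    have "measure (Q n) {-1<..2} = 1" for n
    proof -
      interpret prob_space "P n" by (rule prob)
      have "(\<lambda>x. s (J x)) -` {-1<..2} \<inter> space (P n) = space (P n)"
        using s(3) less_le_trans[of "-1" 0, OF _ s(2)] by auto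
      then show ?thesis unfolding Q_def by (subst measure_distr) (auto simp: prob_space)
    qed
    then show "\<exists>a b. a < b \<and> (\<forall>n. 1 - e < measure (Q n) {a<..b})"
      using e by (intro exI[of _ "-1"] exI[of _ 2]) auto
  qed
  then obtain r \<rho> where r: "strict_mono r" and rd: "real_distribution \<rho>"
    and conv: "weak_conv_m (Q \<circ> r) \<rho>"
    using tight_imp_convergent_subsubsequence[of Q "\<lambda>n. n"] by (auto simp: strict_mono_def comp_def)
  interpret \<rho>: real_distribution \<rho> by (rule rd)
  have intQ: "(\<integral>t. f t \<partial>Q n) = (\<integral>x. f (s (J x)) \<partial>P n)"
    if [measurable]: "f \<in> borel_measurable borel" for f :: "real \<Rightarrow> real" and n
    unfolding Q_def by (rule integral_distr) measurable
  have gm[measurable]: "{t. norm (g t) \<ge> 1} \<in> sets borel" by measurable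
  \<comment> \<open>The inverse of the compression exists only in the open unit ball. Limit mass
    decoded to norm at least 1 would be mass that escaped to infinity, which tightness
    forbids.\<close>
  have null: "measure \<rho> {t. norm (g t) \<ge> 1} = 0"
  proof (rule antisym[OF field_le_epsilon])
    fix e :: real assume "e > 0"
    then obtain R0 where R0: "\<forall>\<^sub>F n in sequentially. measure (P n) {x. norm x > R0} \<le> e"
      using tight by blast
    define R where "R = max 0 R0"
    have R: "R \<ge> 0" by (simp add: R_def)
    have Rev: "\<forall>\<^sub>F n in sequentially. measure (P (r n)) {x. norm x > R} \<le> e"
      using eventually_subseq[OF r R0]
    proof (rule eventually_mono)
      fix n assume le: "measure (P (r n)) {x. norm x > R0} \<le> e"
      interpret prob_space "P (r n)" by (rule prob)
      have "measure (P (r n)) {x. norm x > R} \<le> measure (P (r n)) {x. norm x > R0}"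
        by (rule finite_measure_mono) (auto simp: R_def)
      with le show "measure (P (r n)) {x. norm x > R} \<le> e" by linarith
    qed
    \<comment> \<open>\<open>q\<close> is the norm of \<open>J x\<close> for
      \<open>norm x = R\<close>. Hence \<open>cut\<close> vanishes at the codes of all points with
      \<open>norm x \<le> R\<close>, while it is a continuous majorant of the indicator of
      \<open>norm (g t) \<ge> 1\<close>.\<close>
    define q where "q = R / (1 + R)"
    have q: "q < 1" unfolding q_def using R by simp
    define cut where "cut t = max 0 (min 1 ((norm (g t) - q) / (1 - q)))" for t
    have cut_cont: "continuous_on UNIV cut" unfolding cut_def using q by (auto intro!: continuous_intros g)
    then have [measurable]: "cut \<in> borel_measurable borel" by (rule borel_measurable_continuous_onI)
    have lim_cut: "(\<lambda>n. \<integral>t. cut t \<partial>(Q \<circ> r) n) \<longlonglongrightarrow> (\<integral>t. cut t \<partial>\<rho>)"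
    proof (rule weak_conv_imp_integral_bdd_continuous_conv[OF _ rd conv])
      show "isCont cut x" for x using cut_cont by (simp add: continuous_on_eq_continuous_at)
      show "norm (cut x) \<le> 1" for x by (simp add: cut_def)
    qed (simp add: rdQ)
    have le_cut: "(\<integral>t. cut t \<partial>(Q \<circ> r) n) \<le> measure (P (r n)) {x. norm x > R}" for n
    proof -
      interpret prob_space "P (r n)" by (rule prob)
      have "(\<integral>t. cut t \<partial>(Q \<circ> r) n) = (\<integral>x. cut (s (J x)) \<partial>P (r n))" by (simp add: intQ)
      also have "\<dots> \<le> (\<integral>x. indicator {x. norm x > R} x \<partial>P (r n))"
      proof (rule integral_mono)
        show "integrable (P (r n)) (\<lambda>x. cut (s (J x)))"
          by (rule integrable_const_bound[of _ 1]) (auto simp: cut_def)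
        show "integrable (P (r n)) (\<lambda>x. indicator {x. norm x > R} x :: real)" 
          by (rule integrable_const_bound[of _ 1]) auto
        fix x :: 'a
        have "0 < 1 + norm x" "0 < 1 + R" using R by (simp_all add: add_pos_nonneg)
        then have "norm (J x) \<le> q" if "norm x \<le> R"
          unfolding nJ q_def using that by (auto simp: divide_simps algebra_simps)
        then show "cut (s (J x)) \<le> indicator {x. norm x > R} x"
          using q unfolding cut_def gsJ by (auto split: split_indicator simp: divide_nonpos_pos)
      qed
      also have "\<dots> = measure (P (r n)) {x. norm x > R}"
        by simp
      finally show ?thesis .
    qed
    have "\<forall>\<^sub>F n in sequentially. (\<integral>t. cut t \<partial>(Q \<circ> r) n) \<le> e"
      using Rev by (rule eventually_mono) (rule order_trans[OF le_cut])
    from tendsto_upperbound[OF lim_cut this] have "(\<integral>t. cut t \<partial>\<rho>) \<le> e" by simp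
    moreover have "measure \<rho> {t. norm (g t) \<ge> 1} \<le> (\<integral>t. cut t \<partial>\<rho>)"
    proof -
      have "measure \<rho> {t. norm (g t) \<ge> 1} = (\<integral>t. indicator {t. norm (g t) \<ge> 1} t \<partial>\<rho>)" by simp
      also have "\<dots> \<le> (\<integral>t. cut t \<partial>\<rho>)"
      proof (rule integral_mono)
        show "integrable \<rho> cut" by (rule \<rho>.integrable_const_bound[of _ 1]) (auto simp: cut_def)
        show "integrable \<rho> (\<lambda>t. indicator {t. norm (g t) \<ge> 1} t :: real)"
          by (rule \<rho>.integrable_const_bound[of _ 1]) auto
        show "indicator {t. norm (g t) \<ge> 1} t \<le> cut t" for t
          using q by (auto simp: cut_def divide_simps split: split_indicator)
      qed
      finally show ?thesis .
    qed
    ultimately show "measure \<rho> {t. norm (g t) \<ge> 1} \<le> 0 + e" by linarith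
  qed simp
  \<comment> \<open>The default value 0 is taken only on a \<open>\<rho>\<close>-null set. Where
    \<open>norm (g t) < 1\<close>, an open set, \<open>G\<close> is continuous, so weak convergence
    survives composition with it.\<close>
  define G where "G t = (if norm (g t) < 1 then K (g t) else 0)" for t
  have [measurable]: "G \<in> borel_measurable borel" unfolding G_def[abs_def] by measurable
  define N where "N = distr \<rho> borel G"
  interpret N: prob_space N unfolding N_def by (rule \<rho>.prob_space_distr) measurable
  have "(\<lambda>n. \<integral>x. f x \<partial>P (r n)) \<longlonglongrightarrow> (\<integral>x. f x \<partial>N)"
    if f: "continuous_on UNIV f" and B: "\<And>x. \<bar>f x\<bar> \<le> B" for f :: "'a \<Rightarrow> real" and B
  proof -
    have [measurable]: "f \<in> borel_measurable borel" using f by (rule borel_measurable_continuous_onI)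
    define h where "h t = f (G t)" for t
    have hm: "h \<in> borel_measurable borel" unfolding h_def[abs_def] by measurable
    have "{t. \<not> isCont h t} \<subseteq> {t. norm (g t) \<ge> 1}"
    proof (rule subsetI, rule ccontr)
      fix t assume t: "t \<in> {t. \<not> isCont h t}" "t \<notin> {t. norm (g t) \<ge> 1}"
      have op: "open {t. norm (g t) < 1}" by (intro open_Collect_less continuous_intros g)
      have "continuous_on {t. norm (g t) < 1} (\<lambda>t. f (K (g t)))"
        unfolding K_def by (rule continuous_on_compose2[OF f])
          (auto intro!: continuous_intros continuous_on_subset[OF g])
      then have "isCont (\<lambda>t. f (K (g t))) t"
        using op t by (simp add: continuous_on_eq_continuous_at)
      moreover have "\<forall>\<^sub>F t in nhds t. h t = f (K (g t))"
        using eventually_nhds_in_open[OF op, of t] t by (auto simp: h_def G_def elim!: eventually_mono)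
      ultimately have "isCont h t" by (simp only: isCont_cong[of h "\<lambda>t. f (K (g t))" t])
      with t show False by simp
    qed
    then have "measure \<rho> {t. \<not> isCont h t} = 0 \<and> emeasure \<rho> {t. \<not> isCont h t} = 0"
    proof -
      assume sub: "{t. \<not> isCont h t} \<subseteq> {t. norm (g t) \<ge> 1}"
      have "emeasure \<rho> {t. \<not> isCont h t} \<le> emeasure \<rho> {t. norm (g t) \<ge> 1}"
        by (rule emeasure_mono[OF sub]) simp
      also have "\<dots> = 0" using null by (simp add: \<rho>.emeasure_eq_measure)
      finally show ?thesis by (simp add: \<rho>.emeasure_eq_measure)
    qed
    then have "(\<lambda>n. \<integral>t. h t \<partial>(Q \<circ> r) n) \<longlonglongrightarrow> (\<integral>t. h t \<partial>\<rho>)"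
      by (intro weak_conv_imp_bdd_ae_continuous_conv[OF _ rd conv, of h B]) (auto simp: rdQ h_def B hm)
    moreover have "(\<integral>t. h t \<partial>(Q \<circ> r) n) = (\<integral>x. f x \<partial>P (r n))" for n
      unfolding comp_def intQ[OF hm] by (simp add: h_def G_def gsJ J1 KJ)
    moreover have "(\<integral>t. h t \<partial>\<rho>) = (\<integral>x. f x \<partial>N)"
      unfolding N_def h_def by (rule integral_distr[symmetric]) measurable
    ultimately show ?thesis by simp
  qed
  moreover have "finite_measure N" by unfold_locales
  moreover have "sets N = sets borel" by (simp add: N_def)
  ultimately show ?thesis using r by blast
qed

text \<open>Along a subsequence the total masses converge to some t. For t > 0 the measures are
  normalised and the limit is scaled back by t; for t = 0 normalisation could destroy tightness, but
  then the null measure is the limit.\<close>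

lemma tight_imp_weakly_convergent_subseq_finite:
  fixes P :: "nat \<Rightarrow> 'a::euclidean_space measure"
  assumes fin: "\<And>n. finite_measure (P n)" and sets: "\<And>n. sets (P n) = sets borel"
    and bdd: "\<And>n. measure (P n) UNIV \<le> C"
    and tight: "\<And>e. e > 0 \<Longrightarrow> \<exists>R. \<forall>\<^sub>F n in sequentially. measure (P n) {x. norm x > R} \<le> e"
  shows "\<exists>r N. strict_mono (r :: nat \<Rightarrow> nat) \<and> finite_measure N \<and> sets N = sets borel \<and>
    (\<forall>(f :: 'a \<Rightarrow> real) B. continuous_on UNIV f \<longrightarrow> (\<forall>x. \<bar>f x\<bar> \<le> B) \<longrightarrow>
       (\<lambda>n. \<integral>x. f x \<partial>P (r n)) \<longlonglongrightarrow> (\<integral>x. f x \<partial>N))"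
proof -
  have [measurable_cong]: "sets (P n) = sets borel" for n by (rule sets)
  have sp: "space (P n) = UNIV" for n using sets_eq_imp_space_eq[OF sets] by simp
  define m where "m n = measure (P n) UNIV" for n
  have "bounded (range m)"
    unfolding bounded_iff using bdd by (intro exI[of _ C]) (auto simp: m_def)
  then obtain t r where r: "strict_mono r" and t: "(m \<circ> r) \<longlonglongrightarrow> t"
    using bounded_imp_convergent_subsequence by blast
  have fi: "integrable (P n) f" if "continuous_on UNIV f" "\<And>x. \<bar>f x\<bar> \<le> B" for f :: "'a \<Rightarrow> real" and B n
  proof -
    interpret finite_measure "P n" by (rule fin)
    have [measurable]: "f \<in> borel_measurable borel" using that(1) by (rule borel_measurable_continuous_onI)
    show ?thesis by (rule integrable_const_bound[of _ B]) (auto simp: that)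
  qed
  show ?thesis
  proof (cases "t = 0")
    case True
    have "(\<lambda>n. \<integral>x. f x \<partial>P (r n)) \<longlonglongrightarrow> (\<integral>x. f x \<partial>null_measure borel)"
      if f: "continuous_on UNIV f" "\<And>x. \<bar>f x\<bar> \<le> B" for f :: "'a \<Rightarrow> real" and B
    proof -
      have "norm (\<integral>x. f x \<partial>P (r n)) \<le> m (r n) * B" for n
      proof -
        interpret finite_measure "P (r n)" by (rule fin)
        have "norm (\<integral>x. f x \<partial>P (r n)) \<le> (\<integral>x. \<bar>f x\<bar> \<partial>P (r n))"
          using integral_norm_bound[of "P (r n)" f] by simp
        also have "\<dots> \<le> (\<integral>x. B \<partial>P (r n))"
          by (rule integral_mono) (use fi[OF f] f in auto)
        finally show ?thesis by (simp add: m_def sp)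
      qed
      then have "\<forall>\<^sub>F n in sequentially. norm (\<integral>x. f x \<partial>P (r n)) \<le> m (r n) * B"
        by (intro always_eventually allI)
      moreover have "(\<lambda>n. m (r n) * B) \<longlonglongrightarrow> 0"
        using tendsto_mult_right[OF t, of B] True by (simp add: comp_def)
      ultimately have "(\<lambda>n. \<integral>x. f x \<partial>P (r n)) \<longlonglongrightarrow> 0"
        by (rule Lim_null_comparison)
      then show ?thesis by (simp add: integral_null_measure)
    qed
    moreover have "finite_measure (null_measure (borel :: 'a measure))"
      by (rule finite_measureI) simp
    ultimately show ?thesis using r sets_null_measure[of borel] by blast
  next
    case False
    have "t \<ge> 0" by (rule LIMSEQ_le_const[OF t]) (auto simp: m_def)
    with False have t0: "t > 0" by simp
    have "eventually (\<lambda>n. (m \<circ> r) n > t/2) sequentially"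
      by (rule order_tendstoD(1)[OF t]) (use t0 in simp)
    \<comment> \<open>The lower bound t/2 serves twice: the masses can be divided by, and tail
      bounds \<open>e * (t/2)\<close> become tail bounds e after normalisation.\<close>
    then obtain k where k: "\<And>n. n \<ge> k \<Longrightarrow> m (r n) > t/2"
      unfolding eventually_sequentially by auto
    define r' where "r' n = r (n + k)" for n
    have r': "strict_mono r'" using r unfolding r'_def strict_mono_def by simp
    have m': "m (r' n) > t/2" for n unfolding r'_def by (rule k) simp
    have m0: "m (r' n) > 0" for n using m'[of n] t0 by linarith
    define P' where "P' n = density (P (r' n)) (\<lambda>_. ennreal (1 / m (r' n)))" for n
    have P'e: "emeasure (P' n) A = ennreal (measure (P (r' n)) A / m (r' n))" if "A \<in> sets borel" for n A
    proof -
      interpret finite_measure "P (r' n)" by (rule fin)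
      have "emeasure (P' n) A = ennreal (1 / m (r' n)) * emeasure (P (r' n)) A"
        unfolding P'_def using that by (subst emeasure_density) (auto simp: sets nn_integral_cmult_indicator)
      also have "\<dots> = ennreal (1 / m (r' n) * measure (P (r' n)) A)"
        unfolding emeasure_eq_measure by (rule ennreal_mult[symmetric]) (use m0[of n] in auto)
      finally show ?thesis by simp
    qed
    have P's: "sets (P' n) = sets borel" for n by (simp add: P'_def sets)
    have P'sp: "space (P' n) = UNIV" for n by (simp add: P'_def sp)
    have P'p: "prob_space (P' n)" for n
      by (rule prob_spaceI) (use m0[of n] in \<open>simp add: P'e P'sp m_def\<close>)
    have tight': "\<exists>R. \<forall>\<^sub>F n in sequentially. measure (P' n) {x. norm x > R} \<le> e" if "e > 0" for e :: real
    proof -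
      have "e * (t/2) > 0" using t0 that by simp
      then obtain R where R: "\<forall>\<^sub>F n in sequentially. measure (P n) {x. norm x > R} \<le> e * (t/2)"
        using tight by blast
      have "\<forall>\<^sub>F n in sequentially. measure (P' n) {x. norm x > R} \<le> e"
        using eventually_subseq[OF r' R]
      proof (rule eventually_mono)
        fix n assume le: "measure (P (r' n)) {x. norm x > R} \<le> e * (t/2)"
        have "measure (P' n) {x. norm x > R} = measure (P (r' n)) {x. norm x > R} / m (r' n)"
          using m0[of n] by (simp add: measure_def[of "P' n"] P'e)
        also have "\<dots> \<le> e * (t/2) / m (r' n)"
          by (rule divide_right_mono[OF le]) (use m0[of n] in simp)
        also have "\<dots> \<le> e" using m'[of n] m0[of n] that by (simp add: field_simps)
        finally show "measure (P' n) {x. norm x > R} \<le> e" .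
      qed
      then show ?thesis by blast
    qed
    obtain r2 N where r2: "strict_mono r2" and N: "finite_measure N" "sets N = sets borel"
      and conv: "\<And>(f :: 'a \<Rightarrow> real) B. continuous_on UNIV f \<Longrightarrow> (\<And>x. \<bar>f x\<bar> \<le> B) \<Longrightarrow>
       (\<lambda>n. \<integral>x. f x \<partial>P' (r2 n)) \<longlonglongrightarrow> (\<integral>x. f x \<partial>N)"
      using tight_imp_weakly_convergent_subseq[of P', OF P'p P's tight'] by blast
    interpret N: finite_measure N by (rule N(1))
    note N(2)[measurable_cong]
    define N' where "N' = density N (\<lambda>_. ennreal t)"
    have N's: "sets N' = sets borel" by (simp add: N'_def N)
    have N'f: "finite_measure N'"
      by (rule finite_measureI)
         (simp add: N'_def emeasure_density nn_integral_cmult_indicator ennreal_mult_eq_top_iff)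
    have rr: "strict_mono (r' \<circ> r2)" using r' r2 by (rule strict_mono_o)
    have "(\<lambda>n. \<integral>x. f x \<partial>P ((r' \<circ> r2) n)) \<longlonglongrightarrow> (\<integral>x. f x \<partial>N')"
      if f: "continuous_on UNIV f" "\<And>x. \<bar>f x\<bar> \<le> B" for f :: "'a \<Rightarrow> real" and B
    proof -
      have [measurable]: "f \<in> borel_measurable borel" using f(1) by (rule borel_measurable_continuous_onI)
      have 1: "(\<integral>x. f x \<partial>P' n) = (\<integral>x. f x \<partial>P (r' n)) / m (r' n)" for n
        unfolding P'_def by (subst integral_density) (use m0[of n] in \<open>auto simp: sets\<close>)
      have 2: "(\<integral>x. f x \<partial>N') = t * (\<integral>x. f x \<partial>N)"
        unfolding N'_def by (subst integral_density) (use t0 in auto)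
      have "(\<lambda>n. m (r' n)) \<longlonglongrightarrow> t"
        using LIMSEQ_ignore_initial_segment[OF t, of k] by (simp add: r'_def comp_def)
      then have "(\<lambda>n. m (r' (r2 n))) \<longlonglongrightarrow> t"
        using LIMSEQ_subseq_LIMSEQ[OF _ r2] by (fastforce simp: comp_def)
      from tendsto_mult[OF this conv[OF f]]
      have "(\<lambda>n. m (r' (r2 n)) * (\<integral>x. f x \<partial>P' (r2 n))) \<longlonglongrightarrow> t * (\<integral>x. f x \<partial>N)" .
      moreover have "m (r' (r2 n)) * (\<integral>x. f x \<partial>P' (r2 n)) = (\<integral>x. f x \<partial>P (r' (r2 n)))" for n
        unfolding 1 using m0[of "r2 n"] by simp
      ultimately show ?thesis by (simp add: 2)
    qed
    then show ?thesis using rr N'f N's by blast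
  qed
qed

section \<open>Measures determined by halfspaces away from the origin\<close>

definition poly_bounded :: "('a::euclidean_space \<Rightarrow> real) \<Rightarrow> bool" where
  "poly_bounded f \<longleftrightarrow> f \<in> borel_measurable borel \<and> (\<exists>C n. \<forall>x. \<bar>f x\<bar> \<le> C * (1 + norm x) ^ n)"

lemma poly_boundedI:
  assumes "f \<in> borel_measurable borel" "\<And>x. \<bar>f x\<bar> \<le> C * (1 + norm x) ^ n"
  shows "poly_bounded f"
  using assms unfolding poly_bounded_def by blast

lemma poly_boundedE:
  assumes "poly_bounded f"
  obtains C n where "0 \<le> C" "\<And>x. \<bar>f x\<bar> \<le> C * (1 + norm x) ^ n" "f \<in> borel_measurable borel"
proof -
  obtain C n where C: "\<And>x. \<bar>f x\<bar> \<le> C * (1 + norm x) ^ n" "f \<in> borel_measurable borel"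
    using assms unfolding poly_bounded_def by blast
  have "0 \<le> C" using C(1)[of 0] by simp
  with C show ?thesis using that by blast
qed

lemma poly_bounded_mono:
  assumes "poly_bounded g" "f \<in> borel_measurable borel" "\<And>x. \<bar>f x\<bar> \<le> \<bar>g x\<bar>"
  shows "poly_bounded f"
  using assms unfolding poly_bounded_def by (meson order_trans)

lemma poly_bounded_const: "poly_bounded (\<lambda>x. c)"
  by (rule poly_boundedI[of _ "\<bar>c\<bar>" 0]) auto

lemma poly_bounded_norm: "poly_bounded (\<lambda>x. norm x)"
  by (rule poly_boundedI[of _ 1 1]) auto

lemma poly_bounded_inner: "poly_bounded (\<lambda>x. x \<bullet> v)"
proof (rule poly_boundedI[of _ "norm v" 1])
  fix x :: 'a
  have "\<bar>x \<bullet> v\<bar> \<le> norm v * norm x" using Cauchy_Schwarz_ineq2[of x v] by (simp add: mult.commute)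
  also have "\<dots> \<le> norm v * (1 + norm x) ^ 1" by (intro mult_left_mono) auto
  finally show "\<bar>x \<bullet> v\<bar> \<le> norm v * (1 + norm x) ^ 1" .
qed measurable

lemma poly_bounded_abs: "poly_bounded f \<Longrightarrow> poly_bounded (\<lambda>x. \<bar>f x\<bar>)"
  unfolding poly_bounded_def by auto

lemma poly_bounded_add:
  assumes "poly_bounded f" "poly_bounded g"
  shows "poly_bounded (\<lambda>x. f x + g x)"
proof -
  obtain C n where C: "0 \<le> C" "\<And>x. \<bar>f x\<bar> \<le> C * (1 + norm x) ^ n" and [measurable]: "f \<in> borel_measurable borel"
    using poly_boundedE[OF assms(1)] by metis
  obtain D m where D: "0 \<le> D" "\<And>x. \<bar>g x\<bar> \<le> D * (1 + norm x) ^ m" and [measurable]: "g \<in> borel_measurable borel"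
    using poly_boundedE[OF assms(2)] by metis
  show ?thesis
  proof (rule poly_boundedI[of _ "C + D" "max n m"])
    fix x :: 'a
    have "C * (1 + norm x) ^ n \<le> C * (1 + norm x) ^ max n m"
      using C by (intro mult_left_mono power_increasing) auto
    moreover have "D * (1 + norm x) ^ m \<le> D * (1 + norm x) ^ max n m"
      using D by (intro mult_left_mono power_increasing) auto
    ultimately show "\<bar>f x + g x\<bar> \<le> (C + D) * (1 + norm x) ^ max n m"
      using C(2)[of x] D(2)[of x] unfolding distrib_right by linarith
  qed measurable
qed

lemma poly_bounded_mult:
  assumes "poly_bounded f" "poly_bounded g"
  shows "poly_bounded (\<lambda>x. f x * g x)"
proof -
  obtain C n where C: "0 \<le> C" "\<And>x. \<bar>f x\<bar> \<le> C * (1 + norm x) ^ n" and [measurable]: "f \<in> borel_measurable borel"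
    using poly_boundedE[OF assms(1)] by metis
  obtain D m where D: "0 \<le> D" "\<And>x. \<bar>g x\<bar> \<le> D * (1 + norm x) ^ m" and [measurable]: "g \<in> borel_measurable borel"
    using poly_boundedE[OF assms(2)] by metis
  show ?thesis
  proof (rule poly_boundedI[of _ "C * D" "n + m"])
    fix x :: 'a
    have "\<bar>f x * g x\<bar> \<le> (C * (1 + norm x) ^ n) * (D * (1 + norm x) ^ m)"
      unfolding abs_mult by (rule mult_mono[OF C(2) D(2)]) (use C(1) in auto)
    then show "\<bar>f x * g x\<bar> \<le> (C * D) * (1 + norm x) ^ (n + m)"
      by (simp add: power_add mult_ac)
  qed measurable
qed

lemma poly_bounded_power: "poly_bounded f \<Longrightarrow> poly_bounded (\<lambda>x. f x ^ k)"
  by (induction k) (auto intro: poly_bounded_const poly_bounded_mult)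

lemmas poly_bounded_intros = poly_bounded_const poly_bounded_norm poly_bounded_inner poly_bounded_abs
  poly_bounded_add poly_bounded_mult poly_bounded_power

lemma poly_bounded_pos_part:
  assumes "poly_bounded f" shows "poly_bounded (\<lambda>x. max 0 (f x))"
proof (rule poly_bounded_mono[OF assms])
  have "f \<in> borel_measurable borel" using assms unfolding poly_bounded_def by simp
  then show "(\<lambda>x. max 0 (f x)) \<in> borel_measurable borel" by measurable
qed auto

lemma poly_bounded_diff_const: "poly_bounded f \<Longrightarrow> poly_bounded (\<lambda>x. f x - c)"
  using poly_bounded_add[OF _ poly_bounded_const[of "- c"]] by simp

lemma linear_functional_inner:
  fixes f :: "'a::euclidean_space \<Rightarrow> real"
  assumes "bounded_linear f"
  obtains v where "f = (\<lambda>x. x \<bullet> v)"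
proof -
  have lin: "linear f" using assms by (rule bounded_linear.linear)
  have "f x = x \<bullet> (\<Sum>b\<in>Basis. f b *\<^sub>R b)" for x
  proof -
    have "f x = f (\<Sum>b\<in>Basis. (x \<bullet> b) *\<^sub>R b)" by (simp add: euclidean_representation)
    also have "\<dots> = (\<Sum>b\<in>Basis. (x \<bullet> b) * f b)"
      by (simp add: linear_sum[OF lin] linear_cmul[OF lin])
    finally show ?thesis by (simp add: inner_sum_right mult.commute)
  qed
  then show ?thesis using that by blast
qed

lemma poly_bounded_polynomial:
  fixes Q :: "'a::euclidean_space \<Rightarrow> real"
  assumes "real_polynomial_function Q" shows "poly_bounded Q"
  using assms
proof (induction rule: real_polynomial_function.induct)
  case (linear f)
  then obtain v where "f = (\<lambda>x. x \<bullet> v)" by (rule linear_functional_inner)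
  then show ?case by (simp add: poly_bounded_inner)
qed (auto intro: poly_bounded_intros)

definition finite_moments :: "'a::euclidean_space measure \<Rightarrow> bool" where
  "finite_moments M \<longleftrightarrow> finite_measure M \<and> sets M = sets borel \<and> (\<forall>n. integrable M (\<lambda>x. norm x ^ n))"

lemma integrable_poly_bounded:
  assumes M: "finite_moments M" and f: "poly_bounded f"
  shows "integrable M f"
proof -
  interpret finite_measure M using M by (simp add: finite_moments_def)
  have [measurable_cong]: "sets M = sets borel" using M by (simp add: finite_moments_def)
  obtain C n where C: "0 \<le> C" "\<And>x. \<bar>f x\<bar> \<le> C * (1 + norm x) ^ n" and [measurable]: "f \<in> borel_measurable borel"
    using poly_boundedE[OF f] by metis
  show ?thesis
  proof (rule Bochner_Integration.integrable_bound)
    have "(1 + norm x) ^ n = (\<Sum>k\<le>n. of_nat (n choose k) * norm x ^ k)" for x :: 'a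
      using binomial_ring[of "norm x" 1 n] by (simp add: add.commute)
    then show "integrable M (\<lambda>x. C * (1 + norm x) ^ n)"
      using M by (simp add: finite_moments_def)
    show "AE x in M. norm (f x) \<le> norm (C * (1 + norm x) ^ n)"
      using C by (intro AE_I2) (simp add: abs_mult)
  qed measurable
qed

lemma integral_density_indicator:
  fixes f :: "'a::euclidean_space \<Rightarrow> real"
  assumes sets: "sets M = sets borel" and S: "S \<in> sets borel"
    and f: "f \<in> borel_measurable borel" "\<And>x. x \<notin> S \<Longrightarrow> f x = 0"
  shows "integrable (density M (indicator S)) f \<longleftrightarrow> integrable M f"
    and "(\<integral>x. f x \<partial>density M (indicator S)) = (\<integral>x. f x \<partial>M)"
proof -
  note sets[measurable_cong] S[measurable] f(1)[measurable]
  have d: "density M (indicator S) = density M (\<lambda>x. ennreal (indicator S x))" by (simp add: ennreal_indicator)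
  have fi: "indicator S x * f x = f x" for x using f(2)[of x] by (auto simp: indicator_def)
  show "integrable (density M (indicator S)) f \<longleftrightarrow> integrable M f"
    unfolding d by (subst integrable_density) (auto simp: fi)
  show "(\<integral>x. f x \<partial>density M (indicator S)) = (\<integral>x. f x \<partial>M)"
    unfolding d by (subst integral_density) (auto simp: fi)
qed

lemma halfspace_borel[measurable, simp]: "halfspace \<omega> p \<in> sets borel"
  unfolding halfspace_def by measurable

section \<open>Ridge integrals and polynomial weights\<close>

text \<open>Only the part of the measures in \<open>halfspace \<omega> q\<close> matters. Its image
  under x \<mapsto> - (x . \<omega>) is a finite measure on the line, determined by its upper tails;
  the sign turns those tails into halfspaces of offset at most q, where the measures agree.\<close>

lemma ridge_integral_eq_of_halfspaces:
  fixes M1 M2 :: "'a::euclidean_space measure"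
  assumes M: "finite_moments M1" "finite_moments M2"
    and eq: "\<And>p. p < - r \<Longrightarrow> emeasure M1 (halfspace \<omega> p) = emeasure M2 (halfspace \<omega> p)"
    and h: "h \<in> borel_measurable borel" "\<And>t. t \<ge> q \<Longrightarrow> h t = 0" and q: "q < - r"
  shows "(\<integral>x. h (x \<bullet> \<omega>) \<partial>M1) = (\<integral>x. (h (x \<bullet> \<omega>) :: real) \<partial>M2)"
proof -
  note h(1)[measurable]
  define D where "D M = distr (density M (indicator (halfspace \<omega> q))) borel (\<lambda>x. - (x \<bullet> \<omega>))" for M :: "'a measure"
  have D: "emeasure (D M) {t<..} = emeasure M (halfspace \<omega> (min q (- t)))"
    "(\<integral>y. h (- y) \<partial>D M) = (\<integral>x. h (x \<bullet> \<omega>) \<partial>M)"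
    "sets (D M) = sets borel"
    if "finite_moments M" for M t
  proof -
    have [measurable_cong]: "sets M = sets borel" using that by (simp add: finite_moments_def)
    have sp: "space M = UNIV" using sets_eq_imp_space_eq[of M borel] that by (simp add: finite_moments_def)
    have "emeasure (D M) {t<..} = emeasure (density M (indicator (halfspace \<omega> q))) (halfspace \<omega> (- t))"
      unfolding D_def by (subst emeasure_distr) (auto simp: halfspace_def sp intro!: arg_cong2[where f=emeasure])
    also have "\<dots> = emeasure M (halfspace \<omega> q \<inter> halfspace \<omega> (- t))"
      by (rule emeasure_restricted) measurable
    also have "halfspace \<omega> q \<inter> halfspace \<omega> (- t) = halfspace \<omega> (min q (- t))" by (auto simp: halfspace_def)
    finally show "emeasure (D M) {t<..} = emeasure M (halfspace \<omega> (min q (- t)))" .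
    show "sets (D M) = sets borel" by (simp add: D_def)
    have "(\<integral>y. h (- y) \<partial>D M) = (\<integral>x. h (x \<bullet> \<omega>) \<partial>density M (indicator (halfspace \<omega> q)))"
      unfolding D_def by (subst integral_distr) auto
    also have "\<dots> = (\<integral>x. h (x \<bullet> \<omega>) \<partial>M)"
      by (rule integral_density_indicator(2)) (use that h(2) in \<open>auto simp: finite_moments_def halfspace_def\<close>)
    finally show "(\<integral>y. h (- y) \<partial>D M) = (\<integral>x. h (x \<bullet> \<omega>) \<partial>M)" .
  qed
  have "D M1 = D M2"
  proof (rule measure_eqI_lessThan)
    show "emeasure (D M1) {x<..} < \<infinity>" for x
      using M(1) finite_measure.emeasure_finite[of M1] by (simp add: D(1)[OF M(1)] finite_moments_def less_top)
    show "emeasure (D M1) {x<..} = emeasure (D M2) {x<..}" for x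
      using q by (simp add: D(1)[OF M(1)] D(1)[OF M(2)] eq)
  qed (use D(3) M in auto)
  then show ?thesis using D(2)[OF M(1)] D(2)[OF M(2)] by simp
qed

lemma has_real_derivative_max_0_power:
  assumes "k \<ge> 1"
  shows "((\<lambda>s::real. max 0 s ^ Suc k) has_real_derivative (real (Suc k) * max 0 s ^ k)) (at s)"
proof -
  consider "s > 0" | "s < 0" | "s = 0" by linarith
  then show ?thesis
  proof cases
    case 1
    have "((\<lambda>s. s ^ Suc k) has_real_derivative (real (Suc k) * max 0 s ^ k)) (at s)"
      using 1 DERIV_pow[of "Suc k" s] by simp
    then show ?thesis
      by (rule has_field_derivative_transform_within_open[where S = "{0<..}"]) (use 1 in auto)
  next
    case 2
    have "((\<lambda>s. 0) has_real_derivative (real (Suc k) * max 0 s ^ k)) (at s)"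
      using 2 assms by (simp add: power_0_left)
    then show ?thesis
      by (rule has_field_derivative_transform_within_open[where S = "{..<0}"]) (use 2 in auto)
  next
    case 3
    have "((\<lambda>h::real. (max 0 (0 + h) ^ Suc k - max 0 0 ^ Suc k) / h) \<longlongrightarrow> 0) (at 0)"
    proof (rule Lim_null_comparison)
      show "\<forall>\<^sub>F h::real in at 0. norm ((max 0 (0 + h) ^ Suc k - max 0 0 ^ Suc k) / h) \<le> \<bar>h\<bar> ^ k"
        by (intro always_eventually allI) (auto simp: max_def)
      have "((\<lambda>h::real. \<bar>h\<bar> ^ k) \<longlongrightarrow> \<bar>0\<bar> ^ k) (at 0)" by (intro tendsto_intros)
      moreover have "\<bar>0::real\<bar> ^ k = 0" using assms by simp
      ultimately show "((\<lambda>h::real. \<bar>h\<bar> ^ k) \<longlongrightarrow> 0) (at 0)" by (simp only:)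
    qed
    then show ?thesis using 3 assms by (simp add: DERIV_def power_0_left)
  qed
qed

lemma max_0_power_diff_le:
  fixes a b B :: real
  assumes "k \<ge> 1" "a \<le> B" "b \<le> B" "0 \<le> B"
  shows "\<bar>max 0 a ^ Suc k - max 0 b ^ Suc k\<bar> \<le> real (Suc k) * B ^ k * \<bar>a - b\<bar>"
proof -
  have "norm (max 0 a ^ Suc k - max 0 b ^ Suc k) \<le> real (Suc k) * B ^ k * norm (a - b)"
  proof (rule field_differentiable_bound[where S = "{..B}" and f = "\<lambda>s. max 0 s ^ Suc k"
        and f' = "\<lambda>s. real (Suc k) * max 0 s ^ k"])
    show "((\<lambda>s. max 0 s ^ Suc k) has_real_derivative (real (Suc k) * max 0 z ^ k)) (at z within {..B})" for z :: real
      using has_real_derivative_max_0_power[OF assms(1)] by (rule DERIV_subset) simp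
    show "norm (real (Suc k) * max 0 z ^ k) \<le> real (Suc k) * B ^ k" if "z \<in> {..B}" for z
    proof -
      have "max 0 z ^ k \<le> B ^ k" using that assms by (intro power_mono) auto
      then have "real (Suc k) * max 0 z ^ k \<le> real (Suc k) * B ^ k" by (rule mult_left_mono) simp
      then show ?thesis by (simp add: abs_mult)
    qed
  qed (use assms in auto)
  then show ?thesis by simp
qed

text \<open>Differentiating the vanishing of all ridge integrals in the direction parameter multiplies the
  integrand by a linear function; iterating gives all polynomial factors. This is where rapid decay enters.\<close>

definition ridge_agree :: "real \<Rightarrow> 'a::euclidean_space measure \<Rightarrow> 'a measure \<Rightarrow> ('a \<Rightarrow> real) \<Rightarrow> bool" where
  "ridge_agree r M1 M2 Q \<longleftrightarrow> (\<forall>k\<ge>1. \<forall>w g. g > r * norm w \<longrightarrow>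
     (\<integral>x. Q x * max 0 (x \<bullet> w - g) ^ k \<partial>M1) = (\<integral>x. Q x * max 0 (x \<bullet> w - g) ^ k \<partial>M2))"

lemma ridge_agree_inner_mult:
  fixes M1 M2 :: "'a::euclidean_space measure"
  assumes M: "finite_moments M1" "finite_moments M2"
    and Q: "poly_bounded Q" and agree: "ridge_agree r M1 M2 Q"
  shows "ridge_agree r M1 M2 (\<lambda>x. (x \<bullet> v) * Q x)"
  unfolding ridge_agree_def
proof (intro allI impI)
  fix k :: nat and w :: 'a and g :: real
  assume k: "1 \<le> k" and g: "r * norm w < g"
  have Qm[measurable]: "Q \<in> borel_measurable borel" using Q by (simp add: poly_bounded_def)
  define h where "h n = inverse (real (Suc n))" for n
  have h0: "h n > 0" "h n \<le> 1" "h n \<noteq> 0" for n unfolding h_def by (auto simp: divide_simps)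
  have hl: "h \<longlonglongrightarrow> 0" unfolding h_def by (rule LIMSEQ_inverse_real_of_nat)
  \<comment> \<open>A difference quotient in the direction v. Its power \<open>Suc k\<close> drops
    to k in the limit, which is why \<open>ridge_agree\<close> covers all powers k \<ge> 1 at once
    and not only the first.\<close>
  define F where "F n x = Q x * ((max 0 (x \<bullet> (w + h n *\<^sub>R v) - g) ^ Suc k - max 0 (x \<bullet> w - g) ^ Suc k) / h n)" for n x
  define G where "G x = Q x * (real (Suc k) * max 0 (x \<bullet> w - g) ^ k * (x \<bullet> v))" for x
  define D where "D x = \<bar>Q x\<bar> * (real (Suc k) * (norm x * (norm w + norm v) + \<bar>g\<bar>) ^ k * \<bar>x \<bullet> v\<bar>)" for x
  have pt: "(\<lambda>n. F n x) \<longlonglongrightarrow> G x" for x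
  proof -
    let ?f = "\<lambda>s. max 0 s ^ Suc k :: real"
    have "((\<lambda>t. ?f ((x \<bullet> w - g) + t * (x \<bullet> v))) has_real_derivative
        (real (Suc k) * max 0 (x \<bullet> w - g) ^ k) * (x \<bullet> v)) (at 0)"
      by (rule DERIV_chain2[where f = ?f and g = "\<lambda>t. (x \<bullet> w - g) + t * (x \<bullet> v)"])
         (use has_real_derivative_max_0_power[OF k, of "x \<bullet> w - g"] in
           \<open>auto intro!: derivative_eq_intros simp del: power_Suc\<close>)
    then have "((\<lambda>t. (?f ((x \<bullet> w - g) + t * (x \<bullet> v)) - ?f (x \<bullet> w - g)) / t) \<longlongrightarrow>
        (real (Suc k) * max 0 (x \<bullet> w - g) ^ k) * (x \<bullet> v)) (at 0)"
      by (simp add: DERIV_def)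
    then have "(\<lambda>n. (?f ((x \<bullet> w - g) + h n * (x \<bullet> v)) - ?f (x \<bullet> w - g)) / h n) \<longlonglongrightarrow>
        (real (Suc k) * max 0 (x \<bullet> w - g) ^ k) * (x \<bullet> v)"
      by (rule tendsto_compose_eventually[OF _ hl]) (use h0(3) in auto)
    then have "(\<lambda>n. Q x * ((?f ((x \<bullet> w - g) + h n * (x \<bullet> v)) - ?f (x \<bullet> w - g)) / h n)) \<longlonglongrightarrow> G x"
      unfolding G_def by (rule tendsto_mult_left)
    then show ?thesis unfolding F_def by (simp add: inner_add_right algebra_simps)
  qed
  have bd: "norm (F n x) \<le> D x" for n x
  proof -
    define B where "B = norm x * (norm w + norm v) + \<bar>g\<bar>"
    have B0: "0 \<le> B" by (simp add: B_def)
    have "norm (w + h n *\<^sub>R v) \<le> norm w + norm v"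
    proof -
      have "norm (h n *\<^sub>R v) \<le> norm v" using h0[of n] by (simp add: mult_left_le_one_le)
      then show ?thesis using norm_triangle_ineq[of w "h n *\<^sub>R v"] by linarith
    qed
    then have "norm x * norm (w + h n *\<^sub>R v) \<le> norm x * (norm w + norm v)" by (rule mult_left_mono) simp
    then have 1: "x \<bullet> (w + h n *\<^sub>R v) - g \<le> B"
      using norm_cauchy_schwarz[of x "w + h n *\<^sub>R v"] unfolding B_def by linarith
    have "norm x * norm w \<le> norm x * (norm w + norm v)" by (rule mult_left_mono) auto
    then have 2: "x \<bullet> w - g \<le> B" using norm_cauchy_schwarz[of x w] unfolding B_def by linarith
    have "\<bar>max 0 (x \<bullet> (w + h n *\<^sub>R v) - g) ^ Suc k - max 0 (x \<bullet> w - g) ^ Suc k\<bar>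
      \<le> real (Suc k) * B ^ k * \<bar>(x \<bullet> (w + h n *\<^sub>R v) - g) - (x \<bullet> w - g)\<bar>"
      by (rule max_0_power_diff_le[OF k 1 2 B0])
    also have "(x \<bullet> (w + h n *\<^sub>R v) - g) - (x \<bullet> w - g) = h n * (x \<bullet> v)" by (simp add: inner_add_right)
    finally have "\<bar>max 0 (x \<bullet> (w + h n *\<^sub>R v) - g) ^ Suc k - max 0 (x \<bullet> w - g) ^ Suc k\<bar> / h n
      \<le> real (Suc k) * B ^ k * \<bar>x \<bullet> v\<bar>"
      using h0[of n] by (subst pos_divide_le_eq) (simp_all add: abs_mult mult_ac)
    then have "\<bar>Q x\<bar> * (\<bar>max 0 (x \<bullet> (w + h n *\<^sub>R v) - g) ^ Suc k - max 0 (x \<bullet> w - g) ^ Suc k\<bar> / h n)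
      \<le> \<bar>Q x\<bar> * (real (Suc k) * B ^ k * \<bar>x \<bullet> v\<bar>)" by (rule mult_left_mono) simp
    then show ?thesis using h0(1)[of n] unfolding F_def D_def B_def[symmetric] real_norm_def abs_mult abs_divide by simp
  qed
  have Dp: "poly_bounded D" unfolding D_def by (intro poly_bounded_intros Q)
  have Dm[measurable]: "D \<in> borel_measurable borel" using Dp by (simp add: poly_bounded_def)
  have [measurable]: "F n \<in> borel_measurable borel" "G \<in> borel_measurable borel" for n
    unfolding F_def[abs_def] G_def[abs_def] by measurable
  have conv: "(\<lambda>n. integral\<^sup>L M (F n)) \<longlonglongrightarrow> integral\<^sup>L M G" if "finite_moments M" for M
  proof (rule integral_dominated_convergence[where w = D])
    have [measurable_cong]: "sets M = sets borel" using that by (simp add: finite_moments_def)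
    show "G \<in> borel_measurable M" "F n \<in> borel_measurable M" for n by measurable
    show "integrable M D" using that Dp by (rule integrable_poly_bounded)
  qed (use pt bd in auto)
  \<comment> \<open>The condition g > r |w| is open, so it holds for the perturbed directions from
    some index on; both terms of the quotient are then covered by the hypothesis.\<close>
  have "(\<lambda>n. r * norm (w + h n *\<^sub>R v)) \<longlonglongrightarrow> r * norm (w + 0 *\<^sub>R v)"
    by (intro tendsto_intros hl)
  then have "\<forall>\<^sub>F n in sequentially. r * norm (w + h n *\<^sub>R v) < g"
    by (rule order_tendstoD(2)) (use g in simp)
  then have ev: "\<forall>\<^sub>F n in sequentially. integral\<^sup>L M1 (F n) = integral\<^sup>L M2 (F n)"
  proof (rule eventually_mono)
    fix n assume gn: "r * norm (w + h n *\<^sub>R v) < g"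
    let ?a = "\<lambda>x. Q x * max 0 (x \<bullet> (w + h n *\<^sub>R v) - g) ^ Suc k" and ?b = "\<lambda>x. Q x * max 0 (x \<bullet> w - g) ^ Suc k"
    have "poly_bounded ?a" "poly_bounded ?b"
      by (intro poly_bounded_intros poly_bounded_pos_part poly_bounded_diff_const Q)+
    then have int: "integrable M ?a" "integrable M ?b" if "finite_moments M" for M
      using that by (auto intro: integrable_poly_bounded)
    have F: "F n = (\<lambda>x. (?a x - ?b x) / h n)" unfolding F_def by (auto simp: fun_eq_iff algebra_simps diff_divide_distrib)
    have *: "integral\<^sup>L M (F n) = (integral\<^sup>L M ?a - integral\<^sup>L M ?b) / h n" if "finite_moments M" for M
      unfolding F using int[OF that] by simp
    have "integral\<^sup>L M1 ?a = integral\<^sup>L M2 ?a" "integral\<^sup>L M1 ?b = integral\<^sup>L M2 ?b"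
      using agree k g gn unfolding ridge_agree_def by (auto simp del: power_Suc)
    then show "integral\<^sup>L M1 (F n) = integral\<^sup>L M2 (F n)" by (simp only: *[OF M(1)] *[OF M(2)])
  qed
  have "integral\<^sup>L M1 G = integral\<^sup>L M2 G"
    using conv[OF M(1)] Lim_transform_eventually[OF conv[OF M(2)] eventually_mono[OF ev sym]]
    by (rule LIMSEQ_unique)
  moreover have G: "G = (\<lambda>x. real (Suc k) * (x \<bullet> v * Q x * max 0 (x \<bullet> w - g) ^ k))"
    unfolding G_def by (auto simp: fun_eq_iff)
  ultimately have "real (Suc k) * (\<integral>x. x \<bullet> v * Q x * max 0 (x \<bullet> w - g) ^ k \<partial>M1)
    = real (Suc k) * (\<integral>x. x \<bullet> v * Q x * max 0 (x \<bullet> w - g) ^ k \<partial>M2)"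
    unfolding G by (simp only: integral_mult_right_zero)
  then show "(\<integral>x. x \<bullet> v * Q x * max 0 (x \<bullet> w - g) ^ k \<partial>M1) = (\<integral>x. x \<bullet> v * Q x * max 0 (x \<bullet> w - g) ^ k \<partial>M2)"
    by (simp only: mult_cancel_left of_nat_eq_0_iff) simp
qed

text \<open>The induction carries an arbitrary polynomial weight \<open>Q\<close> along, so that a
  product f g is handled by multiplying with g first and with f afterwards; linear factors are the
  derivative step.\<close>

lemma ridge_agree_polynomial:
  fixes M1 M2 :: "'a::euclidean_space measure"
  assumes M: "finite_moments M1" "finite_moments M2" and agree: "ridge_agree r M1 M2 (\<lambda>_. 1)"
    and P: "real_polynomial_function P"
  shows "ridge_agree r M1 M2 P"
proof -
  have "real_polynomial_function Q \<Longrightarrow> ridge_agree r M1 M2 Q \<Longrightarrow> ridge_agree r M1 M2 (\<lambda>x. P x * Q x)" for Q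
    using P
  proof (induction arbitrary: Q rule: real_polynomial_function.induct)
    case (linear f)
    obtain v where "f = (\<lambda>x. x \<bullet> v)" using linear(1) by (rule linear_functional_inner)
    then show ?case
      using ridge_agree_inner_mult[OF M poly_bounded_polynomial[OF linear(2)] linear(3)] by simp
  next
    case (const c)
    then show ?case unfolding ridge_agree_def by (simp add: mult.assoc)
  next
    case (add f g)
    have *: "integrable M (\<lambda>x. f x * Q x * max 0 (x \<bullet> w - c) ^ k)" "integrable M (\<lambda>x. g x * Q x * max 0 (x \<bullet> w - c) ^ k)"
      if "finite_moments M" for M w c k
      by (intro integrable_poly_bounded[OF that] poly_bounded_intros poly_bounded_pos_part
            poly_bounded_diff_const poly_bounded_polynomial add)+
    show ?case
      using add.IH(1)[OF add.prems] add.IH(2)[OF add.prems]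
      unfolding ridge_agree_def distrib_right
      by (simp add: *[OF M(1)] *[OF M(2)])
  next
    case (mult f g)
    have "ridge_agree r M1 M2 (\<lambda>x. f x * (g x * Q x))"
      by (intro mult.IH mult.prems real_polynomial_function.intros(4) mult.hyps)
    then show ?case by (simp add: mult.assoc)
  qed
  from this[OF real_polynomial_function.intros(2)[of 1] agree] show ?thesis by simp
qed


section \<open>Finite differences in the offset\<close>

text \<open>The forward difference of order n with step h; its nodes are g, g + h, ..., g + n
  h.\<close>

primrec fdiff :: "real \<Rightarrow> nat \<Rightarrow> (real \<Rightarrow> real) \<Rightarrow> real \<Rightarrow> real" where
  "fdiff h 0 F g = F g"
| "fdiff h (Suc n) F g = fdiff h n F (g + h) - fdiff h n F g"

lemma fdiff_cong:
  assumes "h \<ge> 0" "\<And>t. g \<le> t \<Longrightarrow> t \<le> g + real n * h \<Longrightarrow> F t = G t"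
  shows "fdiff h n F g = fdiff h n G g"
  using assms(2)
proof (induction n arbitrary: g)
  case (Suc n)
  have "fdiff h n F (g + h) = fdiff h n G (g + h)"
    by (rule Suc.IH, rule Suc.prems) (use assms(1) in \<open>auto simp: algebra_simps\<close>)
  moreover have "fdiff h n F g = fdiff h n G g"
    by (rule Suc.IH, rule Suc.prems) (use assms(1) in \<open>auto simp: algebra_simps\<close>)
  ultimately show ?case by simp
qed simp

lemma fdiff_zero:
  assumes "h \<ge> 0" "\<And>t. g \<le> t \<Longrightarrow> F t = 0"
  shows "fdiff h n F g = 0"
proof -
  have "fdiff h n (\<lambda>_. 0) g = 0" for g by (induction n arbitrary: g) auto
  then show ?thesis using fdiff_cong[OF assms(1), of g n F "\<lambda>_. 0"] assms(2) by simp
qed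

text \<open>Of all nodes only g itself contributes, with the coefficient (-1)^n.\<close>

lemma fdiff_first:
  assumes "h \<ge> 0" "\<And>t. g + h \<le> t \<Longrightarrow> F t = 0"
  shows "fdiff h n F g = (-1) ^ n * F g"
  by (induction n) (simp_all add: fdiff_zero[OF assms])

lemma has_real_derivative_fdiff_poly:
  "(fdiff h n (poly p) has_real_derivative fdiff h n (poly (pderiv p)) g) (at g)"
proof (induction n arbitrary: g)
  case 0
  have "fdiff h 0 F = F" for F by (rule ext) simp
  then show ?case by (simp only: poly_DERIV)
next
  case (Suc n)
  have "((\<lambda>g. fdiff h n (poly p) (g + h)) has_real_derivative fdiff h n (poly (pderiv p)) (g + h)) (at g)"
    using Suc[of "g + h"] by (simp add: DERIV_shift)
  from DERIV_diff[OF this Suc[of g]] show ?case by simp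
qed

text \<open>Differences commute with differentiation. By induction the difference of order n of
  \<open>pderiv p\<close> is constant, so the next one vanishes, which means that the difference of
  p of order n + 1 has derivative 0.\<close>

lemma fdiff_poly_const:
  assumes "degree p \<le> n" shows "\<exists>c. \<forall>g. fdiff h n (poly p) g = c"
  using assms
proof (induction n arbitrary: p)
  case 0
  then obtain a where "p = [:a:]" by (metis degree_eq_zeroE le_zero_eq)
  then show ?case by simp
next
  case (Suc n)
  have "degree (pderiv p) \<le> n" using Suc.prems by (simp add: degree_pderiv)
  then obtain c where "\<And>g. fdiff h n (poly (pderiv p)) g = c" using Suc.IH by blast
  then have "fdiff h (Suc n) (poly (pderiv p)) g = 0" for g by simp
  then have "(fdiff h (Suc n) (poly p) has_real_derivative 0) (at g)" for g
    using has_real_derivative_fdiff_poly[of h "Suc n" p g] by simp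
  then have "\<forall>g. fdiff h (Suc n) (poly p) g = fdiff h (Suc n) (poly p) 0"
    using DERIV_isconst_all by blast
  then show ?case by blast
qed

lemma fdiff_poly_eq_0:
  assumes "degree p \<le> n" shows "fdiff h (Suc n) (poly p) g = 0"
  using fdiff_poly_const[OF assms, of h] by auto

section \<open>Averaged ridge functions determine the measure outside a ball\<close>

lemma poly_bounded_cap_profile: "poly_bounded (cap_profile g :: 'a::euclidean_space \<Rightarrow> real)"
proof -
  define V where "V = measure lborel (ball (0 :: real \<times> 'a \<times> 'a) 1)"
  have "\<bar>cap_profile g x\<bar> \<le> V * (norm x + \<bar>g\<bar>)" for x :: 'a
  proof -
    have "\<bar>cap_profile g x\<bar> \<le> (\<integral>z. norm (indicator (ball 0 1) z *\<^sub>R max 0 (x \<bullet> fst (snd z) - g))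
        \<partial>(lborel :: (real \<times> 'a \<times> 'a) measure))"
      unfolding cap_profile_def set_lebesgue_integral_def
      using integral_norm_bound[of "lborel :: (real \<times> 'a \<times> 'a) measure"] by simp
    also have "\<dots> \<le> (\<integral>z. indicator (ball (0 :: real \<times> 'a \<times> 'a) 1) z *\<^sub>R (norm x + \<bar>g\<bar>) \<partial>lborel)"
    proof (rule integral_mono)
      show "integrable lborel (\<lambda>z :: real \<times> 'a \<times> 'a. norm (indicator (ball 0 1) z *\<^sub>R max 0 (x \<bullet> fst (snd z) - g)))"
        using integrable_ridge_ball[of x g] unfolding set_integrable_def by (rule integrable_norm)
      show "integrable lborel (\<lambda>z :: real \<times> 'a \<times> 'a. indicator (ball 0 1) z *\<^sub>R (norm x + \<bar>g\<bar>))"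
        using emeasure_lborel_ball_finite by (intro integrable_scaleR_left integrable_real_indicator) auto
      fix z :: "real \<times> 'a \<times> 'a"
      have "max 0 (x \<bullet> fst (snd z) - g) \<le> norm x + \<bar>g\<bar>" if "z \<in> ball 0 1"
        using abs_inner_fst_snd_le[OF that, of x] by linarith
      then show "norm (indicator (ball 0 1) z *\<^sub>R max 0 (x \<bullet> fst (snd z) - g))
         \<le> indicator (ball 0 1) z *\<^sub>R (norm x + \<bar>g\<bar>)"
        by (auto simp: indicator_def)
    qed
    also have "\<dots> = V * (norm x + \<bar>g\<bar>)" unfolding V_def by simp
    finally show ?thesis .
  qed
  moreover have "V * (norm x + \<bar>g\<bar>) \<le> \<bar>V * (norm x + \<bar>g\<bar>)\<bar>" for x :: 'a by simp
  ultimately have "\<bar>cap_profile g x\<bar> \<le> \<bar>V * (norm x + \<bar>g\<bar>)\<bar>" for x :: 'a by (rule order_trans)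
  moreover have "poly_bounded (\<lambda>x :: 'a. V * (norm x + \<bar>g\<bar>))" by (intro poly_bounded_intros)
  moreover have "(cap_profile g :: 'a \<Rightarrow> real) \<in> borel_measurable borel"
    using continuous_on_cap_profile by (rule borel_measurable_continuous_onI)
  ultimately show ?thesis using poly_bounded_mono by blast
qed

text \<open>Fubini exchanges the average over z with the integral over x. In the open unit ball the
  direction \<open>fst (snd z)\<close> has norm below 1, so g > r |w| holds even at the boundary
  value g = r; this value is needed to reach points arbitrarily close to the sphere |x| = r.\<close>

lemma ridge_agree_cap_profile:
  fixes M1 M2 :: "'a::euclidean_space measure"
  assumes M: "finite_moments M1" "finite_moments M2" and r: "r > 0"
    and Q: "real_polynomial_function Q" and agree: "ridge_agree r M1 M2 Q" and g: "g \<ge> r"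
  shows "(\<integral>x. Q x * cap_profile g x \<partial>M1) = (\<integral>x. Q x * cap_profile g x \<partial>M2)"
proof -
  define F :: "'a \<times> (real \<times> 'a \<times> 'a) \<Rightarrow> real" where
    "F y = Q (fst y) * (indicator (ball 0 1) (snd y) *\<^sub>R max 0 (fst y \<bullet> fst (snd (snd y)) - g))" for y
  have Qb: "poly_bounded Q" using Q by (rule poly_bounded_polynomial)
  have Qc: "continuous_on UNIV Q"
    using Q by (intro continuous_on_polymonial_function) (simp add: real_polynomial_function_eq)
  have Fm: "F \<in> borel_measurable borel"
    unfolding F_def
  proof (intro borel_measurable_times borel_measurable_scaleR)
    show "(\<lambda>y :: 'a \<times> (real \<times> 'a \<times> 'a). Q (fst y)) \<in> borel_measurable borel"
      by (intro borel_measurable_continuous_onI continuous_on_compose2[OF Qc] continuous_intros) simp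
    show "(\<lambda>y :: 'a \<times> (real \<times> 'a \<times> 'a). max 0 (fst y \<bullet> fst (snd (snd y)) - g)) \<in> borel_measurable borel"
      by (intro borel_measurable_continuous_onI continuous_intros)
    have "open ((snd :: 'a \<times> (real \<times> 'a \<times> 'a) \<Rightarrow> _) -` ball 0 1)" by (intro open_vimage continuous_intros) simp
    then have "(\<lambda>y. indicator ((snd :: 'a \<times> (real \<times> 'a \<times> 'a) \<Rightarrow> _) -` ball 0 1) y :: real) \<in> borel_measurable borel"
      by (intro borel_measurable_indicator) simp
    then show "(\<lambda>y :: 'a \<times> (real \<times> 'a \<times> 'a). indicat_real (ball 0 1) (snd y)) \<in> borel_measurable borel"
      by (simp only: indicator_def vimage_eq)
  qed
  have 1: "(\<integral>x. Q x * cap_profile g x \<partial>M) = (\<integral>z. \<integral>x. F (x, z) \<partial>M \<partial>lborel)" if fm: "finite_moments M" for M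
  proof -
    interpret finite_measure M using fm by (simp add: finite_moments_def)
    interpret pair_sigma_finite M "lborel :: (real \<times> 'a \<times> 'a) measure" ..
    have sM[measurable_cong]: "sets M = sets borel" using fm by (simp add: finite_moments_def)
    have "sets (M \<Otimes>\<^sub>M (lborel :: (real \<times> 'a \<times> 'a) measure)) = sets (borel \<Otimes>\<^sub>M (borel :: (real \<times> 'a \<times> 'a) measure))"
      by (rule sets_pair_measure_cong) (simp_all add: sM)
    then have sP: "sets (M \<Otimes>\<^sub>M (lborel :: (real \<times> 'a \<times> 'a) measure)) = sets borel"
      by (simp only: borel_prod)
    have FmP: "F \<in> borel_measurable (M \<Otimes>\<^sub>M lborel)"
      using Fm measurable_cong_sets[OF sP refl] by blast
    have inner: "(\<integral>z. F (x, z) \<partial>lborel) = Q x * cap_profile g x" for x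
      unfolding F_def cap_profile_def set_lebesgue_integral_def by simp
    have inner': "(\<integral>z. norm (F (x, z)) \<partial>lborel) = \<bar>Q x\<bar> * cap_profile g x" for x
    proof -
      have "norm (F (x, z)) = \<bar>Q x\<bar> * (indicator (ball 0 1) z *\<^sub>R max 0 (x \<bullet> fst (snd z) - g))" for z
        unfolding F_def by (simp add: abs_mult)
      then show ?thesis unfolding cap_profile_def set_lebesgue_integral_def by simp
    qed
    have int: "integrable (M \<Otimes>\<^sub>M lborel) F"
    proof (rule Fubini_integrable[OF FmP])
      show "integrable M (\<lambda>x. \<integral>z. norm (F (x, z)) \<partial>lborel)"
        unfolding inner' by (intro integrable_poly_bounded[OF fm] poly_bounded_intros Qb poly_bounded_cap_profile)
      show "AE x in M. integrable lborel (\<lambda>z. F (x, z))"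
        unfolding F_def fst_conv snd_conv
        by (intro AE_I2 integrable_mult_right integrable_ridge_ball[unfolded set_integrable_def])
    qed
    have "(\<integral>x. Q x * cap_profile g x \<partial>M) = (\<integral>x. \<integral>z. F (x, z) \<partial>lborel \<partial>M)" unfolding inner ..
    also have "\<dots> = (\<integral>z. \<integral>x. F (x, z) \<partial>M \<partial>lborel)"
      using Fubini_integral[of "\<lambda>x z. F (x, z)"] int by (simp add: case_prod_unfold)
    finally show ?thesis .
  qed
  have 2: "(\<integral>x. F (x, z) \<partial>M1) = (\<integral>x. F (x, z) \<partial>M2)" for z
  proof (cases "z \<in> ball 0 1")
    case True
    have "norm (fst (snd z)) \<le> norm z"
      using dist_fst_le[of "snd z" 0] dist_snd_le[of z 0] by simp
    then have "norm (fst (snd z)) < 1" using True by simp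
    then have "r * norm (fst (snd z)) < r * 1" using r by (intro mult_strict_left_mono) auto
    then have "r * norm (fst (snd z)) < g" using g by simp
    then have "(\<integral>x. Q x * max 0 (x \<bullet> fst (snd z) - g) ^ 1 \<partial>M1) = (\<integral>x. Q x * max 0 (x \<bullet> fst (snd z) - g) ^ 1 \<partial>M2)"
      using agree unfolding ridge_agree_def by blast
    then show ?thesis using True by (simp add: F_def)
  qed (simp add: F_def)
  show ?thesis unfolding 1[OF M(1)] 1[OF M(2)] 2 ..
qed

lemma continuous_closed_indicator_approx:
  fixes K :: "'a::euclidean_space set"
  assumes "closed K" "K \<noteq> {}"
  defines "f \<equiv> \<lambda>n x. max 0 (1 - real n * infdist x K)"
  shows "continuous_on UNIV (f n)" "0 \<le> f n x" "f n x \<le> 1" "(\<lambda>n. f n x) \<longlonglongrightarrow> indicator K x"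
proof -
  show "continuous_on UNIV (f n)" unfolding f_def by (intro continuous_intros)
  show "0 \<le> f n x" unfolding f_def by simp
  show "f n x \<le> 1" unfolding f_def by (simp add: infdist_nonneg)
  show "(\<lambda>n. f n x) \<longlonglongrightarrow> indicator K x"
  proof (cases "x \<in> K")
    case True
    then show ?thesis by (simp add: f_def)
  next
    case False
    then have pos: "infdist x K > 0" using assms infdist_pos_not_in_closed by blast
    obtain N :: nat where N: "1 < real N * infdist x K" using reals_Archimedean3[OF pos] by blast
    have "f n x = 0" if "n \<ge> N" for n
    proof -
      have "real N * infdist x K \<le> real n * infdist x K" using that pos by (intro mult_right_mono) auto
      then show ?thesis using N by (simp add: f_def)
    qed
    then have "\<forall>\<^sub>F n in sequentially. f n x = 0" unfolding eventually_sequentially by blast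
    then show ?thesis using False by (simp add: tendsto_eventually)
  qed
qed

lemma finite_borel_measure_eq_continuous:
  fixes M N :: "'a::euclidean_space measure"
  assumes fin: "finite_measure M" "finite_measure N" and sets: "sets M = sets borel" "sets N = sets borel"
    and eq: "\<And>f. continuous_on UNIV f \<Longrightarrow> (\<And>x. 0 \<le> f x \<and> f x \<le> (1::real)) \<Longrightarrow> (\<integral>x. f x \<partial>M) = (\<integral>x. f x \<partial>N)"
  shows "M = N"
proof -
  interpret M: finite_measure M by fact
  interpret N: finite_measure N by fact
  note sets[measurable_cong]
  have sp: "space M = UNIV" "space N = UNIV" using sets[THEN sets_eq_imp_space_eq] by simp_all
  have closed_eq: "emeasure M K = emeasure N K" if K: "closed K" for K
  proof (cases "K = {}")
    case False
    define f where "f n x = max 0 (1 - real n * infdist x K)" for n and x :: 'a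
    note f = continuous_closed_indicator_approx[OF K False, folded f_def]
    have [measurable]: "K \<in> sets borel" using K by simp
    have [measurable]: "f n \<in> borel_measurable borel" for n using f(1) by (rule borel_measurable_continuous_onI)
    have lM: "(\<lambda>n. \<integral>x. f n x \<partial>M) \<longlonglongrightarrow> (\<integral>x. indicator K x \<partial>M)"
      by (rule integral_dominated_convergence[where w = "\<lambda>_. 1"]) (use f in auto)
    have lN: "(\<lambda>n. \<integral>x. f n x \<partial>N) \<longlonglongrightarrow> (\<integral>x. indicator K x \<partial>N)"
      by (rule integral_dominated_convergence[where w = "\<lambda>_. 1"]) (use f in auto)
    have "(\<integral>x. f n x \<partial>M) = (\<integral>x. f n x \<partial>N)" for n
      by (rule eq) (use f in auto)
    then have "(\<integral>x. indicat_real K x \<partial>M) = (\<integral>x. indicator K x \<partial>N)"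
      using lM lN by (simp only: LIMSEQ_unique)
    then have "measure M K = measure N K" by (simp add: sp)
    then show ?thesis by (simp add: M.emeasure_eq_measure N.emeasure_eq_measure)
  qed simp
  show ?thesis
  proof (rule measure_eqI_generator_eq[where E = "Collect closed" and A = "\<lambda>_. UNIV" and \<Omega> = UNIV])
    show "Int_stable (Collect closed :: 'a set set)" by (auto simp: Int_stable_def closed_Int)
    show "sets M = sigma_sets UNIV (Collect closed)" "sets N = sigma_sets UNIV (Collect closed)"
      using sets by (simp_all add: borel_eq_closed)
    show "emeasure M UNIV \<noteq> \<infinity>" for i :: nat by simp
  qed (use closed_eq in auto)
qed

text \<open>The step of the difference is the width h of the shell. For r < |x| \<le> r + h every
  node but r lies at or beyond |x|, where the profile is 0, so one positive term survives up to
  sign. For |x| > r + N h all nodes lie below |x|, in the polynomial range, and the difference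
  vanishes.\<close>

lemma eq_on_shell:
  fixes M1 M2 :: "'a::euclidean_space measure"
  assumes M: "finite_moments M1" "finite_moments M2" and r: "r > 0"
    and agree: "ridge_agree r M1 M2 (\<lambda>_. 1)" and h: "h > 0"
    and A: "A \<in> sets borel" "A \<subseteq> {x. r < norm x \<and> norm x \<le> r + h}"
  shows "emeasure M1 A = emeasure M2 A"
proof -
  obtain f :: "real poly" where
    f: "\<And>g x. 0 \<le> g \<Longrightarrow> g \<le> norm x \<Longrightarrow> x \<noteq> 0 \<Longrightarrow> cap_profile g (x::'a) = norm x * poly f (g / norm x)"
    and fpos: "\<And>y. 0 \<le> y \<Longrightarrow> y < 1 \<Longrightarrow> poly f y > 0"
    using cap_profile_eq_poly[where 'a='a] by blast
  \<comment> \<open>One more than the degree in g, so that a difference of order \<open>N\<close>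
    annihilates the profile.\<close>
  define N where "N = Suc (degree f)"
  define G where "G x = fdiff h N (\<lambda>g. cap_profile g x) r" for x :: 'a
  have fd: "continuous_on UNIV (\<lambda>x::'a. fdiff h n (\<lambda>g. cap_profile g x) g)"
      "poly_bounded (\<lambda>x::'a. fdiff h n (\<lambda>g. cap_profile g x) g)"
      "g \<ge> r \<Longrightarrow> real_polynomial_function Q \<Longrightarrow> (\<integral>x. Q x * fdiff h n (\<lambda>g. cap_profile g x) g \<partial>M1)
         = (\<integral>x. Q x * fdiff h n (\<lambda>g. cap_profile g x) g \<partial>M2)" for g n Q
  proof (induction n arbitrary: g)
    case 0
    { case 1 show ?case using continuous_on_cap_profile by simp }
    { case 2 show ?case using poly_bounded_cap_profile by simp }
    { case 3
      then show ?case
        using ridge_agree_cap_profile[OF M r 3(2) ridge_agree_polynomial[OF M agree 3(2)] 3(1)] by simp }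
  next
    case (Suc n)
    { case 1 show ?case by (simp add: continuous_on_diff Suc(1)) }
    { case 2 show ?case
        using poly_bounded_add[OF Suc(2)[of "g + h"] poly_bounded_mult[OF poly_bounded_const[of "-1"] Suc(2)[of g]]]
        by simp }
    { case 3
      have "integrable M (\<lambda>x. Q x * fdiff h n (\<lambda>g. cap_profile g x) g')" if "finite_moments M" for M g'
        by (intro integrable_poly_bounded[OF that] poly_bounded_mult poly_bounded_polynomial 3 Suc(2))
      then show ?case using Suc(3)[of "g + h"] Suc(3)[of g] 3 h M by (simp add: right_diff_distrib) }
  qed
  have Gc: "continuous_on UNIV G" unfolding G_def by (rule fd(1))
  then have [measurable]: "G \<in> borel_measurable borel" by (rule borel_measurable_continuous_onI)
  have G0: "G x = 0" if "norm x > r + real N * h" for x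
  proof -
    have x: "norm x > 0" and x0: "x \<noteq> 0"
    proof -
      have "0 \<le> real N * h" using h by simp
      then show "norm x > 0" using that r by linarith
      then show "x \<noteq> 0" by auto
    qed
    \<comment> \<open>For fixed x this is the profile as a polynomial in the offset; its degree does
      not depend on x.\<close>
    define p where "p = smult (norm x) (pcompose f [:0, 1 / norm x:])"
    have "G x = fdiff h N (poly p) r"
      unfolding G_def
    proof (rule fdiff_cong)
      fix t assume "r \<le> t" "t \<le> r + real N * h"
      then show "cap_profile t x = poly p t"
        using f[of t x] that r x0 by (simp add: p_def poly_pcompose)
    qed (use h in simp)
    also have "\<dots> = 0" unfolding N_def
      by (rule fdiff_poly_eq_0) (use x in \<open>simp add: p_def degree_pcompose\<close>)
    finally show ?thesis .
  qed
  have Gn: "G x \<noteq> 0" if "r < norm x" "norm x \<le> r + h" for x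
  proof -
    have x0: "x \<noteq> 0" using that r by auto
    have "G x = (-1) ^ N * cap_profile r x"
      unfolding G_def by (rule fdiff_first) (use h that in \<open>auto intro!: cap_profile_eq_0\<close>)
    moreover have "cap_profile r x > 0"
      using f[of r x] fpos[of "r / norm x"] r that x0 by (simp add: field_simps)
    ultimately show ?thesis by simp
  qed
  have Gint: "integrable M (\<lambda>x. \<bar>G x\<bar>)" if "finite_moments M" for M
    unfolding G_def by (intro integrable_poly_bounded[OF that] poly_bounded_abs fd(2))
  \<comment> \<open>Since \<open>G\<close> vanishes for \<open>norm x > R\<close>, a uniform
    polynomial approximation of \<open>u\<close> on one compact ball suffices, and the error is
    controlled by the integrals of |G|.\<close>
  have contG: "(\<integral>x. u x * G x \<partial>M1) = (\<integral>x. u x * G x \<partial>M2)" if u: "continuous_on UNIV u" for u :: "'a \<Rightarrow> real"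
  proof -
    define R where "R = r + real N * h"
    have um[measurable]: "u \<in> borel_measurable borel" using u by (rule borel_measurable_continuous_onI)
    define K where "K = (\<integral>x. \<bar>G x\<bar> \<partial>M1) + (\<integral>x. \<bar>G x\<bar> \<partial>M2)"
    have K: "0 \<le> K" unfolding K_def by simp
    have bound: "\<bar>(\<integral>x. u x * G x \<partial>M1) - (\<integral>x. u x * G x \<partial>M2)\<bar> \<le> e * K" if e: "e > 0" for e
    proof -
      obtain p where p: "real_polynomial_function p" "\<And>x. x \<in> cball 0 R \<Longrightarrow> \<bar>u x - p x\<bar> < e"
        using Stone_Weierstrass_real_polynomial_function[of "cball (0::'a) R" u e] u e
        by (metis compact_cball continuous_on_subset top_greatest)
      have pb: "poly_bounded (\<lambda>x. p x * G x)"
        unfolding G_def by (intro poly_bounded_mult poly_bounded_polynomial p fd(2))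
      have pm[measurable]: "p \<in> borel_measurable borel"
        using poly_bounded_polynomial[OF p(1)] by (simp add: poly_bounded_def)
      have le: "\<bar>u x * G x - p x * G x\<bar> \<le> e * \<bar>G x\<bar>" for x
      proof (cases "norm x \<le> R")
        case True
        then have "\<bar>u x - p x\<bar> * \<bar>G x\<bar> \<le> e * \<bar>G x\<bar>" using p(2)[of x] by (intro mult_right_mono) auto
        then show ?thesis by (simp add: abs_mult flip: left_diff_distrib)
      qed (simp add: G0 R_def)
      have "\<bar>(\<integral>x. u x * G x \<partial>M) - (\<integral>x. p x * G x \<partial>M)\<bar> \<le> e * (\<integral>x. \<bar>G x\<bar> \<partial>M)" if fm: "finite_moments M" for M
      proof -
        have [measurable_cong]: "sets M = sets borel" using fm by (simp add: finite_moments_def)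
        have ip: "integrable M (\<lambda>x. p x * G x)" using fm pb by (rule integrable_poly_bounded)
        have id: "integrable M (\<lambda>x. u x * G x - p x * G x)"
          by (rule Bochner_Integration.integrable_bound[where f = "\<lambda>x. e * \<bar>G x\<bar>"])
             (use Gint[OF fm] le e in \<open>auto simp: abs_mult\<close>)
        have iu: "integrable M (\<lambda>x. u x * G x)"
          using Bochner_Integration.integrable_add[OF id ip] by simp
        have "\<bar>(\<integral>x. u x * G x \<partial>M) - (\<integral>x. p x * G x \<partial>M)\<bar> = \<bar>\<integral>x. u x * G x - p x * G x \<partial>M\<bar>"
          using iu ip by simp
        also have "\<dots> \<le> (\<integral>x. \<bar>u x * G x - p x * G x\<bar> \<partial>M)"
          using integral_norm_bound[of M "\<lambda>x. u x * G x - p x * G x"] by simp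
        also have "\<dots> \<le> (\<integral>x. e * \<bar>G x\<bar> \<partial>M)"
          by (rule integral_mono) (use id Gint[OF fm] le in auto)
        finally show ?thesis by simp
      qed
      from this[OF M(1)] this[OF M(2)]
      have "\<bar>(\<integral>x. u x * G x \<partial>M1) - (\<integral>x. u x * G x \<partial>M2)\<bar>
        \<le> e * (\<integral>x. \<bar>G x\<bar> \<partial>M1) + e * (\<integral>x. \<bar>G x\<bar> \<partial>M2)"
        using fd(3)[OF order_refl p(1), of N] unfolding G_def[symmetric] by linarith
      then show ?thesis unfolding K_def by (simp add: distrib_left)
    qed
    have "\<bar>(\<integral>x. u x * G x \<partial>M1) - (\<integral>x. u x * G x \<partial>M2)\<bar> \<le> 0"
    proof (rule field_le_epsilon)
      fix e :: real assume e: "e > 0"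
      have "\<bar>(\<integral>x. u x * G x \<partial>M1) - (\<integral>x. u x * G x \<partial>M2)\<bar> \<le> e / (K + 1) * K"
        using e K by (intro bound) simp
      also have "\<dots> \<le> e" using e K by (simp add: field_simps)
      finally show "\<bar>(\<integral>x. u x * G x \<partial>M1) - (\<integral>x. u x * G x \<partial>M2)\<bar> \<le> 0 + e" by simp
    qed
    then show ?thesis by simp
  qed
  \<comment> \<open>The sign of \<open>G\<close> is known only on the shell, so its square serves as
    the density. The extra factor \<open>G\<close> is continuous and goes into the test
    function.\<close>
  define D where "D M = density M (\<lambda>x. ennreal ((G x)\<^sup>2))" for M
  have G2: "integrable M (\<lambda>x. (G x)\<^sup>2)" if "finite_moments M" for M
    unfolding G_def by (intro integrable_poly_bounded[OF that] poly_bounded_power fd(2))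
  have Dfin: "finite_measure (D M)" if fm: "finite_moments M" for M
  proof (rule finite_measureI)
    have [measurable_cong]: "sets M = sets borel" using fm by (simp add: finite_moments_def)
    have sp: "space M = UNIV" using sets_eq_imp_space_eq[of M borel] fm by (simp add: finite_moments_def)
    have "emeasure (D M) (space (D M)) = (\<integral>\<^sup>+x. ennreal ((G x)\<^sup>2) \<partial>M)"
      unfolding D_def by (subst emeasure_density) (auto simp: sp)
    then show "emeasure (D M) (space (D M)) \<noteq> \<infinity>"
      using nn_integral_eq_integral[OF G2[OF fm]] by simp
  qed
  have Ds: "sets (D M) = sets borel" if "finite_moments M" for M
    using that by (simp add: D_def finite_moments_def)
  have DD: "D M1 = D M2"
  proof (rule finite_borel_measure_eq_continuous)
    fix u :: "'a \<Rightarrow> real" assume u: "continuous_on UNIV u" "\<And>x. 0 \<le> u x \<and> u x \<le> 1"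
    have um[measurable]: "u \<in> borel_measurable borel" using u(1) by (rule borel_measurable_continuous_onI)
    have *: "(\<integral>x. u x \<partial>D M) = (\<integral>x. (u x * G x) * G x \<partial>M)" if fm: "finite_moments M" for M
    proof -
      have [measurable_cong]: "sets M = sets borel" using fm by (simp add: finite_moments_def)
      show ?thesis unfolding D_def by (subst integral_density) (auto simp: power2_eq_square mult_ac)
    qed
    have "(\<integral>x. (u x * G x) * G x \<partial>M1) = (\<integral>x. (u x * G x) * G x \<partial>M2)"
      by (intro contG continuous_intros u Gc)
    then show "(\<integral>x. u x \<partial>D M1) = (\<integral>x. u x \<partial>D M2)" by (simp only: *[OF M(1)] *[OF M(2)])
  qed (use Dfin Ds M in auto)
  \<comment> \<open>\<open>G\<close> does not vanish on \<open>A\<close>, so the density can be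
    divided out again.\<close>
  have "emeasure M A = (\<integral>\<^sup>+x. indicator A x * ennreal (1 / (G x)\<^sup>2) \<partial>D M)" if fm: "finite_moments M" for M
  proof -
    have [measurable_cong]: "sets M = sets borel" using fm by (simp add: finite_moments_def)
    note A(1)[measurable]
    have "(\<integral>\<^sup>+x. indicator A x * ennreal (1 / (G x)\<^sup>2) \<partial>D M)
      = (\<integral>\<^sup>+x. ennreal ((G x)\<^sup>2) * (indicator A x * ennreal (1 / (G x)\<^sup>2)) \<partial>M)"
      unfolding D_def by (rule nn_integral_density) measurable
    also have "\<dots> = (\<integral>\<^sup>+x. indicator A x \<partial>M)"
    proof (rule nn_integral_cong)
      fix x
      show "ennreal ((G x)\<^sup>2) * (indicator A x * ennreal (1 / (G x)\<^sup>2)) = indicator A x"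
      proof (cases "x \<in> A")
        case True
        then have "G x \<noteq> 0" using A(2) Gn by blast
        then show ?thesis using True by (simp flip: ennreal_mult)
      qed simp
    qed
    also have "\<dots> = emeasure M A" by (rule nn_integral_indicator) measurable
    finally show ?thesis ..
  qed
  from this[OF M(1)] this[OF M(2)] show ?thesis by (simp only: DD)
qed

text \<open>Exhaustion by shells with inner radius r and growing width; each shell uses differences
  of its own step.\<close>

lemma eq_outside_ball:
  fixes M1 M2 :: "'a::euclidean_space measure"
  assumes M: "finite_moments M1" "finite_moments M2" and r: "r > 0"
    and agree: "ridge_agree r M1 M2 (\<lambda>_. 1)"
    and A: "A \<in> sets borel" "A \<subseteq> {x. r < norm x}"
  shows "emeasure M1 A = emeasure M2 A"
proof -
  note A(1)[measurable]
  define B where "B n = A \<inter> {x. norm x \<le> r + real (Suc n)}" for n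
  have [measurable]: "B n \<in> sets borel" for n unfolding B_def by measurable
  have inc: "incseq B" unfolding B_def incseq_def by auto
  have UB: "(\<Union>n. B n) = A"
  proof -
    have "\<exists>n. norm x \<le> r + real (Suc n)" for x :: 'a
    proof -
      obtain n :: nat where "norm x - r \<le> real n" using real_arch_simple by blast
      then have "norm x \<le> r + real (Suc n)" by simp
      then show ?thesis ..
    qed
    then show ?thesis unfolding B_def by auto
  qed
  have lim: "(\<lambda>n. emeasure M (B n)) \<longlonglongrightarrow> emeasure M A" if "finite_moments M" for M
  proof -
    have "range B \<subseteq> sets M" using that by (auto simp: finite_moments_def)
    from Lim_emeasure_incseq[OF this inc] show ?thesis unfolding UB .
  qed
  have "emeasure M1 (B n) = emeasure M2 (B n)" for n
    by (rule eq_on_shell[OF M r agree, of "real (Suc n)"]) (use A in \<open>auto simp: B_def\<close>)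
  then show ?thesis using lim[OF M(1)] lim[OF M(2)] by (simp only: LIMSEQ_unique)
qed

text \<open>Halfspace masses can jump when the direction moves, but ridge integrals are continuous
  in it, with a moment as dominating function. So equality on a dense set of directions extends to
  all of them, before any derivative in the direction is taken. For w = 0 both integrands vanish
  because g > 0.\<close>

lemma ridge_agree_one:
  fixes M1 M2 :: "'a::euclidean_space measure"
  assumes M: "finite_moments M1" "finite_moments M2" and r: "r > 0"
    and dense: "\<And>\<omega> e. norm \<omega> = 1 \<Longrightarrow> e > 0 \<Longrightarrow> \<exists>\<omega>'. norm \<omega>' = 1 \<and> dist \<omega>' \<omega> < e \<and>
      (\<forall>p<(- r). emeasure M1 (halfspace \<omega>' p) = emeasure M2 (halfspace \<omega>' p))"
  shows "ridge_agree r M1 M2 (\<lambda>_. 1)"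
  unfolding ridge_agree_def
proof (intro allI impI)
  fix k :: nat and w :: 'a and g :: real
  assume k: "1 \<le> k" and g: "r * norm w < g"
  show "(\<integral>x. 1 * max 0 (x \<bullet> w - g) ^ k \<partial>M1) = (\<integral>x. 1 * max 0 (x \<bullet> w - g) ^ k \<partial>M2)"
  proof (cases "w = 0")
    case True
    then show ?thesis using g k by (simp add: max_def power_0_left)
  next
    case False
    define s where "s = norm w"
    have s: "s > 0" using False by (simp add: s_def)
    \<comment> \<open>The ridge is positive where x . w > g, which is the halfspace x . \<omega> < -
      g / s for the opposite unit direction.\<close>
    define \<omega> where "\<omega> = - (w /\<^sub>R s)"
    have w: "w = - (s *\<^sub>R \<omega>)" using s by (simp add: \<omega>_def)
    have "norm \<omega> = 1" using s by (simp add: \<omega>_def s_def)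
    then have "\<exists>\<omega>'. norm \<omega>' = 1 \<and> dist \<omega>' \<omega> < inverse (real (Suc n)) \<and>
      (\<forall>p<(- r). emeasure M1 (halfspace \<omega>' p) = emeasure M2 (halfspace \<omega>' p))" for n
      by (intro dense) auto
    then obtain \<theta> where \<theta>: "\<And>n. norm (\<theta> n) = 1" "\<And>n. dist (\<theta> n) \<omega> < inverse (real (Suc n))"
      "\<And>n p. p < - r \<Longrightarrow> emeasure M1 (halfspace (\<theta> n) p) = emeasure M2 (halfspace (\<theta> n) p)"
      by metis
    have "(\<lambda>n. dist (\<theta> n) \<omega>) \<longlonglongrightarrow> 0"
      by (rule Lim_null_comparison[OF _ LIMSEQ_inverse_real_of_nat])
         (use \<theta>(2) in \<open>auto intro!: always_eventually simp: less_imp_le\<close>)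
    then have lim: "\<theta> \<longlonglongrightarrow> \<omega>" by (rule tendsto_dist_iff[THEN iffD2])
    define D where "D x = (norm x * s + \<bar>g\<bar>) ^ k" for x :: 'a
    have conv: "(\<lambda>n. \<integral>x. max 0 (x \<bullet> (- (s *\<^sub>R \<theta> n)) - g) ^ k \<partial>M) \<longlonglongrightarrow> (\<integral>x. max 0 (x \<bullet> w - g) ^ k \<partial>M)"
      if fm: "finite_moments M" for M
    proof (rule integral_dominated_convergence[where w = D])
      have [measurable_cong]: "sets M = sets borel" using fm by (simp add: finite_moments_def)
      show "(\<lambda>x. max 0 (x \<bullet> w - g) ^ k) \<in> borel_measurable M" by measurable
      show "(\<lambda>x. max 0 (x \<bullet> (- (s *\<^sub>R \<theta> n)) - g) ^ k) \<in> borel_measurable M" for n by measurable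
      show "integrable M D" unfolding D_def by (intro integrable_poly_bounded[OF fm] poly_bounded_intros)
      show "AE x in M. (\<lambda>n. max 0 (x \<bullet> (- (s *\<^sub>R \<theta> n)) - g) ^ k) \<longlonglongrightarrow> max 0 (x \<bullet> w - g) ^ k"
        unfolding w by (intro AE_I2 tendsto_intros lim)
      show "AE x in M. norm (max 0 (x \<bullet> (- (s *\<^sub>R \<theta> n)) - g) ^ k) \<le> D x" for n
      proof (intro AE_I2)
        fix x
        have "norm (- (s *\<^sub>R \<theta> n)) = s" using s by (simp add: \<theta>)
        then have "x \<bullet> (- (s *\<^sub>R \<theta> n)) \<le> norm x * s" using norm_cauchy_schwarz[of x "- (s *\<^sub>R \<theta> n)"] by simp
        moreover have "0 \<le> norm x * s" using s by simp
        ultimately have "max 0 (x \<bullet> (- (s *\<^sub>R \<theta> n)) - g) \<le> norm x * s + \<bar>g\<bar>" by linarith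
        then show "norm (max 0 (x \<bullet> (- (s *\<^sub>R \<theta> n)) - g) ^ k) \<le> D x"
          unfolding D_def by (simp add: power_mono)
      qed
    qed
    have eq: "(\<integral>x. max 0 (x \<bullet> (- (s *\<^sub>R \<theta> n)) - g) ^ k \<partial>M1) = (\<integral>x. max 0 (x \<bullet> (- (s *\<^sub>R \<theta> n)) - g) ^ k \<partial>M2)" for n
    proof -
      have "(\<integral>x. (\<lambda>t. max 0 (- s * t - g) ^ k) (x \<bullet> \<theta> n) \<partial>M1) = (\<integral>x. (\<lambda>t. max 0 (- s * t - g) ^ k) (x \<bullet> \<theta> n) \<partial>M2)"
      proof (rule ridge_integral_eq_of_halfspaces[OF M \<theta>(3), where q = "- (g / s)"])
        show "max 0 (- s * t - g) ^ k = 0" if "- (g / s) \<le> t" for t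
        proof -
          have "s * (- (g / s)) \<le> s * t" using that s by (intro mult_left_mono) auto
          then have "- s * t - g \<le> 0" using s by simp
          then show ?thesis using k by (simp add: max_def power_0_left)
        qed
        show "- (g / s) < - r" using g s by (simp add: s_def[symmetric] field_simps)
      qed auto
      then show ?thesis by (simp add: mult.commute)
    qed
    show ?thesis using LIMSEQ_unique[OF conv[OF M(1), unfolded eq] conv[OF M(2)]] by simp
  qed
qed

section \<open>Surface measure, test functions and approximation\<close>

lemma AE_lborel_open_ex:
  assumes "AE x in lborel. P x" "open S" "S \<noteq> {}"
  shows "\<exists>x::'a::euclidean_space\<in>S. P x"
proof (rule ccontr)
  assume "\<not> (\<exists>x\<in>S. P x)"
  with assms(1) have "AE x in lborel. x \<notin> S" by auto
  then have "S \<in> null_sets lborel"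
    using assms(2) by (subst AE_iff_null_sets) auto
  then have "negligible S"
    by (simp add: negligible_iff_null_sets null_sets_completionI)
  then show False using open_not_negligible[OF assms(2,3)] by simp
qed

lemma sets_sphere_measure[measurable_cong, simp]: "sets sphere_measure = sets borel"
  by (simp add: sphere_measure_def)

lemma emeasure_unit_ball_pos:
  "emeasure lborel (ball (0::'a::euclidean_space) 1) \<noteq> 0" "emeasure lborel (ball (0::'a) 1) < \<infinity>"
proof -
  have "0 < unit_ball_vol (real DIM('a))" by (rule unit_ball_vol_pos) simp
  then show "emeasure lborel (ball (0::'a) 1) \<noteq> 0" by (simp add: emeasure_ball ennreal_eq_0_iff not_le)
qed (rule emeasure_lborel_ball_finite)

lemma prob_space_sphere_measure: "prob_space (sphere_measure :: 'a::euclidean_space measure)"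
  unfolding sphere_measure_def
proof (rule prob_space.prob_space_distr)
  show "prob_space (uniform_measure lborel (ball (0::'a) 1))"
    using emeasure_unit_ball_pos[where 'a='a] by (intro prob_space_uniform_measure) auto
  show "(\<lambda>x. x /\<^sub>R norm x) \<in> uniform_measure lborel (ball (0::'a) 1) \<rightarrow>\<^sub>M borel" by measurable
qed

lemma AE_sphere_measureD:
  assumes "AE \<omega> in sphere_measure. P (\<omega>::'a::euclidean_space)"
  shows "AE x in lborel. x \<in> ball 0 1 \<longrightarrow> P (x /\<^sub>R norm x)"
proof -
  obtain N where N: "{\<omega>. \<not> P \<omega>} \<subseteq> N" "N \<in> null_sets sphere_measure"
    using assms by (auto elim!: AE_E simp: null_sets_def sphere_measure_def)
  then have Nm[measurable]: "N \<in> sets borel" by (auto simp: null_sets_def)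
  have "AE \<omega> in sphere_measure. \<omega> \<notin> N" using N(2) by (rule AE_not_in)
  then have "AE x in uniform_measure lborel (ball 0 1). x /\<^sub>R norm x \<notin> N"
    unfolding sphere_measure_def by (subst (asm) AE_distr_iff) auto
  then have "AE x in lborel. x \<in> ball 0 1 \<longrightarrow> x /\<^sub>R norm x \<notin> N"
    by (simp only: AE_uniform_measure[OF emeasure_unit_ball_pos])
  then show ?thesis using N(1) by (auto elim!: eventually_mono)
qed

lemma AE_sphere_measure_norm: "AE \<omega> in sphere_measure. norm (\<omega>::'a::euclidean_space) = 1"
proof -
  have *: "AE x in lborel. x \<noteq> (0::'a)" by (rule AE_lborel_singleton)
  have "AE x in uniform_measure lborel (ball (0::'a) 1). norm (x /\<^sub>R norm x) = 1"
    by (rule AE_uniform_measureI) (use * in \<open>auto elim!: eventually_mono\<close>)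
  then show ?thesis unfolding sphere_measure_def by (subst AE_distr_iff) auto
qed

text \<open>The cone over a cap around \<omega>, inside the ball, is open and contains
  \<open>(1/2) *\<^sub>R \<omega>\<close>, so it is not a null set and meets the set where P
  holds.\<close>

lemma AE_sphere_measure_dense:
  assumes ae: "AE \<omega> in sphere_measure. P \<omega>" and \<omega>: "norm (\<omega>::'a::euclidean_space) = 1" and e: "e > 0"
  shows "\<exists>\<omega>'. norm \<omega>' = 1 \<and> dist \<omega>' \<omega> < e \<and> P \<omega>'"
proof -
  define S where "S = {x::'a. x \<noteq> 0 \<and> norm x < 1 \<and> dist (x /\<^sub>R norm x) \<omega> < e}"
  have "open (- {0::'a})" by (simp add: open_Compl)
  moreover have "continuous_on (- {0::'a}) (\<lambda>x. dist (x /\<^sub>R norm x) \<omega>)"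
    by (intro continuous_intros) auto
  ultimately have "open ((- {0::'a}) \<inter> (\<lambda>x. dist (x /\<^sub>R norm x) \<omega>) -` {..<e})"
    by (intro continuous_open_preimage) auto
  then have "open (((- {0::'a}) \<inter> (\<lambda>x. dist (x /\<^sub>R norm x) \<omega>) -` {..<e}) \<inter> ball 0 1)" by (rule open_Int) simp
  moreover have "S = ((- {0::'a}) \<inter> (\<lambda>x. dist (x /\<^sub>R norm x) \<omega>) -` {..<e}) \<inter> ball 0 1"
    unfolding S_def by auto
  ultimately have "open S" by simp
  moreover have "(1/2) *\<^sub>R \<omega> \<in> S" unfolding S_def using \<omega> e by auto
  ultimately obtain x where "x \<in> S" "x \<in> ball 0 1 \<longrightarrow> P (x /\<^sub>R norm x)"
    using AE_lborel_open_ex[OF AE_sphere_measureD[OF ae], of S] by blast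
  then show ?thesis by (intro exI[of _ "x /\<^sub>R norm x"]) (auto simp: S_def)
qed

text \<open>Some coordinate of x has modulus at least |x| / d, so one of the vectors b, -b of the
  standard basis has inner product at most - |x| / d with x. Moving these 2 d vectors by less than c
  = 1 / (2 d) to directions satisfying P spends half of that bound.\<close>

lemma AE_sphere_measure_finite_cover:
  assumes ae: "AE \<omega> in sphere_measure. P (\<omega>::'a::euclidean_space)"
  shows "\<exists>\<Omega> c. finite \<Omega> \<and> c > 0 \<and> (\<forall>\<omega>\<in>\<Omega>. norm \<omega> = 1 \<and> P \<omega>) \<and>
     (\<forall>x. \<exists>\<omega>\<in>\<Omega>. x \<bullet> \<omega> \<le> - (c * norm x))"
proof -
  define c where "c = 1 / (2 * real DIM('a))"
  have c: "c > 0" by (simp add: c_def)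
  have "\<exists>\<theta>. norm \<theta> = 1 \<and> dist \<theta> b < c \<and> P \<theta>" if "b \<in> Basis \<union> uminus ` Basis" for b :: 'a
    by (rule AE_sphere_measure_dense[OF ae _ c]) (use that in auto)
  then obtain \<theta> where \<theta>: "\<And>b. b \<in> Basis \<union> uminus ` Basis \<Longrightarrow> norm (\<theta> b) = 1 \<and> dist (\<theta> b) b < c \<and> P (\<theta> b)"
    by metis
  have "\<exists>\<omega>\<in>\<theta> ` (Basis \<union> uminus ` Basis). x \<bullet> \<omega> \<le> - (c * norm x)" for x
  proof -
    have "\<exists>b\<in>Basis. norm x / real DIM('a) \<le> \<bar>x \<bullet> b\<bar>"
    proof (rule ccontr)
      assume "\<not> ?thesis"
      then have "(\<Sum>b\<in>Basis. \<bar>x \<bullet> b\<bar>) < of_nat (card (Basis::'a set)) * (norm x / real DIM('a))"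
        by (intro sum_bounded_above_strict) (auto simp: not_le)
      then show False using norm_le_l1[of x] by simp
    qed
    then obtain b where b: "b \<in> Basis" "norm x / real DIM('a) \<le> \<bar>x \<bullet> b\<bar>" by blast
    define b' where "b' = (if x \<bullet> b \<ge> 0 then - b else b)"
    have b': "b' \<in> Basis \<union> uminus ` Basis" "x \<bullet> b' = - \<bar>x \<bullet> b\<bar>" using b(1) by (auto simp: b'_def)
    have "x \<bullet> \<theta> b' = x \<bullet> b' + x \<bullet> (\<theta> b' - b')" by (simp add: inner_diff_right)
    also have "\<dots> \<le> - (norm x / real DIM('a)) + norm x * norm (\<theta> b' - b')"
      using b(2) b'(2) norm_cauchy_schwarz[of x "\<theta> b' - b'"] by linarith
    also have "\<dots> \<le> - (norm x / real DIM('a)) + norm x * c"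
      using \<theta>[OF b'(1)] by (intro add_left_mono mult_left_mono) (auto simp: dist_norm)
    also have "\<dots> = - (c * norm x)" by (simp add: c_def field_simps)
    finally show ?thesis using b'(1) by blast
  qed
  then show ?thesis using \<theta> c by (intro exI[of _ "\<theta> ` (Basis \<union> uminus ` Basis)"] exI[of _ c]) auto
qed

section \<open>Moments from tails, and measures away from the origin\<close>

lemma ennreal_term_le_suminf: "f j \<le> (\<Sum>i. f i :: ennreal)"
  using sum_le_suminf[of f "{j}"] by simp

text \<open>\<open>norm x ^ n\<close> is bounded by the sum over integers j \<le> |x| of (j + 1)^n.
  Tail decay of order n + 2 makes the integrated terms O(j^(-2)), hence summable.\<close>

lemma finite_moments_of_tail:
  fixes M :: "'a::euclidean_space measure"
  assumes fin: "finite_measure M" and sets: "sets M = sets borel"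
    and tail: "\<And>m::nat. \<exists>C R0. \<forall>R\<ge>R0. measure M {x. R \<le> norm x} \<le> C / R ^ m"
  shows "finite_moments M"
  unfolding finite_moments_def
proof (intro conjI fin sets allI)
  fix n :: nat
  interpret finite_measure M by fact
  note sets[measurable_cong]
  have sp: "space M = UNIV" using sets_eq_imp_space_eq[OF sets] by simp
  obtain C R0 where CR: "\<And>R. R \<ge> R0 \<Longrightarrow> measure M {x. R \<le> norm x} \<le> C / R ^ (n + 2)" using tail by blast
  define c where "c j = real (Suc j) ^ n * measure M {x. real j \<le> norm x}" for j
  have c0: "0 \<le> c j" for j by (simp add: c_def)
  have "summable c"
  proof (rule summable_comparison_test_ev)
    show "\<forall>\<^sub>F j in sequentially. norm (c j) \<le> 2 ^ n * C * inverse (real j ^ 2)"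
      using eventually_ge_at_top[of "nat \<lceil>max 1 R0\<rceil>"]
    proof (rule eventually_mono)
      fix j assume "nat \<lceil>max 1 R0\<rceil> \<le> j"
      then have j: "1 \<le> real j" "R0 \<le> real j" by linarith+
      have "norm (c j) = real (Suc j) ^ n * measure M {x. real j \<le> norm x}" using c0[of j] by (simp add: c_def)
      also have "\<dots> \<le> (2 * real j) ^ n * (C / real j ^ (n + 2))"
        using j by (intro mult_mono CR power_mono) auto
      also have "\<dots> = 2 ^ n * C * inverse (real j ^ 2)"
        using j by (simp add: power_mult_distrib power_add field_simps power2_eq_square)
      finally show "norm (c j) \<le> 2 ^ n * C * inverse (real j ^ 2)" .
    qed
    show "summable (\<lambda>j. 2 ^ n * C * inverse (real j ^ 2))"
      by (intro summable_mult inverse_power_summable) simp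
  qed
  then have fin_sum: "(\<Sum>j. ennreal (c j)) \<noteq> \<infinity>"
    using ennreal_suminf_neq_top[OF _ c0] by (simp add: infinity_ennreal_def)
  show "integrable M (\<lambda>x. norm x ^ n)"
  proof (rule integrableI_bounded)
    have "(\<integral>\<^sup>+x. ennreal (norm (norm x ^ n)) \<partial>M)
       \<le> (\<integral>\<^sup>+x. (\<Sum>j. ennreal (real (Suc j) ^ n) * indicator {x. real j \<le> norm x} x) \<partial>M)"
    proof (rule nn_integral_mono)
      fix x :: 'a
      define j where "j = nat \<lfloor>norm x\<rfloor>"
      have j: "real j \<le> norm x" "norm x \<le> real (Suc j)" 
    proof -
      have "real j = of_int \<lfloor>norm x\<rfloor>" unfolding j_def by simp
      then show "real j \<le> norm x" "norm x \<le> real (Suc j)"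
        using of_int_floor_le[of "norm x"] real_of_int_floor_add_one_ge[of "norm x"] by (simp_all add: add.commute)
    qed
      have "ennreal (norm (norm x ^ n)) \<le> ennreal (real (Suc j) ^ n)"
        using j by (intro ennreal_leI) (simp add: power_mono del: of_nat_Suc)
      also have "\<dots> = ennreal (real (Suc j) ^ n) * indicator {x. real j \<le> norm x} x" using j by simp
      also have "\<dots> \<le> (\<Sum>j. ennreal (real (Suc j) ^ n) * indicator {x. real j \<le> norm x} x)"
        by (rule ennreal_term_le_suminf)
      finally show "ennreal (norm (norm x ^ n)) \<le> (\<Sum>j. ennreal (real (Suc j) ^ n) * indicator {x. real j \<le> norm x} x)" .
    qed
    also have "\<dots> = (\<Sum>j. \<integral>\<^sup>+x. ennreal (real (Suc j) ^ n) * indicator {x. real j \<le> norm x} x \<partial>M)"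
      by (rule nn_integral_suminf) measurable
    also have "\<dots> = (\<Sum>j. ennreal (c j))"
      unfolding c_def by (simp add: nn_integral_cmult_indicator emeasure_eq_measure sp ennreal_mult del: of_nat_Suc)
    also have "\<dots> < \<infinity>" using fin_sum by (simp add: less_top)
    finally show "(\<integral>\<^sup>+x. ennreal (norm (norm x ^ n)) \<partial>M) < \<infinity>" .
  qed measurable
qed

lemma integral_eq_outside:
  fixes M N :: "'a::euclidean_space measure" and f :: "'a \<Rightarrow> real"
  assumes sets: "sets M = sets borel" "sets N = sets borel"
    and eq: "\<And>A. A \<in> sets borel \<Longrightarrow> A \<subseteq> {x. r < norm x} \<Longrightarrow> emeasure M A = emeasure N A"
    and f: "f \<in> borel_measurable borel" "\<And>x. norm x \<le> r \<Longrightarrow> f x = 0"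
  shows "integrable M f \<longleftrightarrow> integrable N f" "(\<integral>x. f x \<partial>M) = (\<integral>x. f x \<partial>N)"
proof -
  define S where "S = {x::'a. r < norm x}"
  have S: "S \<in> sets borel" unfolding S_def by measurable
  have f0: "f x = 0" if "x \<notin> S" for x using f(2)[of x] that by (simp add: S_def)
  have "density M (indicator S) = density N (indicator S)"
  proof (rule measure_eqI)
    fix A assume "A \<in> sets (density M (indicator S))"
    then have A: "A \<in> sets borel" by (simp add: sets)
    have "emeasure M (S \<inter> A) = emeasure N (S \<inter> A)" by (rule eq) (use A S in \<open>auto simp: S_def\<close>)
    then show "emeasure (density M (indicator S)) A = emeasure (density N (indicator S)) A"
      using A S by (simp add: emeasure_restricted sets)
  qed (simp add: sets)
  then show "integrable M f \<longleftrightarrow> integrable N f" "(\<integral>x. f x \<partial>M) = (\<integral>x. f x \<partial>N)"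
    using integral_density_indicator[OF sets(1) S f(1) f0] integral_density_indicator[OF sets(2) S f(1) f0]
    by simp_all
qed

lemma emeasure_halfspace_lim:
  fixes \<mu> :: "'a::euclidean_space measure"
  assumes sets: "sets \<mu> = sets borel"
  shows "(\<lambda>n. emeasure \<mu> (halfspace \<omega> (p - inverse (real (Suc n))))) \<longlonglongrightarrow> emeasure \<mu> (halfspace \<omega> p)"
proof -
  define H where "H n = halfspace \<omega> (p - inverse (real (Suc n)))" for n
  have inc: "incseq H"
    unfolding incseq_def H_def halfspace_def
  proof (intro allI impI subsetI)
    fix m n :: nat and x :: 'a
    assume "m \<le> n" "x \<in> {x. x \<bullet> \<omega> < p - inverse (real (Suc m))}"
    moreover from this have "inverse (real (Suc n)) \<le> inverse (real (Suc m))" by (intro le_imp_inverse_le) auto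
    ultimately show "x \<in> {x. x \<bullet> \<omega> < p - inverse (real (Suc n))}" unfolding mem_Collect_eq by linarith
  qed
  have U: "(\<Union>n. H n) = halfspace \<omega> p"
  proof (intro equalityI subsetI)
    fix x assume "x \<in> halfspace \<omega> p"
    then have "0 < p - x \<bullet> \<omega>" by (simp add: halfspace_def)
    then obtain n where "inverse (real (Suc n)) < p - x \<bullet> \<omega>" using reals_Archimedean by blast
    then show "x \<in> (\<Union>n. H n)" unfolding H_def halfspace_def by (intro UN_I[of n]) auto
  next
    fix x assume "x \<in> (\<Union>n. H n)"
    then obtain n where "x \<bullet> \<omega> < p - inverse (real (Suc n))" by (auto simp: H_def halfspace_def)
    moreover have "0 < inverse (real (Suc n))" by simp
    ultimately have "x \<bullet> \<omega> < p" by linarith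
    then show "x \<in> halfspace \<omega> p" by (simp add: halfspace_def)
  qed
  have "H n \<in> sets \<mu>" for n unfolding sets H_def by (rule halfspace_borel)
  then have "range H \<subseteq> sets \<mu>" by blast
  from Lim_emeasure_incseq[OF this inc]
  show ?thesis unfolding U by (simp only: H_def)
qed

text \<open>Continuous cutoffs decrease to the indicator of K; once they are narrow enough to vanish
  near the origin they are admissible, and the first such cutoff dominates the later ones.\<close>

lemma measure_compact_eq:
  fixes \<mu> \<nu>1 \<nu>2 :: "'a::euclidean_space measure"
  assumes radon: "radon0 \<mu>" "radon0 \<nu>1" "radon0 \<nu>2"
    and eq: "\<And>\<phi>. admissible \<phi> \<Longrightarrow> integrable \<mu> \<phi> \<and> integrable \<nu>1 \<phi> \<and> integrable \<nu>2 \<phi> \<and>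
      (\<integral>x. \<phi> x \<partial>\<nu>1) - (\<integral>x. \<phi> x \<partial>\<nu>2) = (\<integral>x. \<phi> x \<partial>\<mu>)"
    and K: "compact K" "0 \<notin> K"
  shows "measure \<nu>1 K - measure \<nu>2 K = measure \<mu> K"
proof (cases "K = {}")
  case False
  have cl: "closed K" using K(1) by (rule compact_imp_closed)
  define f where "f n x = max 0 (1 - real n * infdist x K)" for n and x :: 'a
  note f = continuous_closed_indicator_approx[OF cl False, folded f_def]
  define d where "d = infdist 0 K"
  have d: "d > 0" unfolding d_def using infdist_pos_not_in_closed[OF cl False K(2)] .
  have "0 < d / 2" using d by simp
  \<comment> \<open>From index \<open>N\<close> on the cutoff lives within distance d/2 of K, and
    therefore vanishes on the ball of radius d/2 about the origin.\<close>
  then obtain N :: nat where N: "1 < real N * (d / 2)" using reals_Archimedean3 by blast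
  have far: "f n x = 0" if "n \<ge> N" "norm x < d / 2" for n x
  proof -
    have "d \<le> infdist x K + dist 0 x" unfolding d_def by (rule infdist_triangle)
    then have "d / 2 \<le> infdist x K" using that(2) by simp
    then have "real N * (d / 2) \<le> real n * infdist x K" using that(1) d by (intro mult_mono) auto
    then show ?thesis using N by (simp add: f_def)
  qed
  have adm: "admissible (f n)" if "n \<ge> N" for n
    unfolding admissible_def
  proof (intro conjI)
    show "continuous_on UNIV (f n)" by (rule f(1))
    show "bounded (range (f n))" unfolding bounded_iff using f(2,3) by (intro exI[of _ 1]) auto
    show "\<exists>r>0. \<forall>x. norm x < r \<longrightarrow> f n x = 0" using far[OF that] d by (intro exI[of _ "d / 2"]) auto
  qed
  have lim: "(\<lambda>n. \<integral>x. f (n + N) x \<partial>L) \<longlonglongrightarrow> measure L K" if L: "sets L = sets borel" "integrable L (f N)" for L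
  proof -
    note L(1)[measurable_cong]
    have [measurable]: "K \<in> sets borel" using cl by simp
    have [measurable]: "f n \<in> borel_measurable borel" for n using f(1) by (rule borel_measurable_continuous_onI)
    have "(\<lambda>n. \<integral>x. f (n + N) x \<partial>L) \<longlonglongrightarrow> (\<integral>x. indicator K x \<partial>L)"
    proof (rule integral_dominated_convergence[where w = "f N"])
      show "AE x in L. (\<lambda>n. f (n + N) x) \<longlonglongrightarrow> indicator K x"
        using f(4) by (intro AE_I2 LIMSEQ_ignore_initial_segment)
      have "f (n + N) x \<le> f N x" for n x
        unfolding f_def by (intro max.mono order_refl diff_left_mono mult_right_mono) (auto simp: infdist_nonneg)
      then show "AE x in L. norm (f (n + N) x) \<le> f N x" for n using f(2) by (intro AE_I2) simp
      show "integrable L (f N)" by (rule L(2))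
    qed measurable
    also have "(\<integral>x. indicator K x \<partial>L) = measure L K"
      using sets_eq_imp_space_eq[OF L(1)] by simp
    finally show ?thesis .
  qed
  have sets: "sets \<mu> = sets borel" "sets \<nu>1 = sets borel" "sets \<nu>2 = sets borel"
    using radon by (simp_all add: radon0_def)
  have "(\<lambda>n. (\<integral>x. f (n + N) x \<partial>\<nu>1) - (\<integral>x. f (n + N) x \<partial>\<nu>2)) \<longlonglongrightarrow> measure \<nu>1 K - measure \<nu>2 K"
    by (intro tendsto_diff lim sets) (use eq[OF adm[of N]] in auto)
  moreover have "(\<integral>x. f (n + N) x \<partial>\<nu>1) - (\<integral>x. f (n + N) x \<partial>\<nu>2) = (\<integral>x. f (n + N) x \<partial>\<mu>)" for n
    using eq[OF adm[of "n + N"]] by simp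
  moreover have "(\<lambda>n. \<integral>x. f (n + N) x \<partial>\<mu>) \<longlonglongrightarrow> measure \<mu> K"
    by (intro lim sets) (use eq[OF adm[of N]] in auto)
  ultimately show ?thesis using LIMSEQ_unique by simp
qed simp

lemma AE_sphere_lborel_norm:
  "AE z in (sphere_measure :: 'a::euclidean_space measure) \<Otimes>\<^sub>M (lborel :: real measure). norm (fst z) = 1"
proof -
  interpret S: prob_space "sphere_measure :: 'a measure" by (rule prob_space_sphere_measure)
  interpret SL: pair_sigma_finite "sphere_measure :: 'a measure" "lborel :: real measure" ..
  show ?thesis
  proof (rule SL.AE_pair_measure)
    show "{z \<in> space (sphere_measure \<Otimes>\<^sub>M lborel). norm (fst z) = 1}
        \<in> sets ((sphere_measure :: 'a measure) \<Otimes>\<^sub>M (lborel :: real measure))"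
      by measurable
    show "AE \<omega> in (sphere_measure :: 'a measure). AE p in (lborel :: real measure). norm (fst (\<omega>, p)) = 1"
      using AE_sphere_measure_norm by eventually_elim simp
  qed
qed

lemma sets_sphere_lborel:
  "sets ((sphere_measure :: 'a::euclidean_space measure) \<Otimes>\<^sub>M (lborel :: real measure)) = sets borel"
  by (simp add: borel_prod[symmetric] cong: sets_pair_measure_cong)

text \<open>Makes the tools for finite measures available (Fubini, continuity from above, countably
  many atoms) although \<open>\<mu>\<close> may have infinite mass near the origin.\<close>

lemma restrict_outside_ball:
  fixes \<mu> :: "'a::euclidean_space measure"
  assumes sets: "sets \<mu> = sets borel" and fin: "emeasure \<mu> {x. e < norm x} < \<infinity>"
  defines "N \<equiv> density \<mu> (indicator {x. e < norm x})"
  shows "sets N = sets borel" "finite_measure N"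
    and "A \<in> sets borel \<Longrightarrow> emeasure N A = emeasure \<mu> (A \<inter> {x. e < norm x})"
proof -
  have S: "{x. e < norm x} \<in> sets \<mu>" unfolding sets by measurable
  show Ns: "sets N = sets borel" by (simp add: N_def sets)
  show Ne: "emeasure N A = emeasure \<mu> (A \<inter> {x. e < norm x})" if "A \<in> sets borel" for A
    unfolding N_def using S that by (simp add: emeasure_restricted sets Int_commute)
  show "finite_measure N"
    by (rule finite_measureI) (use fin Ne[of UNIV] sets_eq_imp_space_eq[OF Ns] in auto)
qed

section \<open>Test functions and the fundamental theorem of calculus in the offset\<close>

lemma smooth_fun_continuous: "smooth_fun f \<Longrightarrow> continuous_on UNIV f"
  unfolding smooth_fun_def by (metis empty_iff foldr.simps(1) id_apply list.set(1) subsetI)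

text \<open>The description operator in \<open>pdiff\<close> yields the derivative only where one
  exists; the differentiability clause of \<open>smooth_fun\<close> for the empty list of directions
  supplies it.\<close>

lemma smooth_fun_dp:
  fixes \<psi> :: "'a::euclidean_space \<times> real \<Rightarrow> real"
  assumes "smooth_fun \<psi>"
  shows "continuous_on UNIV (dp \<psi>)"
    and "((\<lambda>t. \<psi> (\<omega>, t)) has_real_derivative dp \<psi> (\<omega>, p)) (at p)"
proof -
  have B: "(0, 1) \<in> (Basis :: ('a \<times> real) set)" by (simp add: Basis_prod_def)
  have "continuous_on UNIV (foldr pdiff [(0, 1)] \<psi>)"
    using assms B unfolding smooth_fun_def by (metis empty_set list.simps(15) singletonD subsetI empty_subsetI insert_subset)
  then show "continuous_on UNIV (dp \<psi>)" by (simp add: dp_def[abs_def])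
  have "(\<lambda>t. foldr pdiff [] \<psi> ((\<omega>, p) + t *\<^sub>R (0, 1))) differentiable (at 0)"
    using assms B unfolding smooth_fun_def by (metis empty_set empty_subsetI)
  then have "(\<lambda>t. \<psi> ((\<omega>, p) + t *\<^sub>R (0, 1))) differentiable (at 0)" by simp
  then obtain D where D: "((\<lambda>t. \<psi> ((\<omega>, p) + t *\<^sub>R (0, 1))) has_real_derivative D) (at 0)"
    unfolding real_differentiable_def by blast
  then have "dp \<psi> (\<omega>, p) = D"
    unfolding dp_def pdiff_def by (intro the_equality) (auto dest: DERIV_unique)
  moreover have "((\<lambda>t. \<psi> (\<omega>, t)) has_real_derivative D) (at p)"
    using D DERIV_shift[of "\<lambda>t. \<psi> (\<omega>, t)" D 0 p] by (simp add: add.commute)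
  ultimately show "((\<lambda>t. \<psi> (\<omega>, t)) has_real_derivative dp \<psi> (\<omega>, p)) (at p)" by simp
qed

text \<open>The factor 2 leaves a gap between -2e and -e: offsets of relevant halfspaces can be
  enlarged within it while the halfspaces still miss the ball of radius e.\<close>

lemma test_fun_strip:
  fixes \<psi> :: "'a::euclidean_space \<times> real \<Rightarrow> real"
  assumes "test_fun \<psi>"
  obtains e B where "0 < e" "2 * e < B"
    "\<And>\<omega> p. norm \<omega> = 1 \<Longrightarrow> p > - (2 * e) \<or> p < - B \<Longrightarrow> \<psi> (\<omega>, p) = 0"
proof -
  obtain K where K: "compact K" "K \<subseteq> sphere 0 1 \<times> {..<0}"
    "\<And>\<omega> p. \<omega> \<in> sphere 0 1 \<Longrightarrow> (\<omega>, p) \<notin> K \<Longrightarrow> \<psi> (\<omega>, p) = 0"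
    using assms unfolding test_fun_def by blast
  have c: "compact (snd ` K)" using K(1) by (intro compact_continuous_image continuous_intros)
  obtain b where b: "b > 0" "\<And>p. p \<in> snd ` K \<Longrightarrow> norm p \<le> b"
    using compact_imp_bounded[OF c] unfolding bounded_pos by blast
  have "\<exists>e>0. \<forall>p\<in>snd ` K. p \<le> - (2 * e)"
  proof (cases "K = {}")
    case False
    then obtain q where q: "q \<in> snd ` K" "\<And>p. p \<in> snd ` K \<Longrightarrow> p \<le> q"
      using compact_attains_sup[OF c] by auto
    have "q < 0" using q(1) K(2) by auto
    then show ?thesis using q(2) by (intro exI[of _ "- q / 2"]) auto
  qed (auto intro: exI[of _ 1])
  then obtain e where e: "e > 0" "\<And>p. p \<in> snd ` K \<Longrightarrow> p \<le> - (2 * e)" by blast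
  show ?thesis
  proof (rule that[of e "b + 2 * e + 1"])
    show "\<psi> (\<omega>, p) = 0" if "norm \<omega> = 1" "p > - (2 * e) \<or> p < - (b + 2 * e + 1)" for \<omega> p
    proof (rule K(3))
      show "\<omega> \<in> sphere 0 1" using that(1) by simp
      show "(\<omega>, p) \<notin> K"
      proof
        assume "(\<omega>, p) \<in> K"
        then have "p \<in> snd ` K" by force
        then show False using b(2)[of p] e(2)[of p] that(2) e(1) by auto
      qed
    qed
  qed (use b e in auto)
qed

text \<open>The limit function a is not assumed measurable; it only agrees almost everywhere with
  measurable expressions. In the completed parameter measure this is enough.\<close>

lemma borel_measurable_completion_AE:
  fixes f g :: "'b \<Rightarrow> real"
  assumes ae: "AE x in completion M. g x = f x" and g: "g \<in> borel_measurable M"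
  shows "f \<in> borel_measurable (completion M)"
proof (rule measurableI)
  fix A :: "real set" assume A: "A \<in> sets borel"
  have gA: "g -` A \<inter> space (completion M) \<in> sets (completion M)"
    using measurable_sets[OF measurable_completion[OF g] A] .
  have aeA: "AE x in completion M. x \<in> g -` A \<inter> space (completion M) \<longleftrightarrow> x \<in> f -` A \<inter> space (completion M)"
    using ae by eventually_elim auto
  show "f -` A \<inter> space (completion M) \<in> sets (completion M)"
    by (rule completion.in_sets_AE[OF aeA gA]) auto
qed simp

text \<open>Integrating the fundamental theorem of calculus in the offset turns the Radon transform of a measure
  into the derivative of its halfspace function.\<close>

lemma ridge_as_halfspace_integral:
  fixes \<psi> :: "'a::euclidean_space \<times> real \<Rightarrow> real"
  assumes sm: "smooth_fun \<psi>" and \<omega>: "norm \<omega> = 1" and e: "0 < e" "2 * e < B"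
    and \<psi>0: "\<And>p. p > - (2 * e) \<or> p < - B \<Longrightarrow> \<psi> (\<omega>, p) = 0"
  shows "dp \<psi> (\<omega>, p) \<noteq> 0 \<Longrightarrow> - B \<le> p \<and> p \<le> - (2 * e)"
    and "\<psi> (\<omega>, c) = - (\<integral>p. indicator {-B-1..-e} p * dp \<psi> (\<omega>, p) * indicator {c<..} p \<partial>lborel)"
proof -
  have dp0: "dp \<psi> (\<omega>, p) = 0" if "p > - (2 * e) \<or> p < - B" for p
  proof -
    define S where "S = {- (2 * e)<..} \<union> {..<- B}"
    have S: "open S" "p \<in> S" using that by (auto simp: S_def)
    have "((\<lambda>t. 0) has_real_derivative dp \<psi> (\<omega>, p)) (at p)"
      by (rule has_field_derivative_transform_within_open[OF smooth_fun_dp(2)[OF sm] S])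
         (auto simp: S_def \<psi>0)
    then show ?thesis using DERIV_unique DERIV_const by blast
  qed
  then show "dp \<psi> (\<omega>, p) \<noteq> 0 \<Longrightarrow> - B \<le> p \<and> p \<le> - (2 * e)" by force
  have dc: "isCont (\<lambda>p. dp \<psi> (\<omega>, p)) x" for x
  proof -
    have "continuous_on UNIV (\<lambda>p. dp \<psi> (\<omega>, p))"
      by (rule continuous_on_compose2[OF smooth_fun_dp(1)[OF sm]]) (auto intro!: continuous_intros)
    then show ?thesis by (simp add: continuous_on_eq_continuous_at)
  qed
  have FTC: "(\<integral>p. dp \<psi> (\<omega>, p) * indicator {m..-e} p \<partial>lborel) = \<psi> (\<omega>, -e) - \<psi> (\<omega>, m)" if "m \<le> - e" for m
    by (rule integral_FTC_Icc_real[OF that smooth_fun_dp(2)[OF sm] dc])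
  have e0: "\<psi> (\<omega>, - e) = 0" by (rule \<psi>0) (use e in auto)
  show "\<psi> (\<omega>, c) = - (\<integral>p. indicator {-B-1..-e} p * dp \<psi> (\<omega>, p) * indicator {c<..} p \<partial>lborel)"
  proof (cases "c \<le> - e")
    case True
    \<comment> \<open>The strip is lengthened from -B to -B - 1 because \<open>\<psi>\<close> is
      known to vanish only strictly below -B. If c lies below the strip, both
      \<open>\<psi> (\<omega>, m)\<close> and \<open>\<psi> (\<omega>, c)\<close> are therefore
      0.\<close>
    define m where "m = max c (- B - 1)"
    have m: "m \<le> - e" using True e by (simp add: m_def)
    have dm: "(\<lambda>p. dp \<psi> (\<omega>, p)) \<in> borel_measurable borel"
      using dc by (intro borel_measurable_continuous_onI continuous_at_imp_continuous_on) simp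
    have "(\<integral>p. indicator {-B-1..-e} p * dp \<psi> (\<omega>, p) * indicator {c<..} p \<partial>lborel)
       = (\<integral>p. dp \<psi> (\<omega>, p) * indicator {m..-e} p \<partial>lborel)"
    proof (rule integral_cong_AE)
      show "AE p in lborel. indicator {-B-1..-e} p * dp \<psi> (\<omega>, p) * indicator {c<..} p = dp \<psi> (\<omega>, p) * indicator {m..-e} p"
        using AE_lborel_singleton[of c] by eventually_elim (auto simp: indicator_def m_def)
    qed (use dm in measurable)
    also have "\<dots> = - \<psi> (\<omega>, m)" using FTC[OF m] e0 by simp
    also have "\<psi> (\<omega>, m) = \<psi> (\<omega>, c)"
    proof (cases "c \<le> - B - 1")
      case True
      then show ?thesis using \<psi>0[of c] \<psi>0[of m] by (simp add: m_def)
    qed (simp add: m_def)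
    finally show ?thesis by simp
  next
    case False
    then have z: "indicat_real {-B-1..-e} p * dp \<psi> (\<omega>, p) * indicat_real {c<..} p = 0" for p
      by (auto simp: indicator_def)
    have "\<psi> (\<omega>, c) = 0" by (rule \<psi>0) (use False e in auto)
    then show ?thesis by (simp only: z) simp
  qed
qed

section \<open>Limits of measures with convergent halfspace functions\<close>

locale halfspace_limits =
  fixes M :: "nat \<Rightarrow> 'a::euclidean_space measure" and a :: "'a \<Rightarrow> real \<Rightarrow> real"
  assumes radon: "\<And>k. radon0 (M k)"
    and lim: "AE z in param_measure. snd z < 0 \<longrightarrow>
               0 \<le> a (fst z) (snd z) \<and>
               (\<lambda>k. emeasure (M k) (halfspace (fst z) (snd z)))
                  \<longlonglongrightarrow> ennreal (a (fst z) (snd z))"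
    and decay: "\<And>m::nat. \<exists>C. \<exists>P<0. \<forall>\<omega>\<in>sphere 0 1. \<forall>p\<le>P.
                  \<bar>a \<omega> p\<bar> \<le> C * \<bar>p\<bar> powr (- real m)"
begin

lemma sets_M[measurable_cong, simp]: "sets (M k) = sets borel"
  using radon by (simp add: radon0_def)

lemma space_M[simp]: "space (M k) = UNIV"
  using sets_eq_imp_space_eq[OF sets_M] by simp

section \<open>Good directions and tail bounds\<close>

definition conv_at :: "'a \<Rightarrow> real \<Rightarrow> bool" where
  "conv_at \<omega> p \<longleftrightarrow> 0 \<le> a \<omega> p \<and> (\<lambda>k. emeasure (M k) (halfspace \<omega> p)) \<longlonglongrightarrow> ennreal (a \<omega> p)"

text \<open>Convergence is known only for almost every pair. By Fubini almost every direction is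
  good, and in a good direction every interval of negative offsets contains one at which the masses
  converge.\<close>

definition good :: "'a \<Rightarrow> bool" where
  "good \<omega> \<longleftrightarrow> norm \<omega> = 1 \<and> (AE p in lborel. p < 0 \<longrightarrow> conv_at \<omega> p)"

lemma AE_good: "AE \<omega> in sphere_measure. good \<omega>"
proof -
  interpret S: prob_space "sphere_measure :: 'a measure" by (rule prob_space_sphere_measure)
  interpret P: pair_sigma_finite "sphere_measure :: 'a measure" "lborel :: real measure" ..
  have "AE z in sphere_measure \<Otimes>\<^sub>M lborel. snd z < 0 \<longrightarrow> conv_at (fst z) (snd z)"
    using lim unfolding param_measure_def AE_completion_iff conv_at_def .
  then have "AE \<omega> in sphere_measure. AE p in lborel. p < 0 \<longrightarrow> conv_at \<omega> p"
    using P.AE_pair by fastforce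
  then show ?thesis using AE_sphere_measure_norm unfolding good_def by eventually_elim simp
qed

lemma good_between:
  assumes "good \<omega>" "p1 < p2" "p2 \<le> 0"
  shows "\<exists>p. p1 < p \<and> p < p2 \<and> conv_at \<omega> p"
proof -
  have "\<exists>p\<in>{p1<..<p2}. p < 0 \<longrightarrow> conv_at \<omega> p"
    by (rule AE_lborel_open_ex) (use assms in \<open>auto simp: good_def\<close>)
  then show ?thesis using assms by auto
qed

text \<open>Points with |x| \<ge> R satisfy x . \<omega> \<le> - c R for some \<omega> in the finite
  set, so halfspaces with offsets above - c R cover them. The offsets stay below - c R / 2 as well,
  which keeps |p| comparable to R and turns the decay of a in p into decay in R.\<close>

lemma cover_bound:
  assumes \<Omega>: "finite \<Omega>" "\<And>\<omega>. \<omega> \<in> \<Omega> \<Longrightarrow> good \<omega>" and c: "c > 0"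
    and cover: "\<And>x. \<exists>\<omega>\<in>\<Omega>. x \<bullet> \<omega> \<le> - (c * norm x)" and R: "R > 0" and e: "e > 0"
  shows "\<exists>p. (\<forall>\<omega>\<in>\<Omega>. - (c * R) < p \<omega> \<and> p \<omega> < - (c * R / 2) \<and> conv_at \<omega> (p \<omega>)) \<and>
    (\<forall>\<^sub>F k in sequentially. emeasure (M k) {x. R \<le> norm x} \<le> ennreal ((\<Sum>\<omega>\<in>\<Omega>. a \<omega> (p \<omega>)) + e))"
proof -
  have cR: "c * R > 0" using c R by simp
  have "\<exists>p. - (c * R) < p \<and> p < - (c * R / 2) \<and> conv_at \<omega> p" if "\<omega> \<in> \<Omega>" for \<omega>
    by (rule good_between[OF \<Omega>(2)[OF that]]) (use cR in linarith)+
  then obtain p where p: "\<And>\<omega>. \<omega> \<in> \<Omega> \<Longrightarrow> - (c * R) < p \<omega> \<and> p \<omega> < - (c * R / 2) \<and> conv_at \<omega> (p \<omega>)"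
    by metis
  have sub: "{x::'a. R \<le> norm x} \<subseteq> (\<Union>\<omega>\<in>\<Omega>. halfspace \<omega> (p \<omega>))"
  proof
    fix x :: 'a assume "x \<in> {x. R \<le> norm x}"
    then have "c * R \<le> c * norm x" using c by simp
    moreover obtain \<omega> where \<omega>: "\<omega> \<in> \<Omega>" "x \<bullet> \<omega> \<le> - (c * norm x)" using cover by blast
    ultimately have "x \<bullet> \<omega> < p \<omega>" using p[OF \<omega>(1)] by linarith
    then show "x \<in> (\<Union>\<omega>\<in>\<Omega>. halfspace \<omega> (p \<omega>))" using \<omega>(1) by (auto simp: halfspace_def)
  qed
  have le: "emeasure (M k) {x. R \<le> norm x} \<le> (\<Sum>\<omega>\<in>\<Omega>. emeasure (M k) (halfspace \<omega> (p \<omega>)))" for k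
  proof -
    have "emeasure (M k) {x. R \<le> norm x} \<le> emeasure (M k) (\<Union>\<omega>\<in>\<Omega>. halfspace \<omega> (p \<omega>))"
      by (rule emeasure_mono[OF sub]) (use \<Omega>(1) in auto)
    also have "\<dots> \<le> (\<Sum>\<omega>\<in>\<Omega>. emeasure (M k) (halfspace \<omega> (p \<omega>)))"
      by (rule emeasure_subadditive_finite) (use \<Omega>(1) in auto)
    finally show ?thesis .
  qed
  have "(\<lambda>k. \<Sum>\<omega>\<in>\<Omega>. emeasure (M k) (halfspace \<omega> (p \<omega>))) \<longlonglongrightarrow> (\<Sum>\<omega>\<in>\<Omega>. ennreal (a \<omega> (p \<omega>)))"
    by (rule tendsto_sum) (use p in \<open>auto simp: conv_at_def\<close>)
  moreover have "(\<Sum>\<omega>\<in>\<Omega>. ennreal (a \<omega> (p \<omega>))) < ennreal ((\<Sum>\<omega>\<in>\<Omega>. a \<omega> (p \<omega>)) + e)"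
  proof -
    have nn: "0 \<le> a \<omega> (p \<omega>)" if "\<omega> \<in> \<Omega>" for \<omega> using p[OF that] by (simp add: conv_at_def)
    have "(\<Sum>\<omega>\<in>\<Omega>. ennreal (a \<omega> (p \<omega>))) = ennreal (\<Sum>\<omega>\<in>\<Omega>. a \<omega> (p \<omega>))"
      by (rule sum_ennreal) (rule nn)
    then show ?thesis using e sum_nonneg[of \<Omega> "\<lambda>\<omega>. a \<omega> (p \<omega>)"] nn by (simp add: ennreal_less_iff)
  qed
  ultimately have "\<forall>\<^sub>F k in sequentially. (\<Sum>\<omega>\<in>\<Omega>. emeasure (M k) (halfspace \<omega> (p \<omega>))) < ennreal ((\<Sum>\<omega>\<in>\<Omega>. a \<omega> (p \<omega>)) + e)"
    by (rule order_tendstoD(2))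
  then have "\<forall>\<^sub>F k in sequentially. emeasure (M k) {x. R \<le> norm x} \<le> ennreal ((\<Sum>\<omega>\<in>\<Omega>. a \<omega> (p \<omega>)) + e)"
    by (rule eventually_mono) (use le in \<open>meson order_trans less_imp_le\<close>)
  then show ?thesis using p by blast
qed

lemma eventually_bounded_outside:
  assumes "r > 0"
  shows "\<exists>C\<ge>0. \<forall>\<^sub>F k in sequentially. emeasure (M k) {x. r \<le> norm x} \<le> ennreal C"
proof -
  obtain \<Omega> c where \<Omega>: "finite \<Omega>" "c > 0" "\<forall>\<omega>\<in>\<Omega>. norm \<omega> = 1 \<and> good \<omega>"
     "\<forall>x. \<exists>\<omega>\<in>\<Omega>. x \<bullet> \<omega> \<le> - (c * norm x)"
    using AE_sphere_measure_finite_cover[OF AE_good] by blast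
  obtain C where "\<forall>\<^sub>F k in sequentially. emeasure (M k) {x. r \<le> norm x} \<le> ennreal C"
    using cover_bound[of \<Omega> c r 1] \<Omega> assms by auto
  moreover have "ennreal C \<le> ennreal (max 0 C)" by (rule ennreal_leI) simp
  ultimately have "\<forall>\<^sub>F k in sequentially. emeasure (M k) {x. r \<le> norm x} \<le> ennreal (max 0 C)"
    by (elim eventually_mono) (rule order_trans)
  then show ?thesis by (intro exI[of _ "max 0 C"]) simp
qed

text \<open>The order of quantifiers matters: the constants are uniform in R, whereas the index from
  which the bound holds depends on R, since the offsets are chosen anew for each R.\<close>

lemma tail_bound:
  "\<exists>C R0. 0 \<le> C \<and> 0 < R0 \<and>
     (\<forall>R\<ge>R0. \<forall>\<^sub>F k in sequentially. emeasure (M k) {x. R \<le> norm x} \<le> ennreal (C / R ^ m))"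
proof -
  obtain \<Omega> c where \<Omega>: "finite \<Omega>" "c > 0" "\<forall>\<omega>\<in>\<Omega>. norm \<omega> = 1 \<and> good \<omega>"
     "\<forall>x. \<exists>\<omega>\<in>\<Omega>. x \<bullet> \<omega> \<le> - (c * norm x)"
    using AE_sphere_measure_finite_cover[OF AE_good] by blast
  obtain C P where C: "P < 0" "\<And>\<omega> p. \<omega> \<in> sphere 0 1 \<Longrightarrow> p \<le> P \<Longrightarrow> \<bar>a \<omega> p\<bar> \<le> C * \<bar>p\<bar> powr (- real m)"
    using decay[of m] by blast
  define C' where "C' = \<bar>C\<bar>"
  \<comment> \<open>For R \<ge> R0 all offsets, being below - c R / 2, lie in the range p \<le> P of
    the decay hypothesis. The summand 1 in \<open>K\<close> absorbs the slack
    \<open>1 / R ^ m\<close> of the covering bound.\<close>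
  define R0 where "R0 = - 2 * P / c"
  have R0: "R0 > 0" unfolding R0_def by (rule divide_pos_pos) (use C(1) \<Omega>(2) in auto)
  define K where "K = real (card \<Omega>) * (C' * (2 / c) ^ m) + 1"
  have K: "0 \<le> K" unfolding K_def C'_def using \<Omega>(2) by simp
  have "\<forall>\<^sub>F k in sequentially. emeasure (M k) {x. R \<le> norm x} \<le> ennreal (K / R ^ m)" if R: "R \<ge> R0" for R
  proof -
    have Rp: "R > 0" using R R0 by linarith
    obtain p where p: "\<And>\<omega>. \<omega> \<in> \<Omega> \<Longrightarrow> - (c * R) < p \<omega> \<and> p \<omega> < - (c * R / 2) \<and> conv_at \<omega> (p \<omega>)"
      and ev: "\<forall>\<^sub>F k in sequentially. emeasure (M k) {x. R \<le> norm x} \<le> ennreal ((\<Sum>\<omega>\<in>\<Omega>. a \<omega> (p \<omega>)) + 1 / R ^ m)"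
      using cover_bound[of \<Omega> c R "1 / R ^ m"] \<Omega> Rp by auto
    have cRP: "c * R / 2 \<ge> - P"
    proof -
      have "R0 * c = - 2 * P" using \<Omega>(2) by (simp add: R0_def)
      moreover have "R0 * c \<le> R * c" using R \<Omega>(2) by simp
      ultimately have "- 2 * P \<le> R * c" by simp
      then show ?thesis by (simp add: mult.commute)
    qed
    have "a \<omega> (p \<omega>) \<le> C' * (2 / c) ^ m / R ^ m" if \<omega>: "\<omega> \<in> \<Omega>" for \<omega>
    proof -
      have pn: "p \<omega> \<le> P" "\<bar>p \<omega>\<bar> \<ge> c * R / 2" "\<bar>p \<omega>\<bar> > 0" using p[OF \<omega>] cRP C(1) by linarith+
      have cR: "c * R / 2 > 0" using \<Omega>(2) Rp by simp
      have "a \<omega> (p \<omega>) \<le> C * \<bar>p \<omega>\<bar> powr (- real m)"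
        using C(2)[of \<omega> "p \<omega>"] \<Omega>(3) \<omega> pn(1) by (auto simp: abs_le_iff)
      also have "\<dots> \<le> C' * \<bar>p \<omega>\<bar> powr (- real m)" unfolding C'_def by (rule mult_right_mono) auto
      also have "\<bar>p \<omega>\<bar> powr (- real m) = 1 / \<bar>p \<omega>\<bar> ^ m"
        using pn(3) by (simp add: powr_minus powr_realpow inverse_eq_divide)
      also have "C' * (1 / \<bar>p \<omega>\<bar> ^ m) \<le> C' * (1 / (c * R / 2) ^ m)"
        using pn cR by (intro mult_left_mono divide_left_mono power_mono) (auto simp: C'_def)
      also have "\<dots> = C' * (2 / c) ^ m / R ^ m"
        by (simp add: power_mult_distrib power_divide)
      finally show ?thesis .
    qed
    then have "(\<Sum>\<omega>\<in>\<Omega>. a \<omega> (p \<omega>)) \<le> real (card \<Omega>) * (C' * (2 / c) ^ m / R ^ m)"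
      by (rule sum_bounded_above)
    then have "(\<Sum>\<omega>\<in>\<Omega>. a \<omega> (p \<omega>)) + 1 / R ^ m \<le> K / R ^ m"
      unfolding K_def by (simp add: add_divide_distrib)
    then have "ennreal ((\<Sum>\<omega>\<in>\<Omega>. a \<omega> (p \<omega>)) + 1 / R ^ m) \<le> ennreal (K / R ^ m)" by (rule ennreal_leI)
    with ev show ?thesis by (elim eventually_mono) (rule order_trans)
  qed
  then show ?thesis using K R0 by blast
qed

lemma integrable_outside:
  fixes N :: "'a measure" and f :: "'a \<Rightarrow> real"
  assumes N: "sets N = sets borel" "emeasure N {x. r \<le> norm x} < \<infinity>"
    and f: "continuous_on UNIV f" "\<And>x. \<bar>f x\<bar> \<le> B" "\<And>x. norm x \<le> r \<Longrightarrow> f x = 0"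
  shows "integrable N f"
proof (rule Bochner_Integration.integrable_bound)
  note N(1)[measurable_cong]
  have "{x. r \<le> norm x} \<in> sets N" unfolding N(1) by measurable
  then show "integrable N (\<lambda>x. B * indicator {x. r \<le> norm x} x)"
    using N(2) by (intro integrable_mult_right integrable_real_indicator)
  show "f \<in> borel_measurable N" using borel_measurable_continuous_onI[OF f(1)] by simp
  have "\<bar>f x\<bar> \<le> \<bar>B * indicator {x. r \<le> norm x} x\<bar>" for x
    using f(2)[of x] f(3)[of x] by (auto simp: indicator_def)
  then show "AE x in N. norm (f x) \<le> norm (B * indicator {x. r \<le> norm x} x)"
    by (intro AE_I2) simp
qed

section \<open>Limits outside a ball and their uniqueness\<close>

text \<open>The test functions may be nonzero right up to the sphere |x| = r, so the limit is pinned
  down on all of |x| > r, while nothing is claimed inside. Integrability is demanded only for the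
  limit measure.\<close>

definition converges_beyond :: "real \<Rightarrow> (nat \<Rightarrow> nat) \<Rightarrow> 'a measure \<Rightarrow> bool" where
  "converges_beyond r s \<mu> \<longleftrightarrow> (\<forall>f B. continuous_on UNIV f \<longrightarrow> (\<forall>x. \<bar>f x\<bar> \<le> B) \<longrightarrow>
     (\<forall>x. norm x \<le> r \<longrightarrow> f x = 0) \<longrightarrow>
     integrable \<mu> f \<and> (\<lambda>n. \<integral>x. f x \<partial>M (s n)) \<longlonglongrightarrow> (\<integral>x. (f x :: real) \<partial>\<mu>))"

lemma converges_beyondD:
  fixes f :: "'a \<Rightarrow> real"
  assumes "converges_beyond r s \<mu>" "continuous_on UNIV f" "\<And>x. \<bar>f x\<bar> \<le> B" "\<And>x. norm x \<le> r \<Longrightarrow> f x = 0"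
  shows "integrable \<mu> f" "(\<lambda>n. \<integral>x. f x \<partial>M (s n)) \<longlonglongrightarrow> (\<integral>x. f x \<partial>\<mu>)"
  using assms unfolding converges_beyond_def by blast+

lemma converges_beyond_mono:
  assumes "converges_beyond r s \<mu>" "r \<le> r'"
  shows "converges_beyond r' s \<mu>"
  using assms unfolding converges_beyond_def by (meson order_trans)

text \<open>Without integrability the integrals would have the default value 0 and could not be
  compared with masses; it holds as soon as the mass outside the ball is bounded.\<close>

lemma eventually_integrable_M:
  fixes f :: "'a \<Rightarrow> real"
  assumes "r > 0" "strict_mono s"
    and f: "continuous_on UNIV f" "\<And>x. \<bar>f x\<bar> \<le> B" "\<And>x. norm x \<le> r \<Longrightarrow> f x = 0"
  shows "\<forall>\<^sub>F n in sequentially. integrable (M (s n)) f"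
proof -
  obtain C where "\<forall>\<^sub>F k in sequentially. emeasure (M k) {x. r \<le> norm x} \<le> ennreal C"
    using eventually_bounded_outside[OF assms(1)] by blast
  then have "\<forall>\<^sub>F n in sequentially. emeasure (M (s n)) {x. r \<le> norm x} \<le> ennreal C"
    by (rule eventually_subseq[OF assms(2)])
  then show ?thesis
  proof (rule eventually_mono)
    fix n assume "emeasure (M (s n)) {x. r \<le> norm x} \<le> ennreal C"
    then have "emeasure (M (s n)) {x. r \<le> norm x} < \<infinity>" by (simp add: le_less_trans)
    then show "integrable (M (s n)) f" by (rule integrable_outside[OF sets_M _ f])
  qed
qed

text \<open>A piecewise linear function of x . \<omega> lies between the indicators of the two
  halfspaces, and q \<le> - r makes it vanish on the ball, so its integrals converge. The gap p < q
  is the price of continuity and is closed later by letting the offsets approach each other.\<close>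

lemma halfspace_sandwich:
  assumes conv: "converges_beyond r s \<mu>" and s: "strict_mono s" and sets: "sets \<mu> = sets borel"
    and r: "r > 0" and \<omega>: "norm \<omega> = 1" and p: "p < q" "q \<le> - r"
  shows "conv_at \<omega> p \<Longrightarrow> ennreal (a \<omega> p) \<le> emeasure \<mu> (halfspace \<omega> q)"
    and "conv_at \<omega> q \<Longrightarrow> emeasure \<mu> (halfspace \<omega> p) \<le> ennreal (a \<omega> q)"
proof -
  define h where "h x = max 0 (min 1 ((q - x \<bullet> \<omega>) / (q - p)))" for x
  have hc: "continuous_on UNIV h" unfolding h_def using p by (intro continuous_intros) auto
  have h01: "0 \<le> h x" "h x \<le> 1" "\<bar>h x\<bar> \<le> 1" for x unfolding h_def by auto
  have h0: "h x = 0" if "norm x \<le> r" for x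
  proof -
    have "- r \<le> x \<bullet> \<omega>" using Cauchy_Schwarz_ineq2[of x \<omega>] that \<omega> by simp
    then have "(q - x \<bullet> \<omega>) / (q - p) \<le> 0" using p by (intro divide_nonpos_pos) auto
    then show ?thesis by (simp add: h_def)
  qed
  have hp: "indicator (halfspace \<omega> p) x \<le> ennreal (h x)" for x
  proof -
    have "1 \<le> (q - x \<bullet> \<omega>) / (q - p)" if "x \<bullet> \<omega> < p" using that p by simp
    then show ?thesis by (auto simp: h_def halfspace_def indicator_def)
  qed
  have hq: "ennreal (h x) \<le> indicator (halfspace \<omega> q) x" for x
  proof -
    have "(q - x \<bullet> \<omega>) / (q - p) \<le> 0" if "q \<le> x \<bullet> \<omega>" using that p by (intro divide_nonpos_pos) auto
    then show ?thesis using h01[of x] by (auto simp: h_def halfspace_def indicator_def ennreal_eq_0_iff)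
  qed
  have int: "integrable \<mu> h" and cv: "(\<lambda>n. \<integral>x. h x \<partial>M (s n)) \<longlonglongrightarrow> (\<integral>x. h x \<partial>\<mu>)"
    using converges_beyondD[OF conv hc h01(3) h0] by auto
  have bnd: "emeasure N (halfspace \<omega> p) \<le> ennreal (\<integral>x. h x \<partial>N)"
     "ennreal (\<integral>x. h x \<partial>N) \<le> emeasure N (halfspace \<omega> q)"
    if N: "sets N = sets borel" "integrable N h" for N
  proof -
    note N(1)[measurable_cong]
    have eq: "ennreal (\<integral>x. h x \<partial>N) = (\<integral>\<^sup>+x. ennreal (h x) \<partial>N)"
      using nn_integral_eq_integral[OF N(2)] h01(1) by simp
    have "emeasure N (halfspace \<omega> p) = (\<integral>\<^sup>+x. indicator (halfspace \<omega> p) x \<partial>N)"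
      by (rule nn_integral_indicator[symmetric]) measurable
    also have "\<dots> \<le> (\<integral>\<^sup>+x. ennreal (h x) \<partial>N)" by (rule nn_integral_mono) (rule hp)
    finally show "emeasure N (halfspace \<omega> p) \<le> ennreal (\<integral>x. h x \<partial>N)" using eq by simp
    have "(\<integral>\<^sup>+x. ennreal (h x) \<partial>N) \<le> (\<integral>\<^sup>+x. indicator (halfspace \<omega> q) x \<partial>N)"
      by (rule nn_integral_mono) (rule hq)
    also have "\<dots> = emeasure N (halfspace \<omega> q)" by (rule nn_integral_indicator) measurable
    finally show "ennreal (\<integral>x. h x \<partial>N) \<le> emeasure N (halfspace \<omega> q)" using eq by simp
  qed
  have cv': "(\<lambda>n. ennreal (\<integral>x. h x \<partial>M (s n))) \<longlonglongrightarrow> ennreal (\<integral>x. h x \<partial>\<mu>)"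
    using cv by (rule tendsto_ennrealI)
  have evi: "\<forall>\<^sub>F n in sequentially. integrable (M (s n)) h"
    by (rule eventually_integrable_M[OF r s hc h01(3) h0])
  show "ennreal (a \<omega> p) \<le> emeasure \<mu> (halfspace \<omega> q)" if "conv_at \<omega> p"
  proof -
    have "(\<lambda>n. emeasure (M (s n)) (halfspace \<omega> p)) \<longlonglongrightarrow> ennreal (a \<omega> p)"
      using that LIMSEQ_subseq_LIMSEQ[OF _ s] by (fastforce simp: conv_at_def comp_def)
    then have "ennreal (a \<omega> p) \<le> ennreal (\<integral>x. h x \<partial>\<mu>)"
      by (rule tendsto_le[OF sequentially_bot cv']) (use evi in \<open>auto elim!: eventually_mono intro: bnd\<close>)
    also have "\<dots> \<le> emeasure \<mu> (halfspace \<omega> q)" by (rule bnd(2)[OF sets int])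
    finally show ?thesis .
  qed
  show "emeasure \<mu> (halfspace \<omega> p) \<le> ennreal (a \<omega> q)" if "conv_at \<omega> q"
  proof -
    have "(\<lambda>n. emeasure (M (s n)) (halfspace \<omega> q)) \<longlonglongrightarrow> ennreal (a \<omega> q)"
      using that LIMSEQ_subseq_LIMSEQ[OF _ s] by (fastforce simp: conv_at_def comp_def)
    then have "ennreal (\<integral>x. h x \<partial>\<mu>) \<le> ennreal (a \<omega> q)"
      by (rule tendsto_le[OF sequentially_bot _ cv']) (use evi in \<open>auto elim!: eventually_mono intro: bnd\<close>)
    with bnd(1)[OF sets int] show ?thesis by (rule order_trans)
  qed
qed


text \<open>The selection theorem is applied to the restrictions to |x| \<ge> r, whose boundary
  behaviour is invisible to test functions vanishing on the ball. The limit inherits the tail bound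
  of every order, hence has all moments.\<close>

lemma subsequential_limit:
  assumes r: "r > 0" and s0: "strict_mono (s0 :: nat \<Rightarrow> nat)"
  shows "\<exists>s \<mu>. strict_mono (s :: nat \<Rightarrow> nat) \<and> finite_moments \<mu> \<and> converges_beyond r (s0 \<circ> s) \<mu>"
proof -
  obtain C where C: "C \<ge> 0" "\<forall>\<^sub>F k in sequentially. emeasure (M k) {x. r \<le> norm x} \<le> ennreal C"
    using eventually_bounded_outside[OF r] by blast
  then obtain k0 where k0: "\<And>k. k \<ge> k0 \<Longrightarrow> emeasure (M k) {x. r \<le> norm x} \<le> ennreal C"
    unfolding eventually_sequentially by blast
  \<comment> \<open>The selection theorem asks for a mass bound at every index, not just eventually;
    the shift by k0 provides it.\<close>
  define s1 where "s1 n = s0 (n + k0)" for n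
  have s1: "strict_mono s1" using s0 unfolding s1_def strict_mono_def by simp
  have s1k: "emeasure (M (s1 n)) {x. r \<le> norm x} \<le> ennreal C" for n
    by (rule k0) (use seq_suble[OF s0, of "n + k0"] in \<open>simp add: s1_def\<close>)
  have S: "{x::'a. r \<le> norm x} \<in> sets borel" by measurable
  define P where "P n = density (M (s1 n)) (indicator {x. r \<le> norm x})" for n
  have Ps: "sets (P n) = sets borel" for n by (simp add: P_def)
  have Psp: "space (P n) = UNIV" for n by (simp add: P_def)
  have Pe: "emeasure (P n) A = emeasure (M (s1 n)) (A \<inter> {x. r \<le> norm x})" if "A \<in> sets borel" for n A
    unfolding P_def using that S by (simp add: emeasure_restricted Int_commute)
  have PC: "emeasure (P n) UNIV \<le> ennreal C" for n using s1k[of n] by (simp add: Pe)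
  have Pfin: "finite_measure (P n)" for n
    by (rule finite_measureI) (use PC[of n] in \<open>auto simp: Psp top_unique\<close>)
  have Pm: "measure (P n) UNIV \<le> C" for n
    using enn2real_mono[OF PC[of n]] C(1) by (simp add: measure_def)
  have tight: "\<exists>R. \<forall>\<^sub>F n in sequentially. measure (P n) {x. norm x > R} \<le> e" if e: "e > 0" for e
  proof -
    obtain K R0 where K: "0 \<le> K" "0 < R0"
      "\<And>R. R \<ge> R0 \<Longrightarrow> \<forall>\<^sub>F k in sequentially. emeasure (M k) {x. R \<le> norm x} \<le> ennreal (K / R ^ 1)"
      using tail_bound[of 1] by blast
    define R where "R = max R0 (K / e)"
    have R: "R \<ge> R0" "R > 0" using K(2) by (auto simp: R_def)
    have "K / e \<le> R" by (simp add: R_def)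
    then have KR: "K / R \<le> e" using R(2) e by (simp add: field_simps)
    have "\<forall>\<^sub>F n in sequentially. emeasure (M (s1 n)) {x. R \<le> norm x} \<le> ennreal (K / R ^ 1)"
      by (rule eventually_subseq[OF s1 K(3)[OF R(1)]])
    then have "\<forall>\<^sub>F n in sequentially. measure (P n) {x. norm x > R} \<le> e"
    proof (rule eventually_mono)
      fix n assume le: "emeasure (M (s1 n)) {x. R \<le> norm x} \<le> ennreal (K / R ^ 1)"
      have "emeasure (P n) {x. norm x > R} \<le> emeasure (M (s1 n)) {x. R \<le> norm x}"
        by (subst Pe) (auto intro!: emeasure_mono)
      also have "\<dots> \<le> ennreal e" using le KR by (auto intro: order_trans ennreal_leI)
      finally show "measure (P n) {x. norm x > R} \<le> e"
        using enn2real_mono[of _ "ennreal e"] e by (simp add: measure_def)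
    qed
    then show ?thesis by blast
  qed
  obtain s2 \<mu> where s2: "strict_mono (s2 :: nat \<Rightarrow> nat)" and \<mu>: "finite_measure \<mu>" "sets \<mu> = sets borel"
    and conv: "\<And>(f :: 'a \<Rightarrow> real) B. continuous_on UNIV f \<Longrightarrow> (\<And>x. \<bar>f x\<bar> \<le> B) \<Longrightarrow>
       (\<lambda>n. \<integral>x. f x \<partial>P (s2 n)) \<longlonglongrightarrow> (\<integral>x. f x \<partial>\<mu>)"
    using tight_imp_weakly_convergent_subseq_finite[of P, OF Pfin Ps Pm tight] by blast
  define s where "s n = s2 n + k0" for n
  have s: "strict_mono s" using s2 unfolding s_def strict_mono_def by simp
  have s_eq: "(s0 \<circ> s) n = s1 (s2 n)" for n by (simp add: s_def s1_def)
  interpret \<mu>: finite_measure \<mu> by (rule \<mu>(1))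
  note \<mu>(2)[measurable_cong]
  have bc: "converges_beyond r (s0 \<circ> s) \<mu>"
    unfolding converges_beyond_def
  proof (intro allI impI conjI)
    fix f :: "'a \<Rightarrow> real" and B
    assume f: "continuous_on UNIV f" "\<forall>x. \<bar>f x\<bar> \<le> B" "\<forall>x. norm x \<le> r \<longrightarrow> f x = 0"
    have fm[measurable]: "f \<in> borel_measurable borel" using f(1) by (rule borel_measurable_continuous_onI)
    show "integrable \<mu> f" by (rule \<mu>.integrable_const_bound[of _ B]) (use f(2) in auto)
    have "(\<integral>x. f x \<partial>P n) = (\<integral>x. f x \<partial>M (s1 n))" for n
      unfolding P_def by (rule integral_density_indicator(2)[OF sets_M S fm]) (use f(3) in auto)
    then show "(\<lambda>n. \<integral>x. f x \<partial>M ((s0 \<circ> s) n)) \<longlonglongrightarrow> (\<integral>x. f x \<partial>\<mu>)"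
      using conv[of f B] f unfolding s_eq by simp
  qed
  have "finite_moments \<mu>"
  proof (rule finite_moments_of_tail[OF \<mu>])
    fix m :: nat
    obtain K R0 where K: "0 \<le> K" "0 < R0"
      "\<And>R. R \<ge> R0 \<Longrightarrow> \<forall>\<^sub>F k in sequentially. emeasure (M k) {x. R \<le> norm x} \<le> ennreal (K / R ^ m)"
      using tail_bound[of m] by blast
    have "measure \<mu> {x. R \<le> norm x} \<le> (K * 2 ^ m) / R ^ m" if R: "R \<ge> 2 * max R0 r" for R
    proof -
      \<comment> \<open>Tails are not continuous under weak limits, so a continuous cutoff rising
        between R/2 and R is inserted; it costs the factor \<open>2 ^ m\<close>.\<close>
      define R' where "R' = R / 2"
      have R': "R' \<ge> R0" "R' \<ge> r" "R' > 0" using R r by (auto simp: R'_def)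
      define h where "h x = max 0 (min 1 (norm x / R' - 1))" for x :: 'a
      have hc: "continuous_on UNIV h" unfolding h_def using R' by (intro continuous_intros) auto
      then have [measurable]: "h \<in> borel_measurable borel" by (rule borel_measurable_continuous_onI)
      have h01: "0 \<le> h x" "h x \<le> 1" "\<bar>h x\<bar> \<le> 1" for x unfolding h_def by auto
      have h0: "h x = 0" if "norm x \<le> R'" for x
        using that R'(3) by (simp add: h_def divide_le_eq)
      have h1: "h x = 1" if "R \<le> norm x" for x
        using that R'(3) by (simp add: h_def R'_def field_simps)
      have int: "integrable \<mu> h" by (rule \<mu>.integrable_const_bound[of _ 1]) (use h01 in auto)
      have cv: "(\<lambda>n. \<integral>x. h x \<partial>M ((s0 \<circ> s) n)) \<longlonglongrightarrow> (\<integral>x. h x \<partial>\<mu>)"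
        by (rule converges_beyondD(2)[OF bc hc h01(3)]) (use h0 R'(2) in auto)
      have "\<forall>\<^sub>F n in sequentially. emeasure (M ((s0 \<circ> s) n)) {x. R' \<le> norm x} \<le> ennreal (K / R' ^ m)"
        by (rule eventually_subseq[OF strict_mono_o[OF s0 s] K(3)[OF R'(1)]])
      then have "\<forall>\<^sub>F n in sequentially. (\<integral>x. h x \<partial>M ((s0 \<circ> s) n)) \<le> K / R' ^ m"
      proof (rule eventually_mono)
        fix n assume le: "emeasure (M ((s0 \<circ> s) n)) {x. R' \<le> norm x} \<le> ennreal (K / R' ^ m)"
        have fin: "emeasure (M ((s0 \<circ> s) n)) {x. R' \<le> norm x} < \<infinity>"
          by (rule le_less_trans[OF le]) simp
        have "(\<integral>x. h x \<partial>M ((s0 \<circ> s) n)) \<le> (\<integral>x. indicator {x. R' \<le> norm x} x \<partial>M ((s0 \<circ> s) n))"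
        proof (rule integral_mono)
          show "integrable (M ((s0 \<circ> s) n)) h"
            by (rule integrable_outside[OF sets_M fin hc h01(3) h0])
          show "integrable (M ((s0 \<circ> s) n)) (indicat_real {x. R' \<le> norm x})"
            using fin by (intro integrable_real_indicator) auto
          show "h x \<le> indicator {x. R' \<le> norm x} x" for x
            using h01[of x] h0[of x] by (auto simp: indicator_def)
        qed
        also have "\<dots> = measure (M ((s0 \<circ> s) n)) {x. R' \<le> norm x}" by simp
        also have "\<dots> \<le> K / R' ^ m"
          using enn2real_mono[OF le] K(1) R'(3) by (simp add: measure_def)
        finally show "(\<integral>x. h x \<partial>M ((s0 \<circ> s) n)) \<le> K / R' ^ m" .
      qed
      from tendsto_upperbound[OF cv this] have "(\<integral>x. h x \<partial>\<mu>) \<le> K / R' ^ m" by simp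
      moreover have "measure \<mu> {x. R \<le> norm x} \<le> (\<integral>x. h x \<partial>\<mu>)"
      proof -
        have "measure \<mu> {x. R \<le> norm x} = (\<integral>x. indicator {x. R \<le> norm x} x \<partial>\<mu>)"
          using sets_eq_imp_space_eq[OF \<mu>(2)] by simp
        also have "\<dots> \<le> (\<integral>x. h x \<partial>\<mu>)"
        proof (rule integral_mono[OF _ int])
          show "integrable \<mu> (indicat_real {x. R \<le> norm x})"
            by (rule \<mu>.integrable_const_bound[of _ 1]) auto
          show "indicator {x. R \<le> norm x} x \<le> h x" for x
            using h01[of x] h1[of x] by (auto simp: indicator_def)
        qed
        finally show ?thesis .
      qed
      moreover have "K / R' ^ m = (K * 2 ^ m) / R ^ m" by (simp add: R'_def power_divide)
      ultimately show ?thesis by linarith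
    qed
    then show "\<exists>C R0. \<forall>R\<ge>R0. measure \<mu> {x. R \<le> norm x} \<le> C / R ^ m" by blast
  qed
  with s bc show ?thesis by blast
qed


text \<open>A convergent offset q slightly below p separates the two limits: the first one at p -
  1/(n+1) is at most \<open>a \<omega> q\<close>, which is at most the second one at p. As the
  halfspaces are open, continuity from below removes the gap. Exchanging the roles gives
  equality.\<close>

lemma halfspace_emeasure_le:
  assumes c1: "converges_beyond r s1 \<mu>1" "strict_mono s1" "sets \<mu>1 = sets borel"
    and c2: "converges_beyond r s2 \<mu>2" "strict_mono s2" "sets \<mu>2 = sets borel"
    and r: "r > 0" and \<omega>: "good \<omega>" and p: "p < - r"
  shows "emeasure \<mu>1 (halfspace \<omega> p) \<le> emeasure \<mu>2 (halfspace \<omega> p)"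
proof -
  define H where "H n = halfspace \<omega> (p - inverse (real (Suc n)))" for n
  have lim: "(\<lambda>n. emeasure \<mu>1 (H n)) \<longlonglongrightarrow> emeasure \<mu>1 (halfspace \<omega> p)"
    unfolding H_def by (rule emeasure_halfspace_lim[OF c1(3)])
  have le: "emeasure \<mu>1 (H n) \<le> emeasure \<mu>2 (halfspace \<omega> p)" for n
  proof -
    have "p - inverse (real (Suc n)) < p" "p \<le> 0" using p r by auto
    then obtain q where q: "p - inverse (real (Suc n)) < q" "q < p" "conv_at \<omega> q"
      using good_between[OF \<omega>] by blast
    have n\<omega>: "norm \<omega> = 1" using \<omega> by (simp add: good_def)
    have "emeasure \<mu>1 (H n) \<le> ennreal (a \<omega> q)"
      unfolding H_def by (rule halfspace_sandwich(2)[OF c1 r n\<omega> q(1) _ q(3)]) (use p q in simp)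
    also have "\<dots> \<le> emeasure \<mu>2 (halfspace \<omega> p)"
      by (rule halfspace_sandwich(1)[OF c2 r n\<omega> q(2) _ q(3)]) (use p in simp)
    finally show ?thesis .
  qed
  show ?thesis by (rule LIMSEQ_le_const2[OF lim]) (use le in blast)
qed

lemma converges_beyond_unique:
  assumes c1: "converges_beyond r s1 \<mu>1" "strict_mono s1" "finite_moments \<mu>1"
    and c2: "converges_beyond r s2 \<mu>2" "strict_mono s2" "finite_moments \<mu>2"
    and r: "r > 0" and A: "A \<in> sets borel" "A \<subseteq> {x. r < norm x}"
  shows "emeasure \<mu>1 A = emeasure \<mu>2 A"
proof (rule eq_outside_ball[OF c1(3) c2(3) r _ A])
  have sets: "sets \<mu>1 = sets borel" "sets \<mu>2 = sets borel"
    using c1(3) c2(3) by (simp_all add: finite_moments_def)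
  have eq: "emeasure \<mu>1 (halfspace \<omega> p) = emeasure \<mu>2 (halfspace \<omega> p)" if "good \<omega>" "p < - r" for \<omega> p
    using halfspace_emeasure_le[OF c1(1,2) sets(1) c2(1,2) sets(2) r that]
      halfspace_emeasure_le[OF c2(1,2) sets(2) c1(1,2) sets(1) r that] by (rule antisym)
  show "ridge_agree r \<mu>1 \<mu>2 (\<lambda>_. 1)"
  proof (rule ridge_agree_one[OF c1(3) c2(3) r])
    fix \<omega> :: 'a and e :: real assume "norm \<omega> = 1" "e > 0"
    from AE_sphere_measure_dense[OF AE_good this] eq
    show "\<exists>\<omega>'. norm \<omega>' = 1 \<and> dist \<omega>' \<omega> < e \<and>
        (\<forall>p<(- r). emeasure \<mu>1 (halfspace \<omega>' p) = emeasure \<mu>2 (halfspace \<omega>' p))" by blast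
  qed
qed

text \<open>If one test integral stayed away from its limit along a subsequence, a further
  subsequence would have a limit measure that agrees with the first one on |x| > r, and the test
  function sees nothing else.\<close>

lemma full_limit_beyond:
  assumes r: "r > 0"
  shows "\<exists>\<mu>. finite_moments \<mu> \<and> converges_beyond r id \<mu>"
proof -
  obtain s \<mu> where s: "strict_mono (s :: nat \<Rightarrow> nat)" "finite_moments \<mu>" "converges_beyond r (id \<circ> s) \<mu>"
    using subsequential_limit[OF r, of id] by (auto simp: strict_mono_def)
  have bs: "strict_mono (id \<circ> s)" using s(1) by simp
  have sets: "sets \<mu> = sets borel" using s(2) by (simp add: finite_moments_def)
  have "converges_beyond r id \<mu>"
    unfolding converges_beyond_def
  proof (intro allI impI conjI)
    fix f :: "'a \<Rightarrow> real" and B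
    assume f: "continuous_on UNIV f" "\<forall>x. \<bar>f x\<bar> \<le> B" "\<forall>x. norm x \<le> r \<longrightarrow> f x = 0"
    have fb: "\<bar>f x\<bar> \<le> B" and f0: "norm x \<le> r \<Longrightarrow> f x = 0" for x using f by auto
    have fm: "f \<in> borel_measurable borel" using f(1) by (rule borel_measurable_continuous_onI)
    show "integrable \<mu> f" by (rule converges_beyondD(1)[OF s(3) f(1) fb f0])
    show "(\<lambda>n. \<integral>x. f x \<partial>M (id n)) \<longlonglongrightarrow> (\<integral>x. f x \<partial>\<mu>)"
    proof (rule ccontr)
      assume "\<not> ?thesis"
      then obtain e where e: "e > 0" "\<And>N. \<exists>n\<ge>N. e \<le> dist (\<integral>x. f x \<partial>M n) (\<integral>x. f x \<partial>\<mu>)"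
        unfolding lim_sequentially by (auto simp: not_less)
      then have inf: "infinite {n. e \<le> dist (\<integral>x. f x \<partial>M n) (\<integral>x. f x \<partial>\<mu>)}"
        unfolding infinite_nat_iff_unbounded_le by auto
      obtain s0 where s0: "strict_mono (s0 :: nat \<Rightarrow> nat)"
        "\<And>n. s0 n \<in> {n. e \<le> dist (\<integral>x. f x \<partial>M n) (\<integral>x. f x \<partial>\<mu>)}"
        using infinite_enumerate[OF inf] by auto
      obtain s' \<mu>' where s': "strict_mono (s' :: nat \<Rightarrow> nat)" "finite_moments \<mu>'" "converges_beyond r (s0 \<circ> s') \<mu>'"
        using subsequential_limit[OF r s0(1)] by blast
      have sets': "sets \<mu>' = sets borel" using s'(2) by (simp add: finite_moments_def)
      have "(\<integral>x. f x \<partial>\<mu>') = (\<integral>x. f x \<partial>\<mu>)"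
        by (rule integral_eq_outside(2)[OF sets' sets
              converges_beyond_unique[OF s'(3) strict_mono_o[OF s0(1) s'(1)] s'(2) s(3) bs s(2) r] fm f0])
      moreover have "(\<lambda>n. \<integral>x. f x \<partial>M ((s0 \<circ> s') n)) \<longlonglongrightarrow> (\<integral>x. f x \<partial>\<mu>')"
        by (rule converges_beyondD(2)[OF s'(3) f(1) fb f0])
      ultimately obtain N where "dist (\<integral>x. f x \<partial>M ((s0 \<circ> s') N)) (\<integral>x. f x \<partial>\<mu>) < e"
        using e(1) unfolding lim_sequentially by force
      then show False using s0(2)[of "s' N"] by simp
    qed
  qed
  with s(2) show ?thesis by blast
qed


section \<open>Gluing the limits over all radii\<close>

text \<open>By uniqueness the limits for smaller radii extend those for larger ones, so their
  restrictions form an increasing chain of measures whose supremum is computed setwise. A compact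
  set avoiding the origin lies in one member of the exhaustion, where the mass is finite.\<close>

lemma glued_limit:
  "\<exists>\<mu>. radon0 \<mu> \<and> (\<forall>r>0. converges_beyond r id \<mu>) \<and> (\<forall>r>0. emeasure \<mu> {x. r < norm x} < \<infinity>)"
proof -
  define R where "R n = inverse (real (Suc n))" for n
  have R0: "R n > 0" for n by (simp add: R_def)
  have Rmono: "R m \<le> R n" if "n \<le> m" for n m
    unfolding R_def using that by (intro le_imp_inverse_le) auto
  have Rsmall: "\<exists>n. R n < r" if "r > 0" for r
    using reals_Archimedean[OF that] by (simp add: R_def)
  define S where "S n = {x::'a. R n < norm x}" for n
  have Sb: "S n \<in> sets borel" for n unfolding S_def by measurable
  have Smono: "S n \<subseteq> S m" if "n \<le> m" for n m
    using Rmono[OF that] by (auto simp: S_def)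
  have "\<forall>n. \<exists>\<nu>. finite_moments \<nu> \<and> converges_beyond (R n) id \<nu>"
    using full_limit_beyond R0 by blast
  then obtain \<nu> where \<nu>: "\<And>n. finite_moments (\<nu> n)" "\<And>n. converges_beyond (R n) id (\<nu> n)"
    by metis
  have \<nu>s: "sets (\<nu> n) = sets borel" for n using \<nu>(1)[of n] by (simp add: finite_moments_def)
  have \<nu>fin: "emeasure (\<nu> n) A < \<infinity>" for n A
  proof -
    interpret finite_measure "\<nu> n" using \<nu>(1)[of n] by (simp add: finite_moments_def)
    show ?thesis by (simp add: less_top[symmetric])
  qed
  have idm: "strict_mono (id :: nat \<Rightarrow> nat)" by (simp add: strict_mono_def)
  have agree: "emeasure (\<nu> n) A = emeasure (\<nu> m) A" if "n \<le> m" "A \<in> sets borel" "A \<subseteq> S n" for n m A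
    by (rule converges_beyond_unique[OF \<nu>(2)[of n] idm \<nu>(1) converges_beyond_mono[OF \<nu>(2)[of m] Rmono[OF that(1)]]
          idm \<nu>(1) R0 that(2)]) (use that(3) in \<open>simp add: S_def\<close>)
  \<comment> \<open>The values of \<open>\<nu> n\<close> inside its ball are meaningless; only after
    cutting them off do the measures increase with n.\<close>
  define K where "K n = density (\<nu> n) (indicator (S n))" for n
  have Ks: "sets (K n) = sets borel" for n by (simp add: K_def \<nu>s)
  have Ke: "emeasure (K n) A = emeasure (\<nu> n) (A \<inter> S n)" if A: "A \<in> sets borel" for n A
    unfolding K_def using A Sb by (simp add: emeasure_restricted \<nu>s Int_commute)
  have Kmono: "emeasure (K n) A \<le> emeasure (K m) A" if nm: "n \<le> m" and A: "A \<in> sets borel" for n m A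
  proof -
    have "emeasure (K n) A = emeasure (\<nu> m) (A \<inter> S n)"
      unfolding Ke[OF A] by (rule agree[OF nm]) (use A Sb in auto)
    also have "\<dots> \<le> emeasure (\<nu> m) (A \<inter> S m)"
      by (rule emeasure_mono) (use Smono[OF nm] A Sb in \<open>auto simp: \<nu>s\<close>)
    also have "\<dots> = emeasure (K m) A" using Ke[OF A] by simp
    finally show ?thesis .
  qed
  have Kle: "K n \<le> K m" if "n \<le> m" for n m
  proof -
    have "sets (K n) = sets (K m)" using Ks by simp
    then show ?thesis using Kmono[OF that] Ks by (simp add: le_measure)
  qed
  have chain: "Complete_Partial_Order.chain (\<le>) (range K)"
  proof (rule chainI)
    fix x y assume "x \<in> range K" "y \<in> range K"
    then obtain n m where "x = K n" "y = K m" by blast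
    then show "x \<le> y \<or> y \<le> x" using Kle[of n m] Kle[of m n] by (cases "n \<le> m") auto
  qed
  define \<mu> where "\<mu> = (SUP n. K n)"
  have \<mu>s: "sets \<mu> = sets borel" unfolding \<mu>_def by (rule sets_SUP) (simp_all add: Ks)
  have \<mu>e: "emeasure \<mu> A = (SUP n. emeasure (K n) A)" if "A \<in> sets borel" for A
    unfolding \<mu>_def by (rule emeasure_SUP_chain[of _ _ borel]) (use that Ks chain in auto)
  have \<mu>\<nu>: "emeasure \<mu> A = emeasure (\<nu> n) A" if A: "A \<in> sets borel" "A \<subseteq> S n" for A n
  proof (rule antisym)
    have KA: "emeasure (K n) A = emeasure (\<nu> n) A" using A by (simp add: Ke Int_absorb2)
    show "emeasure \<mu> A \<le> emeasure (\<nu> n) A"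
      unfolding \<mu>e[OF A(1)]
    proof (rule SUP_least)
      fix m
      show "emeasure (K m) A \<le> emeasure (\<nu> n) A"
      proof (cases "m \<le> n")
        case True
        then show ?thesis using Kmono[OF True A(1)] KA by simp
      next
        case False
        then have nm: "n \<le> m" by simp
        have "A \<subseteq> S m" using A(2) Smono[OF nm] by blast
        then have "emeasure (K m) A = emeasure (\<nu> m) A" using A(1) by (simp add: Ke Int_absorb2)
        then show ?thesis using agree[OF nm A] by simp
      qed
    qed
    show "emeasure (\<nu> n) A \<le> emeasure \<mu> A"
      unfolding \<mu>e[OF A(1)] KA[symmetric] by (rule SUP_upper) simp
  qed
  have "radon0 \<mu>"
    unfolding radon0_def
  proof (intro conjI allI impI \<mu>s)
    have "{0} \<inter> S n = {}" for n using R0[of n] by (auto simp: S_def)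
    then show "emeasure \<mu> {0} = 0" by (simp add: \<mu>e Ke)
  next
    fix C :: "'a set" assume C: "compact C \<and> 0 \<notin> C"
    then have "open (- C)" "0 \<in> - C" by (auto simp: compact_imp_closed open_Compl)
    then obtain e where e: "e > 0" "ball 0 e \<subseteq> - C" by (meson open_contains_ball)
    then obtain n where n: "R n < e" using Rsmall by blast
    have "C \<subseteq> S n"
    proof
      fix x assume "x \<in> C"
      then have "x \<notin> ball 0 e" using e(2) by blast
      then show "x \<in> S n" using n by (simp add: S_def)
    qed
    then have "emeasure \<mu> C = emeasure (\<nu> n) C" using C by (intro \<mu>\<nu>) (auto intro: borel_compact)
    then show "emeasure \<mu> C < \<infinity>" using \<nu>fin by simp
  qed
  moreover have "converges_beyond r id \<mu>" if r: "r > 0" for r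
  proof -
    obtain n where n: "R n < r" using Rsmall[OF r] by blast
    show ?thesis
      unfolding converges_beyond_def
    proof (intro allI impI)
      fix f :: "'a \<Rightarrow> real" and B
      assume f: "continuous_on UNIV f" "\<forall>x. \<bar>f x\<bar> \<le> B" "\<forall>x. norm x \<le> r \<longrightarrow> f x = 0"
      have fm: "f \<in> borel_measurable borel" using f(1) by (rule borel_measurable_continuous_onI)
      have fb: "\<bar>f x\<bar> \<le> B" and f0: "norm x \<le> R n \<Longrightarrow> f x = 0" for x using f n by auto
      have eqA: "emeasure \<mu> A = emeasure (\<nu> n) A" if "A \<in> sets borel" "A \<subseteq> {x. R n < norm x}" for A
        by (rule \<mu>\<nu>) (use that in \<open>auto simp: S_def\<close>)
      have "integrable \<mu> f \<longleftrightarrow> integrable (\<nu> n) f" "(\<integral>x. f x \<partial>\<mu>) = (\<integral>x. f x \<partial>\<nu> n)"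
        using integral_eq_outside[OF \<mu>s \<nu>s eqA fm f0] by blast+
      with converges_beyondD[OF \<nu>(2) f(1) fb f0]
      show "integrable \<mu> f \<and> (\<lambda>n. \<integral>x. f x \<partial>M (id n)) \<longlonglongrightarrow> (\<integral>x. f x \<partial>\<mu>)" by simp
    qed
  qed
  moreover have "emeasure \<mu> {x. r < norm x} < \<infinity>" if r: "r > 0" for r
  proof -
    obtain n where n: "R n < r" using Rsmall[OF r] by blast
    have "{x::'a. r < norm x} \<in> sets borel" by measurable
    then have "emeasure \<mu> {x. r < norm x} = emeasure (\<nu> n) {x. r < norm x}"
      by (rule \<mu>\<nu>) (use n in \<open>auto simp: S_def\<close>)
    then show ?thesis using \<nu>fin by simp
  qed
  ultimately show ?thesis by blast
qed


section \<open>The Radon transform of the limit\<close>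

text \<open>Where the masses converge, the sandwich bounds a from below by the mass of the open
  halfspace and from above by that of the closed one. They differ only if the hyperplane x .
  \<omega> = p has positive mass, which for each \<omega> happens for countably many p, the atoms of
  a finite measure on the line.\<close>

lemma AE_halfspace_value:
  assumes rad: "radon0 \<mu>" and conv: "\<And>r. r > 0 \<Longrightarrow> converges_beyond r id \<mu>"
    and fin: "emeasure \<mu> {x. e < norm x} < \<infinity>" and e: "e > 0"
  shows "AE z in sphere_measure \<Otimes>\<^sub>M lborel. snd z \<le> - (2 * e) \<longrightarrow>
    emeasure \<mu> (halfspace (fst z) (snd z)) = ennreal (a (fst z) (snd z)) \<and> 0 \<le> a (fst z) (snd z)"
proof -
  have sets: "sets \<mu> = sets borel" using rad by (simp add: radon0_def)
  note sets[measurable_cong]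
  have idm: "strict_mono (id :: nat \<Rightarrow> nat)" by (simp add: strict_mono_def)
  interpret S: prob_space "sphere_measure :: 'a measure" by (rule prob_space_sphere_measure)
  interpret P: pair_sigma_finite "sphere_measure :: 'a measure" "lborel :: real measure" ..
  define N where "N = density \<mu> (indicator {x. e < norm x})"
  note N_facts = restrict_outside_ball[OF sets fin, folded N_def]
  note Ns = N_facts(1) and Ne = N_facts(3)
  note Ns[measurable_cong]
  interpret N: finite_measure N by (rule N_facts(2))
  have ev_conv: "AE z in sphere_measure \<Otimes>\<^sub>M lborel. snd z < 0 \<longrightarrow> conv_at (fst z) (snd z)"
    using lim unfolding param_measure_def AE_completion_iff conv_at_def .
  have nonatom: "AE z in sphere_measure \<Otimes>\<^sub>M lborel. emeasure N {x. x \<bullet> fst z = snd z} = 0"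
  proof (rule P.AE_pair_measure)
    \<comment> \<open>The incidence set is closed, so the masses of its sections depend measurably
      on the pair. Without this the null sets of offsets for single directions could not be joined
      to a null set of pairs.\<close>
    define Q where "Q = {y :: ('a \<times> real) \<times> 'a. snd y \<bullet> fst (fst y) = snd (fst y)}"
    have "closed Q" unfolding Q_def by (intro closed_Collect_eq continuous_intros)
    then have "Q \<in> sets (borel :: (('a \<times> real) \<times> 'a) measure)" by simp
    moreover have "sets ((sphere_measure \<Otimes>\<^sub>M lborel) \<Otimes>\<^sub>M N) = sets (borel :: (('a \<times> real) \<times> 'a) measure)"
      unfolding borel_prod[symmetric] by (rule sets_pair_measure_cong) (simp_all add: sets_sphere_lborel[unfolded borel_prod[symmetric]] Ns)
    ultimately have "Q \<in> sets ((sphere_measure \<Otimes>\<^sub>M lborel) \<Otimes>\<^sub>M N)" by simp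
    then have [measurable]: "(\<lambda>z. emeasure N (Pair z -` Q)) \<in> borel_measurable (sphere_measure \<Otimes>\<^sub>M lborel)"
      by (rule N.measurable_emeasure_Pair)
    have "{z \<in> space (sphere_measure \<Otimes>\<^sub>M lborel). emeasure N (Pair z -` Q) = 0} \<in> sets (sphere_measure \<Otimes>\<^sub>M lborel)"
      by measurable
    then show "{z \<in> space (sphere_measure \<Otimes>\<^sub>M lborel). emeasure N {x. x \<bullet> fst z = snd z} = 0} \<in> sets (sphere_measure \<Otimes>\<^sub>M lborel)"
      by (simp add: Q_def vimage_def)
    show "AE \<omega> in sphere_measure. AE p in lborel. emeasure N {x. x \<bullet> fst (\<omega>, p) = snd (\<omega>, p)} = 0"
    proof (rule AE_I2)
      fix \<omega> :: 'a
      define D where "D = distr N borel (\<lambda>x. x \<bullet> \<omega>)"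
      interpret D: finite_measure D unfolding D_def by (rule N.finite_measure_distr) measurable
      have "{p. measure D {p} \<noteq> 0} \<in> null_sets lborel"
        by (rule countable_imp_null_set_lborel[OF D.countable_support])
      then have "AE p in lborel. p \<notin> {p. measure D {p} \<noteq> 0}" by (rule AE_not_in)
      then show "AE p in lborel. emeasure N {x. x \<bullet> fst (\<omega>, p) = snd (\<omega>, p)} = 0"
      proof eventually_elim
        case (elim p)
        have "emeasure D {p} = emeasure N {x. x \<bullet> \<omega> = p}"
          unfolding D_def using sets_eq_imp_space_eq[OF Ns]
          by (subst emeasure_distr) (auto intro!: arg_cong2[where f = emeasure])
        with elim show ?case by (simp add: D.emeasure_eq_measure)
      qed
    qed
  qed
  from AE_sphere_lborel_norm ev_conv nonatom show ?thesis
  proof eventually_elim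
    case (elim z)
    obtain \<omega> p where z: "z = (\<omega>, p)" by (cases z)
    show ?case
    proof (intro impI)
      assume pe: "snd z \<le> - (2 * e)"
      have p: "p \<le> - (2 * e)" "p < 0" using pe e by (auto simp: z)
      have ca: "conv_at \<omega> p" and \<omega>: "norm \<omega> = 1" using elim p by (auto simp: z)
      have at: "emeasure N {x. x \<bullet> \<omega> = p} = 0" using elim by (simp add: z)
      have far: "e < norm x" if "x \<bullet> \<omega> < - e" for x
        using Cauchy_Schwarz_ineq2[of x \<omega>] that \<omega> by simp
      have "emeasure \<mu> (halfspace \<omega> p) \<le> ennreal (a \<omega> p)"
      proof (rule LIMSEQ_le_const2[OF emeasure_halfspace_lim[OF sets, of \<omega> p]])
        have "emeasure \<mu> (halfspace \<omega> (p - inverse (real (Suc n)))) \<le> ennreal (a \<omega> p)" for n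
          by (rule halfspace_sandwich(2)[OF conv[of "- p"] idm sets _ \<omega> _ _ ca]) (use p in auto)
        then show "\<exists>N. \<forall>n\<ge>N. emeasure \<mu> (halfspace \<omega> (p - inverse (real (Suc n)))) \<le> ennreal (a \<omega> p)" by blast
      qed
      moreover have "ennreal (a \<omega> p) \<le> emeasure \<mu> (halfspace \<omega> p)"
      proof -
        \<comment> \<open>The factor e keeps the enlarged offsets at most -e, so these halfspaces
          remain in the region where the finite restriction \<open>N\<close> equals
          \<open>\<mu>\<close>; continuity from above needs that finiteness.\<close>
        define H where "H n = halfspace \<omega> (p + e * inverse (real (Suc n)))" for n
        have q: "p < p + e * inverse (real (Suc n))" "p + e * inverse (real (Suc n)) \<le> - e" for n
        proof -
          have i: "0 < inverse (real (Suc n))" "inverse (real (Suc n)) \<le> 1" by (auto simp: divide_simps)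
          then show "p < p + e * inverse (real (Suc n))" using e by simp
          have "e * inverse (real (Suc n)) \<le> e * 1" using i e by (intro mult_left_mono) auto
          then show "p + e * inverse (real (Suc n)) \<le> - e" using p by linarith
        qed
        have NH: "emeasure N A = emeasure \<mu> A" if "A \<in> sets borel" "A \<subseteq> {x. x \<bullet> \<omega> < - e}" for A
          using that far by (subst Ne) (auto intro!: arg_cong2[where f = emeasure])
        have Hsub: "H n \<subseteq> {x. x \<bullet> \<omega> < - e}" for n using q(2)[of n] by (auto simp: H_def halfspace_def)
        have "decseq H"
          unfolding decseq_def H_def halfspace_def
        proof (intro allI impI subsetI)
          fix m n :: nat and x :: 'a
          assume mn: "m \<le> n" and x: "x \<in> {x. x \<bullet> \<omega> < p + e * inverse (real (Suc n))}"
          have "inverse (real (Suc n)) \<le> inverse (real (Suc m))" using mn by (intro le_imp_inverse_le) auto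
          then have "e * inverse (real (Suc n)) \<le> e * inverse (real (Suc m))" using e by (intro mult_left_mono) auto
          then show "x \<in> {x. x \<bullet> \<omega> < p + e * inverse (real (Suc m))}" using x unfolding mem_Collect_eq by linarith
        qed
        moreover have "range H \<subseteq> sets N" by (auto simp: H_def Ns)
        ultimately have lim': "(\<lambda>n. emeasure N (H n)) \<longlonglongrightarrow> emeasure N (\<Inter>n. H n)"
          by (intro Lim_emeasure_decseq) (simp_all add: N.emeasure_finite)
        have I: "(\<Inter>n. H n) = halfspace \<omega> p \<union> {x. x \<bullet> \<omega> = p}"
        proof (intro equalityI subsetI)
          fix x assume x: "x \<in> (\<Inter>n. H n)"
          have "x \<bullet> \<omega> \<le> p"
          proof (rule ccontr)
            assume "\<not> ?thesis"
            then have "0 < (x \<bullet> \<omega> - p) / e" using e by simp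
            then obtain n where "inverse (real (Suc n)) < (x \<bullet> \<omega> - p) / e" using reals_Archimedean by blast
            then have "e * inverse (real (Suc n)) < x \<bullet> \<omega> - p" using e by (simp add: pos_less_divide_eq mult.commute)
            moreover have "x \<in> H n" using x by blast
            ultimately show False unfolding H_def halfspace_def mem_Collect_eq by linarith
          qed
          then show "x \<in> halfspace \<omega> p \<union> {x. x \<bullet> \<omega> = p}" by (auto simp: halfspace_def)
        next
          fix x assume x: "x \<in> halfspace \<omega> p \<union> {x. x \<bullet> \<omega> = p}"
          have "x \<in> H n" for n using x q(1)[of n] unfolding H_def halfspace_def by auto
          then show "x \<in> (\<Inter>n. H n)" by blast
        qed
        have "ennreal (a \<omega> p) \<le> emeasure N (H n)" for n
        proof -
          have "ennreal (a \<omega> p) \<le> emeasure \<mu> (H n)"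
            unfolding H_def by (rule halfspace_sandwich(1)[OF conv[OF e] idm sets e \<omega> q ca])
          also have "\<dots> = emeasure N (H n)" by (rule NH[symmetric]) (use Hsub in \<open>auto simp: H_def\<close>)
          finally show ?thesis .
        qed
        then have "ennreal (a \<omega> p) \<le> emeasure N (\<Inter>n. H n)"
          by (intro LIMSEQ_le_const[OF lim']) blast
        also have "\<dots> \<le> emeasure N (halfspace \<omega> p) + emeasure N {x. x \<bullet> \<omega> = p}"
          unfolding I by (rule emeasure_subadditive) (auto simp: Ns)
        also have "\<dots> = emeasure \<mu> (halfspace \<omega> p)"
          using at NH[of "halfspace \<omega> p"] p e by (simp add: halfspace_def subset_eq)
        finally show ?thesis .
      qed
      ultimately show "emeasure \<mu> (halfspace (fst z) (snd z)) = ennreal (a (fst z) (snd z)) \<and> 0 \<le> a (fst z) (snd z)"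
        using ca by (auto simp: z conv_at_def intro: antisym)
    qed
  qed
qed


text \<open>Writing \<psi>(\<omega>, x . \<omega>) as an integral of its p-derivative over p > x .
  \<omega> and exchanging integrals makes the inner integral over x the mass of the halfspace of
  offset p, which is a almost everywhere. Only halfspaces missing the ball of radius e occur, so
  \<open>\<mu>\<close> may be replaced by a finite measure.\<close>

lemma radon_transform_identity:
  assumes rad: "radon0 \<mu>" and conv: "\<And>r. r > 0 \<Longrightarrow> converges_beyond r id \<mu>"
    and fin: "\<And>r. r > 0 \<Longrightarrow> emeasure \<mu> {x. r < norm x} < \<infinity>" and \<psi>: "test_fun \<psi>"
  shows "integrable \<mu> (Rstar \<psi>)"
    and "integrable param_measure (\<lambda>z. a (fst z) (snd z) * dp \<psi> z)"
    and "(\<integral>x. Rstar \<psi> x \<partial>\<mu>) = - (\<integral>z. a (fst z) (snd z) * dp \<psi> z \<partial>param_measure)"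
proof -
  have sm: "smooth_fun \<psi>" using \<psi> by (simp add: test_fun_def)
  obtain e B where e: "0 < e" "2 * e < B"
    and \<psi>0: "\<And>\<omega> p. norm \<omega> = 1 \<Longrightarrow> p > - (2 * e) \<or> p < - B \<Longrightarrow> \<psi> (\<omega>, p) = 0"
    using test_fun_strip[OF \<psi>] by metis
  have \<psi>c: "continuous_on UNIV \<psi>" using sm by (rule smooth_fun_continuous)
  have dpc: "continuous_on UNIV (dp \<psi>)" using sm by (rule smooth_fun_dp(1))
  note FTC = ridge_as_halfspace_integral[OF sm _ e \<psi>0]
  interpret S: prob_space "sphere_measure :: 'a measure" by (rule prob_space_sphere_measure)
  interpret SL: pair_sigma_finite "sphere_measure :: 'a measure" "lborel :: real measure" ..
  define P where "P = (sphere_measure :: 'a measure) \<Otimes>\<^sub>M (lborel :: real measure)"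
  have sP: "sets P = sets borel"
    unfolding P_def by (rule sets_sphere_lborel)
  interpret P: sigma_finite_measure P
    unfolding P_def by (rule sigma_finite_pair_measure) unfold_locales
  have sets: "sets \<mu> = sets borel" using rad by (simp add: radon0_def)
  define N where "N = density \<mu> (indicator {x. e < norm x})"
  note N_facts = restrict_outside_ball[OF sets fin[OF e(1)], folded N_def]
  note Ns = N_facts(1) and Ne = N_facts(3)
  interpret N: finite_measure N by (rule N_facts(2))
  interpret NP: pair_sigma_finite N P ..
  have sNP: "sets (N \<Otimes>\<^sub>M P) = sets (borel :: ('a \<times> 'a \<times> real) measure)"
    unfolding borel_prod[symmetric, where 'a='a and 'b="'a \<times> real"]
    by (rule sets_pair_measure_cong) (simp_all add: Ns sP)
  \<comment> \<open>The test function is controlled only on the unit sphere, while the surface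
    measure is a Borel measure on the whole space. Cutting to |\<omega>| = 1 makes \<open>g\<close>
    bounded everywhere and changes it on a null set of directions only.\<close>
  define strip where "strip = {z :: 'a \<times> real. norm (fst z) = 1 \<and> - B - 1 \<le> snd z \<and> snd z \<le> - e}"
  define g where "g z = indicator strip z * dp \<psi> z" for z
  have strip: "closed strip"
    unfolding strip_def by (intro closed_Collect_conj closed_Collect_eq closed_Collect_le continuous_intros)
  have gm: "g \<in> borel_measurable borel"
    unfolding g_def using strip borel_measurable_continuous_onI[OF dpc]
    by (intro borel_measurable_times borel_measurable_indicator) auto
  have "compact (sphere (0::'a) 1 \<times> {-B-1..-e})" by (intro compact_Times) auto
  then have "bounded (dp \<psi> ` (sphere (0::'a) 1 \<times> {-B-1..-e}))"
    by (intro compact_imp_bounded compact_continuous_image continuous_on_subset[OF dpc]) auto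
  then obtain L where L: "L > 0" "\<And>z. z \<in> sphere (0::'a) 1 \<times> {-B-1..-e} \<Longrightarrow> \<bar>dp \<psi> z\<bar> \<le> L"
    unfolding bounded_pos by (metis imageI real_norm_def)
  have gL: "\<bar>g z\<bar> \<le> L * indicator (UNIV \<times> {-B-1..-e}) z" for z
  proof (cases "z \<in> strip")
    case True
    then have "z \<in> sphere 0 1 \<times> {-B-1..-e}" by (cases z) (auto simp: strip_def)
    then show ?thesis using L(2)[of z] True by (auto simp: g_def indicator_def)
  qed (use L(1) in \<open>simp add: g_def\<close>)
  have slab: "integrable P (\<lambda>z. L * indicator (UNIV \<times> {-B-1..-e}) z)"
  proof (intro integrable_mult_right integrable_real_indicator)
    have "space (sphere_measure :: 'a measure) = UNIV" using sets_eq_imp_space_eq[OF sets_sphere_measure] by simp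
    then have 1: "emeasure (sphere_measure :: 'a measure) UNIV = 1" using S.emeasure_space_1 by simp
    show "UNIV \<times> {-B-1..-e} \<in> sets P" unfolding P_def by (intro pair_measureI) auto
    have "emeasure P (UNIV \<times> {-B-1..-e}) = emeasure (sphere_measure :: 'a measure) UNIV * emeasure lborel {-B-1..-e}"
      unfolding P_def by (rule lborel.emeasure_pair_measure_Times) auto
    then show "emeasure P (UNIV \<times> {-B-1..-e}) < \<infinity>" by (simp add: 1 emeasure_lborel_Icc_eq)
  qed
  \<comment> \<open>Integrating out the parameters gives minus the dual transform of
    \<open>\<psi>\<close>; integrating out x gives \<open>g\<close> times the mass of a halfspace.
    The identity compares the two orders.\<close>
  define F where "F = (\<lambda>y :: 'a \<times> 'a \<times> real. g (snd y) * indicator {y. fst y \<bullet> fst (snd y) < snd (snd y)} y)"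
  have Fm: "F \<in> borel_measurable borel"
    unfolding F_def
  proof (intro borel_measurable_times borel_measurable_indicator)
    show "(\<lambda>y :: 'a \<times> 'a \<times> real. g (snd y)) \<in> borel_measurable borel"
      by (rule measurable_compose[OF _ gm]) (intro borel_measurable_continuous_onI continuous_intros)
    have "open {y :: 'a \<times> 'a \<times> real. fst y \<bullet> fst (snd y) < snd (snd y)}"
      by (intro open_Collect_less continuous_intros)
    then show "{y :: 'a \<times> 'a \<times> real. fst y \<bullet> fst (snd y) < snd (snd y)} \<in> sets borel" by simp
  qed
  have FmNP: "F \<in> borel_measurable (N \<Otimes>\<^sub>M P)" using Fm measurable_cong_sets[OF sNP refl] by blast
  have FxP: "(\<lambda>z. F (x, z)) \<in> borel_measurable P" for x
  proof -
    have "(\<lambda>z :: 'a \<times> real. F (x, z)) \<in> borel_measurable borel"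
      by (rule measurable_compose[OF _ Fm]) (intro borel_measurable_continuous_onI continuous_intros)
    then show ?thesis using measurable_cong_sets[OF sP refl] by blast
  qed
  have FL: "\<bar>F (x, z)\<bar> \<le> L * indicator (UNIV \<times> {-B-1..-e}) z" for x z
    using gL[of z] L(1) by (auto simp: F_def indicator_def split: if_splits)
  have Fint: "integrable P (\<lambda>z. F (x, z))" for x
    by (rule Bochner_Integration.integrable_bound[OF slab FxP]) (use FL L(1) in \<open>auto intro!: AE_I2\<close>)
  have Rs: "Rstar \<psi> x = - (\<integral>z. F (x, z) \<partial>P)" for x
  proof -
    have "(\<integral>z. F (x, z) \<partial>P) = (\<integral>\<omega>. \<integral>p. F (x, \<omega>, p) \<partial>lborel \<partial>sphere_measure)"
      using SL.integral_fst'[of "\<lambda>z. F (x, z)"] Fint[of x] unfolding P_def by simp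
    also have "\<dots> = (\<integral>\<omega>. - \<psi> (\<omega>, x \<bullet> \<omega>) \<partial>sphere_measure)"
    proof (rule integral_cong_AE)
      show "(\<lambda>\<omega>. \<integral>p. F (x, \<omega>, p) \<partial>lborel) \<in> borel_measurable sphere_measure"
        using FxP[of x] unfolding P_def by (intro lborel.borel_measurable_lebesgue_integral) (simp add: case_prod_unfold)
      have "continuous_on UNIV (\<lambda>\<omega>. - \<psi> (\<omega>, x \<bullet> \<omega>))"
        by (intro continuous_intros continuous_on_compose2[OF \<psi>c]) auto
      then show "(\<lambda>\<omega>. - \<psi> (\<omega>, x \<bullet> \<omega>)) \<in> borel_measurable sphere_measure"
        using borel_measurable_continuous_onI measurable_cong_sets[OF sets_sphere_measure refl] by blast
      show "AE \<omega> in sphere_measure. (\<integral>p. F (x, \<omega>, p) \<partial>lborel) = - \<psi> (\<omega>, x \<bullet> \<omega>)"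
        using AE_sphere_measure_norm
      proof eventually_elim
        case (elim \<omega>)
        have "F (x, \<omega>, p) = indicator {-B-1..-e} p * dp \<psi> (\<omega>, p) * indicator {x \<bullet> \<omega><..} p" for p
          using elim by (simp add: F_def g_def strip_def indicator_def)
        then show ?case using FTC(2)[OF elim elim, of "x \<bullet> \<omega>"] by simp
      qed
    qed
    finally show ?thesis by (simp add: Rstar_def)
  qed
  have FNP: "integrable (N \<Otimes>\<^sub>M P) F"
  proof (rule NP.Fubini_integrable[OF FmNP])
    show "AE x in N. integrable P (\<lambda>z. F (x, z))" using Fint by simp
    show "integrable N (\<lambda>x. \<integral>z. norm (F (x, z)) \<partial>P)"
    proof (rule N.integrable_const_bound[of _ "\<integral>z. L * indicator (UNIV \<times> {-B-1..-e}) z \<partial>P"])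
      show "AE x in N. norm (\<integral>z. norm (F (x, z)) \<partial>P) \<le> (\<integral>z. L * indicator (UNIV \<times> {-B-1..-e}) z \<partial>P)"
      proof (intro AE_I2)
        fix x
        have "(\<integral>z. norm (F (x, z)) \<partial>P) \<le> (\<integral>z. L * indicator (UNIV \<times> {-B-1..-e}) z \<partial>P)"
          by (rule integral_mono[OF integrable_norm[OF Fint] slab]) (use FL in simp)
        then show "norm (\<integral>z. norm (F (x, z)) \<partial>P) \<le> (\<integral>z. L * indicator (UNIV \<times> {-B-1..-e}) z \<partial>P)"
          by simp
      qed
      show "(\<lambda>x. \<integral>z. norm (F (x, z)) \<partial>P) \<in> borel_measurable N"
        using FmNP by (intro P.borel_measurable_lebesgue_integral) (simp add: case_prod_unfold)
    qed
  qed
  have Rm: "Rstar \<psi> \<in> borel_measurable borel"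
  proof -
    have "(\<lambda>x. - (\<integral>z. F (x, z) \<partial>P)) \<in> borel_measurable N"
      using FmNP by (intro borel_measurable_uminus P.borel_measurable_lebesgue_integral) (simp add: case_prod_unfold)
    then show ?thesis unfolding Rs[abs_def] using measurable_cong_sets[OF Ns refl] by blast
  qed
  have R0: "Rstar \<psi> x = 0" if x: "norm x \<le> e" for x
  proof -
    have "F (x, z) = 0" for z
    proof (cases "z \<in> strip")
      case True
      then have "\<bar>x \<bullet> fst z\<bar> \<le> e" using Cauchy_Schwarz_ineq2[of x "fst z"] x by (simp add: strip_def)
      moreover have "snd z \<le> - e" using True by (simp add: strip_def)
      ultimately show ?thesis by (simp add: F_def)
    qed (simp add: F_def g_def)
    then show ?thesis by (simp add: Rs)
  qed
  have RN: "integrable N (Rstar \<psi>)"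
    unfolding Rs[abs_def] using NP.integrable_fst'[OF FNP] by simp
  have \<mu>N: "emeasure \<mu> A = emeasure N A" if "A \<in> sets borel" "A \<subseteq> {x. e < norm x}" for A
    using that by (simp add: Ne Int_absorb2)
  note out = integral_eq_outside[OF sets Ns \<mu>N Rm R0]
  show "integrable \<mu> (Rstar \<psi>)" using out(1) RN by simp
  have "(\<integral>x. Rstar \<psi> x \<partial>\<mu>) = (\<integral>x. Rstar \<psi> x \<partial>N)" by (rule out(2))
  also have "\<dots> = - (\<integral>x. \<integral>z. F (x, z) \<partial>P \<partial>N)" unfolding Rs by simp
  also have "(\<integral>x. \<integral>z. F (x, z) \<partial>P \<partial>N) = (\<integral>z. \<integral>x. F (x, z) \<partial>N \<partial>P)"
    using NP.Fubini_integral[of "\<lambda>x z. F (x, z)"] FNP by (simp add: case_prod_unfold)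
  finally have R1: "(\<integral>x. Rstar \<psi> x \<partial>\<mu>) = - (\<integral>z. \<integral>x. F (x, z) \<partial>N \<partial>P)" .
  define G where "G z = (\<integral>x. F (x, z) \<partial>N)" for z
  have Gint: "integrable P G" unfolding G_def using NP.integrable_snd[of "\<lambda>x z. F (x, z)"] FNP by (simp add: case_prod_unfold)
  have GH: "G z = g z * measure N (halfspace (fst z) (snd z))" for z
  proof -
    have "F (x, z) = g z * indicator (halfspace (fst z) (snd z)) x" for x
      by (simp add: F_def halfspace_def indicator_def)
    then have "G z = g z * (\<integral>x. indicator (halfspace (fst z) (snd z)) x \<partial>N)" by (simp add: G_def)
    then show ?thesis using sets_eq_imp_space_eq[OF Ns] by simp
  qed
  have AEn: "AE z in P. norm (fst z) = 1" unfolding P_def by (rule AE_sphere_lborel_norm)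
  have "AE z in P. snd z \<le> - (2 * e) \<longrightarrow>
    emeasure \<mu> (halfspace (fst z) (snd z)) = ennreal (a (fst z) (snd z)) \<and> 0 \<le> a (fst z) (snd z)"
    unfolding P_def by (rule AE_halfspace_value[OF rad conv fin[OF e(1)] e(1)])
  then have AEG: "AE z in P. G z = a (fst z) (snd z) * dp \<psi> z"
    using AEn
  proof eventually_elim
    case (elim z)
    show ?case
    proof (cases "dp \<psi> z = 0")
      case True
      then show ?thesis by (simp add: GH g_def)
    next
      case False
      have r: "- B \<le> snd z" "snd z \<le> - (2 * e)" using FTC(1)[OF elim(2) elim(2), of "snd z"] False by auto
      then have st: "z \<in> strip" using e elim(2) by (simp add: strip_def)
      have "halfspace (fst z) (snd z) \<subseteq> {x. e < norm x}"
      proof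
        fix x assume "x \<in> halfspace (fst z) (snd z)"
        then have "x \<bullet> fst z < - e" using r e by (simp add: halfspace_def)
        then show "x \<in> {x. e < norm x}" using Cauchy_Schwarz_ineq2[of x "fst z"] elim(2) by simp
      qed
      then have "emeasure N (halfspace (fst z) (snd z)) = ennreal (a (fst z) (snd z))"
        using elim(1) r(2) by (simp add: Ne Int_absorb2)
      then have "measure N (halfspace (fst z) (snd z)) = a (fst z) (snd z)"
        using elim(1) r(2) by (simp add: measure_def)
      then show ?thesis using st by (simp add: GH g_def)
    qed
  qed
  \<comment> \<open>\<open>G\<close> is measurable for the uncompleted product, the function with a
    is only almost everywhere equal to it. Passing to the completion transfers measurability,
    integrability and the value.\<close>
  have pm: "param_measure = completion P" by (simp add: param_measure_def P_def)
  have AEc: "AE z in completion P. G z = a (fst z) (snd z) * dp \<psi> z" using AEG by (rule AE_completion)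
  have Gm: "G \<in> borel_measurable P" using Gint by (rule borel_measurable_integrable)
  have am: "(\<lambda>z. a (fst z) (snd z) * dp \<psi> z) \<in> borel_measurable (completion P)"
    by (rule borel_measurable_completion_AE[OF AEc Gm])
  have "integrable (completion P) G" using Gint integrable_completion[OF Gm] by simp
  then show "integrable param_measure (\<lambda>z. a (fst z) (snd z) * dp \<psi> z)"
    unfolding pm using integrable_cong_AE[OF measurable_completion[OF Gm] am AEc] by simp
  have "(\<integral>z. G z \<partial>P) = (\<integral>z. a (fst z) (snd z) * dp \<psi> z \<partial>param_measure)"
    unfolding pm integral_completion[OF Gm, symmetric]
    by (rule integral_cong_AE[OF measurable_completion[OF Gm] am AEc])
  then show "(\<integral>x. Rstar \<psi> x \<partial>\<mu>) = - (\<integral>z. a (fst z) (snd z) * dp \<psi> z \<partial>param_measure)"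
    using R1 by (simp add: G_def)
qed

lemma admissible_converges:
  assumes conv: "\<And>r. r > 0 \<Longrightarrow> converges_beyond r id \<mu>" and \<phi>: "admissible \<phi>"
  shows "integrable \<mu> \<phi>" "(\<lambda>k. \<integral>x. \<phi> x \<partial>M k) \<longlonglongrightarrow> (\<integral>x. \<phi> x \<partial>\<mu>)"
proof -
  obtain r where r: "r > 0" "\<And>x. norm x < r \<Longrightarrow> \<phi> x = 0" and c: "continuous_on UNIV \<phi>" and b: "bounded (range \<phi>)"
    using \<phi> unfolding admissible_def by blast
  obtain B where B: "\<And>x. \<bar>\<phi> x\<bar> \<le> B" using b unfolding bounded_iff by auto
  \<comment> \<open>Admissible functions vanish on an open ball, whereas
    \<open>converges_beyond\<close> asks for a closed one; half the radius reconciles them.\<close>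
  have r2: "r / 2 > 0" using r(1) by simp
  have z: "\<phi> x = 0" if "norm x \<le> r / 2" for x using r that by simp
  show "integrable \<mu> \<phi>" "(\<lambda>k. \<integral>x. \<phi> x \<partial>M k) \<longlonglongrightarrow> (\<integral>x. \<phi> x \<partial>\<mu>)"
    using converges_beyondD[OF conv[OF r2] c B z] by simp_all
qed

end

text \<open>A signed Radon measure is represented by a pair of non-negative ones, as in its Jordan
  decomposition, so uniqueness ranges over differences \<open>\<nu>1\<close> -
  \<open>\<nu>2\<close>; they are compared on compact sets, where both masses are finite. The minus
  sign in the last clause is the one of the distributional derivative.\<close>

theorem mainTheorem10:
  fixes M :: "nat \<Rightarrow> 'a::euclidean_space measure"
    and a :: "'a \<Rightarrow> real \<Rightarrow> real"
  assumes radon: "\<And>k. radon0 (M k)"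
    and lim: "AE z in param_measure. snd z < 0 \<longrightarrow>
               0 \<le> a (fst z) (snd z) \<and>
               (\<lambda>k. emeasure (M k) (halfspace (fst z) (snd z)))
                  \<longlonglongrightarrow> ennreal (a (fst z) (snd z))"
    and decay: "\<And>m::nat. \<exists>C. \<exists>P<0. \<forall>\<omega>\<in>sphere 0 1. \<forall>p\<le>P.
                  \<bar>a \<omega> p\<bar> \<le> C * \<bar>p\<bar> powr (- real m)"
  shows "\<exists>\<mu>. radon0 \<mu> \<and>
           (\<forall>\<phi>. admissible \<phi> \<longrightarrow> integrable \<mu> \<phi> \<and>
                 (\<lambda>k. \<integral>x. \<phi> x \<partial>M k) \<longlonglongrightarrow> (\<integral>x. \<phi> x \<partial>\<mu>)) \<and>
           (\<forall>\<nu>1 \<nu>2. radon0 \<nu>1 \<and> radon0 \<nu>2 \<and>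
              (\<forall>\<phi>. admissible \<phi> \<longrightarrow> integrable \<nu>1 \<phi> \<and> integrable \<nu>2 \<phi> \<and>
                 (\<lambda>k. \<integral>x. \<phi> x \<partial>M k) \<longlonglongrightarrow> (\<integral>x. \<phi> x \<partial>\<nu>1) - (\<integral>x. \<phi> x \<partial>\<nu>2))
              \<longrightarrow> (\<forall>K. compact K \<and> 0 \<notin> K \<longrightarrow>
                     measure \<nu>1 K - measure \<nu>2 K = measure \<mu> K)) \<and>
           (\<forall>\<psi>. test_fun \<psi> \<longrightarrow>
              integrable \<mu> (Rstar \<psi>) \<and>
              integrable param_measure (\<lambda>z. a (fst z) (snd z) * dp \<psi> z) \<and>
              (\<integral>x. Rstar \<psi> x \<partial>\<mu>) = - (\<integral>z. a (fst z) (snd z) * dp \<psi> z \<partial>param_measure))"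
proof -
  interpret halfspace_limits M a by unfold_locales (fact radon lim decay)+
  obtain \<mu> where \<mu>: "radon0 \<mu>" "\<And>r. r > 0 \<Longrightarrow> converges_beyond r id \<mu>"
    "\<And>r. r > 0 \<Longrightarrow> emeasure \<mu> {x. r < norm x} < \<infinity>"
    using glued_limit by blast
  have adm: "integrable \<mu> \<phi>" "(\<lambda>k. \<integral>x. \<phi> x \<partial>M k) \<longlonglongrightarrow> (\<integral>x. \<phi> x \<partial>\<mu>)" if "admissible \<phi>" for \<phi>
  proof -
    show "integrable \<mu> \<phi>" by (rule admissible_converges(1)[OF \<mu>(2) that])
    show "(\<lambda>k. \<integral>x. \<phi> x \<partial>M k) \<longlonglongrightarrow> (\<integral>x. \<phi> x \<partial>\<mu>)" by (rule admissible_converges(2)[OF \<mu>(2) that])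
  qed
  have rad: "integrable \<mu> (Rstar \<psi>)" "integrable param_measure (\<lambda>z. a (fst z) (snd z) * dp \<psi> z)"
    "(\<integral>x. Rstar \<psi> x \<partial>\<mu>) = - (\<integral>z. a (fst z) (snd z) * dp \<psi> z \<partial>param_measure)" if "test_fun \<psi>" for \<psi>
  proof -
    show "integrable \<mu> (Rstar \<psi>)" by (rule radon_transform_identity(1)[OF \<mu> that])
    show "integrable param_measure (\<lambda>z. a (fst z) (snd z) * dp \<psi> z)" by (rule radon_transform_identity(2)[OF \<mu> that])
    show "(\<integral>x. Rstar \<psi> x \<partial>\<mu>) = - (\<integral>z. a (fst z) (snd z) * dp \<psi> z \<partial>param_measure)"
      by (rule radon_transform_identity(3)[OF \<mu> that])
  qed
  have uniq: "measure \<nu>1 K - measure \<nu>2 K = measure \<mu> K"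
    if "radon0 \<nu>1" "radon0 \<nu>2" and K: "compact K" "0 \<notin> K"
      and \<nu>: "\<And>\<phi>. admissible \<phi> \<Longrightarrow> integrable \<nu>1 \<phi> \<and> integrable \<nu>2 \<phi> \<and>
        (\<lambda>k. \<integral>x. \<phi> x \<partial>M k) \<longlonglongrightarrow> (\<integral>x. \<phi> x \<partial>\<nu>1) - (\<integral>x. \<phi> x \<partial>\<nu>2)"
    for \<nu>1 \<nu>2 K
  proof (rule measure_compact_eq[OF \<mu>(1) that(1,2) _ K])
    fix \<phi> :: "'a \<Rightarrow> real" assume \<phi>: "admissible \<phi>"
    show "integrable \<mu> \<phi> \<and> integrable \<nu>1 \<phi> \<and> integrable \<nu>2 \<phi> \<and>
        (\<integral>x. \<phi> x \<partial>\<nu>1) - (\<integral>x. \<phi> x \<partial>\<nu>2) = (\<integral>x. \<phi> x \<partial>\<mu>)"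
      using \<nu>[OF \<phi>] adm[OF \<phi>] LIMSEQ_unique by blast
  qed
  show ?thesis
  proof (intro exI[of _ \<mu>] conjI allI impI)
    fix \<nu>1 \<nu>2 :: "'a measure" and K :: "'a set"
    assume "radon0 \<nu>1 \<and> radon0 \<nu>2 \<and>
        (\<forall>\<phi>. admissible \<phi> \<longrightarrow> integrable \<nu>1 \<phi> \<and> integrable \<nu>2 \<phi> \<and>
           (\<lambda>k. \<integral>x. \<phi> x \<partial>M k) \<longlonglongrightarrow> (\<integral>x. \<phi> x \<partial>\<nu>1) - (\<integral>x. \<phi> x \<partial>\<nu>2))"
      and "compact K \<and> 0 \<notin> K"
    then show "measure \<nu>1 K - measure \<nu>2 K = measure \<mu> K" by (intro uniq) auto
  qed (use \<mu>(1) adm rad in auto)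
qed

end
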